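(* Let $(M,g)$ be an $n$-dimensional pseudo-Riemannian manifold, $n\ge3$, let $I\subseteq\mathbb R$ be an open connected interval, let $f\colon M\to(0,\infty)$ be smooth, and let $\bar M=I_f\times M$ be the $(n+1)$-dimensional standard static space-time with metric $\bar g=-f^2\mathrm dt^2\oplus g$ and scalar curvature $\bar\tau$. Then $\bar M$ is concircularly flat if and only if (1) $\nabla_X\mathrm{grad} f=-\frac{\bar\tau f}{n(n+1)}X$ for any vector field $X$ on $M$, and (2) $(M,g)$ has constant sectional curvature $\kappa=\frac{\bar\tau}{n(n+1)}$.
   Context: A standard static space-time $I_f\times M$ is the product $I\times M$ with metric $-f^2\mathrm dt^2\oplus g$, $f$ a positive function on $M$. With $\mathcal R(X,Y)Z=\nabla_Y\nabla_XZ-\nabla_X\nabla_YZ+\nabla_{[X,Y]}Z$, the concircular curvature tensor of an $m$-dimensional pseudo-Riemannian manifold with metric $g$ and scalar curvature $\tau$ is $\mathcal C(X,Y)Z=\mathcal R(X,Y)Z-\frac{\tau}{m(m-1)}[g(X,Z)Y-g(Y,Z)X]$; the manifold is concircularly flat if $\mathcal C=0$. Here $\nabla$ and $\mathrm{grad}$ refer to $(M,g)$.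
   Formalization: M is assumed connected; for disconnected M (e.g. an open hemisphere of S^3 with f = cos r together with R^3 with f = 1) the space-time is concircularly flat but the sectional curvature is not a single constant; I is also assumed nonempty. *)

theory Defs
  imports "HOL-Analysis.Analysis"
begin

text \<open>Smooth maps between normed spaces: all iterated directional derivatives exist and are
  (totally) differentiable. Only used for maps on open subsets of Euclidean spaces.\<close>

primrec Ck_on :: "nat \<Rightarrow> 'a::real_normed_vector set \<Rightarrow> ('a \<Rightarrow> 'b::real_normed_vector) \<Rightarrow> bool" where
  "Ck_on 0 S h \<longleftrightarrow> continuous_on S h"
| "Ck_on (Suc k) S h \<longleftrightarrow>
     (\<forall>x\<in>S. h differentiable (at x)) \<and>
     (\<forall>v. Ck_on k S (\<lambda>x. frechet_derivative h (at x) v))"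

definition smooth_on :: "'a::real_normed_vector set \<Rightarrow> ('a \<Rightarrow> 'b::real_normed_vector) \<Rightarrow> bool" where
  "smooth_on S h \<longleftrightarrow> (\<forall>k. Ck_on k S h)"

text \<open>A chart is a domain together with a coordinate map whose values off the domain are
  irrelevant. A manifold is given by a (not necessarily maximal) smooth atlas; its underlying space
  is the union of the chart domains. Hausdorffness and second countability come from the type
  classes of the point type, and the dimension is that of the model space.\<close>

type_synonym ('a, 'e) chart = "'a set \<times> ('a \<Rightarrow> 'e)"

definition cdom :: "('a, 'e) chart \<Rightarrow> 'a set" where
  "cdom c = fst c"

definition cmap :: "('a, 'e) chart \<Rightarrow> 'a \<Rightarrow> 'e" where
  "cmap c = snd c"

definition cinv :: "('a, 'e) chart \<Rightarrow> 'e \<Rightarrow> 'a" where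
  "cinv c = inv_into (cdom c) (cmap c)"

definition carrier :: "('a, 'e) chart set \<Rightarrow> 'a set" where
  "carrier A = (\<Union>c\<in>A. cdom c)"

definition smooth_atlas ::
  "('a::{t2_space,second_countable_topology}, 'e::euclidean_space) chart set \<Rightarrow> bool" where
  "smooth_atlas A \<longleftrightarrow>
     (\<forall>c\<in>A. open (cdom c) \<and> open (cmap c ` cdom c) \<and>
        homeomorphism (cdom c) (cmap c ` cdom c) (cmap c) (cinv c)) \<and>
     (\<forall>c\<in>A. \<forall>d\<in>A. smooth_on (cmap c ` (cdom c \<inter> cdom d)) (cmap d \<circ> cinv c))"

definition chart_at :: "('a, 'e) chart set \<Rightarrow> 'a \<Rightarrow> ('a, 'e) chart" where
  "chart_at A p = (SOME c. c \<in> A \<and> p \<in> cdom c)"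

definition product_atlas ::
  "('a, 'e) chart set \<Rightarrow> ('b, 'f) chart set \<Rightarrow> ('a \<times> 'b, 'e \<times> 'f) chart set" where
  "product_atlas A B = {(cdom c \<times> cdom d, map_prod (cmap c) (cmap d)) |c d. c \<in> A \<and> d \<in> B}"

text \<open>A tangent vector at \<open>p\<close> is the family of its coordinate vectors in all charts around \<open>p\<close>,
  related by the Jacobians of the coordinate changes; it is 0 at every other index.
  Vector space operations are componentwise.\<close>

type_synonym ('a, 'e) tvec = "('a, 'e) chart \<Rightarrow> 'e"

definition tangent_space ::
  "('a, 'e::euclidean_space) chart set \<Rightarrow> 'a \<Rightarrow> ('a, 'e) tvec set" where
  "tangent_space A p = {v.
     (\<forall>c\<in>A. \<forall>d\<in>A. p \<in> cdom c \<longrightarrow> p \<in> cdom d \<longrightarrow>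
        v d = frechet_derivative (cmap d \<circ> cinv c) (at (cmap c p)) (v c)) \<and>
     (\<forall>c. c \<notin> A \<or> p \<notin> cdom c \<longrightarrow> v c = 0)}"

definition differential ::
  "('a, 'e::euclidean_space) chart set \<Rightarrow> ('a \<Rightarrow> real) \<Rightarrow> 'a \<Rightarrow> ('a, 'e) tvec \<Rightarrow> real" where
  "differential A h p v =
     (let c = chart_at A p in frechet_derivative (h \<circ> cinv c) (at (cmap c p)) (v c))"

definition pushforward ::
  "('a, 'e::euclidean_space) chart set \<Rightarrow> ('b, 'f::euclidean_space) chart set \<Rightarrow> ('a \<Rightarrow> 'b) \<Rightarrow> 'a
     \<Rightarrow> ('a, 'e) tvec \<Rightarrow> ('b, 'f) tvec" where
  "pushforward A B F p v = (\<lambda>d.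
     if d \<in> B \<and> F p \<in> cdom d
     then let c = chart_at A p in
       frechet_derivative (cmap d \<circ> F \<circ> cinv c) (at (cmap c p)) (v c)
     else 0)"

definition smooth_function ::
  "('a, 'e::euclidean_space) chart set \<Rightarrow> ('a \<Rightarrow> real) \<Rightarrow> bool" where
  "smooth_function A h \<longleftrightarrow> (\<forall>c\<in>A. smooth_on (cmap c ` cdom c) (h \<circ> cinv c))"

definition field_rep ::
  "('a, 'e) chart \<Rightarrow> ('a \<Rightarrow> ('a, 'e) tvec) \<Rightarrow> 'e \<Rightarrow> 'e" where
  "field_rep c X = (\<lambda>x. X (cinv c x) c)"

definition vector_field ::
  "('a, 'e::euclidean_space) chart set \<Rightarrow> ('a \<Rightarrow> ('a, 'e) tvec) \<Rightarrow> bool" where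
  "vector_field A X \<longleftrightarrow>
     (\<forall>p\<in>carrier A. X p \<in> tangent_space A p) \<and>
     (\<forall>c\<in>A. smooth_on (cmap c ` cdom c) (field_rep c X))"

text \<open>The local vector field on \<open>cdom c\<close> that has constant coordinates \<open>a\<close> in the chart \<open>c\<close>
  (for a basis vector \<open>a\<close>, a coordinate vector field), extended by 0.\<close>

definition coord_field ::
  "('a, 'e::euclidean_space) chart set \<Rightarrow> ('a, 'e) chart \<Rightarrow> 'e \<Rightarrow> 'a \<Rightarrow> ('a, 'e) tvec" where
  "coord_field A c a p = (\<lambda>d.
     if d \<in> A \<and> p \<in> cdom d \<and> p \<in> cdom c
     then frechet_derivative (cmap d \<circ> cinv c) (at (cmap c p)) a
     else 0)"

type_synonym ('a, 'e) metric = "'a \<Rightarrow> ('a, 'e) tvec \<Rightarrow> ('a, 'e) tvec \<Rightarrow> real"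

definition metric_rep ::
  "('a, 'e::euclidean_space) chart set \<Rightarrow> ('a, 'e) metric \<Rightarrow> ('a, 'e) chart
     \<Rightarrow> 'e \<Rightarrow> 'e \<Rightarrow> 'e \<Rightarrow> real" where
  "metric_rep A g c x u v =
     (let p = cinv c x in g p (coord_field A c u p) (coord_field A c v p))"

text \<open>A smooth symmetric nondegenerate bilinear form of arbitrary signature on the tangent spaces.
  The index is locally constant by continuity, hence constant when the manifold is connected.\<close>

definition pseudo_riemannian ::
  "('a::{t2_space,second_countable_topology}, 'e::euclidean_space) chart set
     \<Rightarrow> ('a, 'e) metric \<Rightarrow> bool" where
  "pseudo_riemannian A g \<longleftrightarrow>
     smooth_atlas A \<and>
     (\<forall>p\<in>carrier A.
        (\<forall>u\<in>tangent_space A p. \<forall>v\<in>tangent_space A p. g p u v = g p v u) \<and>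
        (\<forall>u\<in>tangent_space A p. \<forall>v\<in>tangent_space A p. \<forall>w\<in>tangent_space A p. \<forall>a b.
           g p (\<lambda>c. a *\<^sub>R u c + b *\<^sub>R v c) w = a * g p u w + b * g p v w) \<and>
        (\<forall>u\<in>tangent_space A p. (\<forall>v\<in>tangent_space A p. g p u v = 0) \<longrightarrow> u = (\<lambda>_. 0))) \<and>
     (\<forall>c\<in>A. \<forall>u v. smooth_on (cmap c ` cdom c) (\<lambda>x. metric_rep A g c x u v))"

text \<open>The tangent vector metrically equivalent to a linear form on the tangent space at \<open>p\<close>.\<close>

definition sharp ::
  "('a, 'e::euclidean_space) chart set \<Rightarrow> ('a, 'e) metric \<Rightarrow> 'a \<Rightarrow> (('a, 'e) tvec \<Rightarrow> real)
     \<Rightarrow> ('a, 'e) tvec" where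
  "sharp A g p \<alpha> =
     (THE z. z \<in> tangent_space A p \<and> (\<forall>w\<in>tangent_space A p. g p z w = \<alpha> w))"

definition gradient ::
  "('a, 'e::euclidean_space) chart set \<Rightarrow> ('a, 'e) metric \<Rightarrow> ('a \<Rightarrow> real) \<Rightarrow> 'a \<Rightarrow> ('a, 'e) tvec" where
  "gradient A g h p = sharp A g p (differential A h p)"

text \<open>Coordinates in the chart \<open>c\<close> of the Levi-Civita derivative at \<open>p\<close> of the constant-coordinate
  field \<open>v\<close> in direction \<open>u\<close>, from the Koszul formula; for basis vectors \<open>u\<close>, \<open>v\<close>, these are the
  Christoffel symbols.\<close>

definition christoffel ::
  "('a, 'e::euclidean_space) chart set \<Rightarrow> ('a, 'e) metric \<Rightarrow> ('a, 'e) chart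
     \<Rightarrow> 'a \<Rightarrow> 'e \<Rightarrow> 'e \<Rightarrow> 'e" where
  "christoffel A g c p u v =
     sharp A g p (\<lambda>w.
       (frechet_derivative (\<lambda>x. metric_rep A g c x v (w c)) (at (cmap c p)) u
        + frechet_derivative (\<lambda>x. metric_rep A g c x u (w c)) (at (cmap c p)) v
        - frechet_derivative (\<lambda>x. metric_rep A g c x u v) (at (cmap c p)) (w c)) / 2) c"

definition nabla ::
  "('a, 'e::euclidean_space) chart set \<Rightarrow> ('a, 'e) metric
     \<Rightarrow> ('a \<Rightarrow> ('a, 'e) tvec) \<Rightarrow> ('a \<Rightarrow> ('a, 'e) tvec) \<Rightarrow> 'a \<Rightarrow> ('a, 'e) tvec" where
  "nabla A g X Y p = (\<lambda>c.
     if c \<in> A \<and> p \<in> cdom c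
     then frechet_derivative (field_rep c Y) (at (cmap c p)) (X p c)
          + christoffel A g c p (X p c) (Y p c)
     else 0)"

definition lie_bracket ::
  "('a, 'e::euclidean_space) chart set
     \<Rightarrow> ('a \<Rightarrow> ('a, 'e) tvec) \<Rightarrow> ('a \<Rightarrow> ('a, 'e) tvec) \<Rightarrow> 'a \<Rightarrow> ('a, 'e) tvec" where
  "lie_bracket A X Y p = (\<lambda>c.
     if c \<in> A \<and> p \<in> cdom c
     then frechet_derivative (field_rep c Y) (at (cmap c p)) (X p c)
          - frechet_derivative (field_rep c X) (at (cmap c p)) (Y p c)
     else 0)"

text \<open>The sign convention for the curvature is the opposite of
  \<open>\<nabla>\<^sub>X\<nabla>\<^sub>Y - \<nabla>\<^sub>Y\<nabla>\<^sub>X - \<nabla>\<^bsub>[X,Y]\<^esub>\<close>; the contractions below are chosen so that round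
  spheres have positive sectional and scalar curvature.\<close>

definition riemann ::
  "('a, 'e::euclidean_space) chart set \<Rightarrow> ('a, 'e) metric
     \<Rightarrow> ('a \<Rightarrow> ('a, 'e) tvec) \<Rightarrow> ('a \<Rightarrow> ('a, 'e) tvec) \<Rightarrow> ('a \<Rightarrow> ('a, 'e) tvec)
     \<Rightarrow> 'a \<Rightarrow> ('a, 'e) tvec" where
  "riemann A g X Y Z p = (\<lambda>c.
     nabla A g Y (nabla A g X Z) p c - nabla A g X (nabla A g Y Z) p c
     + nabla A g (lie_bracket A X Y) Z p c)"

text \<open>The curvature on tangent vectors at \<open>p\<close>, which are extended to local vector fields with
  constant coordinates (by tensoriality the extension does not matter).\<close>

definition riemann_at ::
  "('a, 'e::euclidean_space) chart set \<Rightarrow> ('a, 'e) metric \<Rightarrow> 'a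
     \<Rightarrow> ('a, 'e) tvec \<Rightarrow> ('a, 'e) tvec \<Rightarrow> ('a, 'e) tvec \<Rightarrow> ('a, 'e) tvec" where
  "riemann_at A g p u v w =
     (let c = chart_at A p in
      riemann A g (coord_field A c (u c)) (coord_field A c (v c)) (coord_field A c (w c)) p)"

text \<open>Trace of \<open>z \<mapsto> R(u,z)v\<close>.\<close>

definition ricci ::
  "('a, 'e::euclidean_space) chart set \<Rightarrow> ('a, 'e) metric \<Rightarrow> 'a
     \<Rightarrow> ('a, 'e) tvec \<Rightarrow> ('a, 'e) tvec \<Rightarrow> real" where
  "ricci A g p u v =
     (let c = chart_at A p in
      \<Sum>b\<in>Basis. riemann_at A g p u (coord_field A c b p) v c \<bullet> b)"

text \<open>Metric trace of the Ricci tensor, i.e. trace of the Ricci operator.\<close>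

definition scalar_curvature ::
  "('a, 'e::euclidean_space) chart set \<Rightarrow> ('a, 'e) metric \<Rightarrow> 'a \<Rightarrow> real" where
  "scalar_curvature A g p =
     (let c = chart_at A p in
      \<Sum>b\<in>Basis. sharp A g p (ricci A g p (coord_field A c b p)) c \<bullet> b)"

definition sectional_curvature ::
  "('a, 'e::euclidean_space) chart set \<Rightarrow> ('a, 'e) metric \<Rightarrow> 'a
     \<Rightarrow> ('a, 'e) tvec \<Rightarrow> ('a, 'e) tvec \<Rightarrow> real" where
  "sectional_curvature A g p u v =
     g p (riemann_at A g p u v u) v / (g p u u * g p v v - (g p u v)\<^sup>2)"

text \<open>The denominator condition says that \<open>u\<close>, \<open>v\<close> span a nondegenerate tangent plane.\<close>

definition constant_sectional_curvature ::
  "('a, 'e::euclidean_space) chart set \<Rightarrow> ('a, 'e) metric \<Rightarrow> real \<Rightarrow> bool" where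
  "constant_sectional_curvature A g \<kappa> \<longleftrightarrow>
     (\<forall>p\<in>carrier A. \<forall>u\<in>tangent_space A p. \<forall>v\<in>tangent_space A p.
        g p u u * g p v v - (g p u v)\<^sup>2 \<noteq> 0 \<longrightarrow> sectional_curvature A g p u v = \<kappa>)"

definition concircular ::
  "('a, 'e::euclidean_space) chart set \<Rightarrow> ('a, 'e) metric
     \<Rightarrow> ('a \<Rightarrow> ('a, 'e) tvec) \<Rightarrow> ('a \<Rightarrow> ('a, 'e) tvec) \<Rightarrow> ('a \<Rightarrow> ('a, 'e) tvec)
     \<Rightarrow> 'a \<Rightarrow> ('a, 'e) tvec" where
  "concircular A g X Y Z p = (\<lambda>c.
     riemann A g X Y Z p c
     - (scalar_curvature A g p / (real DIM('e) * (real DIM('e) - 1))) *\<^sub>R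
         (g p (X p) (Z p) *\<^sub>R Y p c - g p (Y p) (Z p) *\<^sub>R X p c))"

definition concircularly_flat ::
  "('a, 'e::euclidean_space) chart set \<Rightarrow> ('a, 'e) metric \<Rightarrow> bool" where
  "concircularly_flat A g \<longleftrightarrow>
     (\<forall>X Y Z. vector_field A X \<longrightarrow> vector_field A Y \<longrightarrow> vector_field A Z \<longrightarrow>
        (\<forall>p\<in>carrier A. concircular A g X Y Z p = (\<lambda>_. 0)))"

text \<open>The standard static space-time: the product manifold \<open>I \<times> M\<close> with the metric
  \<open>- f\<^sup>2 dt\<^sup>2 \<oplus> g\<close>, where \<open>t\<close> and the projection to \<open>M\<close> are the two projections.\<close>

definition static_atlas ::
  "real set \<Rightarrow> ('a, 'e) chart set \<Rightarrow> (real \<times> 'a, real \<times> 'e) chart set" where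
  "static_atlas I A = product_atlas {(I, \<lambda>t. t)} A"

definition static_metric ::
  "real set \<Rightarrow> ('a, 'e::euclidean_space) chart set \<Rightarrow> ('a, 'e) metric \<Rightarrow> ('a \<Rightarrow> real)
     \<Rightarrow> (real \<times> 'a, real \<times> 'e) metric" where
  "static_metric I A g f q u v =
     (let B = static_atlas I A in
      - (f (snd q))\<^sup>2 * differential B fst q u * differential B fst q v
      + g (snd q) (pushforward B A snd q u) (pushforward B A snd q v))"

end

theory Submission
  imports Defs
begin

text \<open>Evaluating the curvature \<open>R'\<close> of \<open>- f\<^sup>2 dt\<^sup>2 \<oplus> g\<close> in product charts shows that
  \<open>R'(U,V)W = K (g'(U,W)V - g'(V,W)U)\<close> holds at \<open>(t, p)\<close> for all \<open>U\<close>, \<open>V\<close>, \<open>W\<close> iff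
  \<open>\<nabla>\<^sub>u grad f = - K f u\<close> and \<open>R(u,v)w = K (g(u,w)v - g(v,w)u)\<close> at \<open>p\<close>. With
  \<open>K = \<tau>' / (n (n + 1))\<close> this is the theorem pointwise, and \<open>\<tau>'\<close> itself never has to be computed.
  That \<open>K\<close> is constant follows from the Ricci identity for \<open>grad f\<close>; that constant sectional
  curvature determines \<open>R\<close> even on degenerate planes follows because both sides are polynomial and
  the nondegenerate planes are Zariski dense. Bump functions pass between global vector fields and
  tangent vectors.\<close>

text \<open>The equivalence is pointwise because each curvature component of the product isolates
  one condition: for U = W = dt and V tangent to M the spatial part is f nabla_V grad f, and since
  g'(dt, dt) = - f^2 the prescribed value is - K f^2 V; triples tangent to M give R itself, with the
  same K. The obstacle is that K is a function of (t, p) of unknown regularity, while condition (2)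
  asks for a constant. Independence of t comes from the Hessian equation, whose left side lives on M
  alone, and differentiability along M from solving the same equation for K. A second difficulty is
  that tangent vectors are families of coordinates and that several definitions refer to an
  arbitrarily chosen chart. All tensor calculus is therefore done for a metric on an open subset of
  a Euclidean space, with vectors in place of indices, and transferred once to the charts.\<close>

section \<open>Calculus of Frechet derivatives and smooth maps\<close>

lemma fd_eqI:
  "(h has_derivative h') (at x) \<Longrightarrow> frechet_derivative h (at x) = h'"
  using frechet_derivative_at by metis

lemma fd_has_derivative:
  "h differentiable (at x) \<Longrightarrow> (h has_derivative frechet_derivative h (at x)) (at x)"
  by (simp add: frechet_derivative_works)

text \<open>\<open>frechet_derivative\<close> is a choice among all derivatives at the point.
  Functions that agree near the point have the same derivatives, hence the same choice, even where
  there is none to choose from.\<close>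

lemma fd_cong:
  assumes "open S" "x \<in> S" "\<And>y. y \<in> S \<Longrightarrow> h y = k y"
  shows "frechet_derivative h (at x) = frechet_derivative k (at x)"
proof -
  have "(h has_derivative D) (at x) \<longleftrightarrow> (k has_derivative D) (at x)" for D
    using has_derivative_transform_within_open[of h D x UNIV S k]
      has_derivative_transform_within_open[of k D x UNIV S h] assms by auto
  then show ?thesis unfolding frechet_derivative_def by simp
qed

lemma differentiable_cong_open:
  assumes "open S" "x \<in> S" "\<And>y. y \<in> S \<Longrightarrow> h y = k y" "h differentiable (at x)"
  shows "k differentiable (at x)"
  using assms unfolding differentiable_def
  by (metis has_derivative_transform_within_open)

lemma Ck_on_cong:
  assumes "open S" "\<And>x. x \<in> S \<Longrightarrow> h x = k x" "Ck_on n S h"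
  shows "Ck_on n S k"
  using assms(2,3)
proof (induction n arbitrary: h k)
  case 0
  then show ?case by (metis Ck_on.simps(1) continuous_on_cong)
next
  case (Suc n)
  have "k differentiable (at x)" if "x \<in> S" for x
    using differentiable_cong_open[OF assms(1) that] Suc.prems that by auto
  moreover have "Ck_on n S (\<lambda>x. frechet_derivative k (at x) v)" for v
  proof (rule Suc.IH)
    show "Ck_on n S (\<lambda>x. frechet_derivative h (at x) v)" using Suc.prems by simp
    show "frechet_derivative h (at x) v = frechet_derivative k (at x) v" if "x \<in> S" for x
      using fd_cong[OF assms(1) that, of h k] Suc.prems(1) by simp
  qed
  ultimately show ?case by simp
qed

lemma Ck_on_subset: "Ck_on n S h \<Longrightarrow> T \<subseteq> S \<Longrightarrow> Ck_on n T h"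
  by (induction n arbitrary: h) (auto intro: continuous_on_subset)

text \<open>Both continuity and differentiability are conditions at single points. This is what
  allows smoothness of a cut-off field to be checked separately on two open sets.\<close>

lemma Ck_on_local:
  "(\<And>x. x \<in> S \<Longrightarrow> \<exists>T. open T \<and> x \<in> T \<and> Ck_on n T h) \<Longrightarrow> Ck_on n S h"
proof (induction n arbitrary: h)
  case 0
  have "isCont h x" if "x \<in> S" for x
    using 0[OF that] continuous_on_eq_continuous_at by auto
  then show ?case by (simp add: continuous_at_imp_continuous_on)
next
  case (Suc n)
  have "Ck_on n S (\<lambda>x. frechet_derivative h (at x) v)" for v
    by (rule Suc.IH) (use Suc.prems in fastforce)
  then show ?case using Suc.prems by fastforce
qed

lemma Ck_on_Suc_D: "Ck_on (Suc n) S h \<Longrightarrow> Ck_on n S h"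
proof (induction n arbitrary: h)
  case 0
  then show ?case
    by (auto intro!: continuous_at_imp_continuous_on differentiable_imp_continuous_within)
next
  case (Suc n)
  then show ?case by (metis Ck_on.simps(2))
qed

lemma Ck_on_const: "Ck_on n S (\<lambda>x. c)"
  by (induction n arbitrary: c) auto

lemma Ck_on_bounded_linear:
  assumes "bounded_linear L" shows "Ck_on n S L"
proof (cases n)
  case 0
  then show ?thesis using assms by (simp add: linear_continuous_on)
next
  case (Suc m)
  have "frechet_derivative L (at x) = L" for x
    by (rule fd_eqI) (rule bounded_linear_imp_has_derivative[OF assms])
  then show ?thesis
    using Suc assms bounded_linear_imp_differentiable Ck_on_const by auto
qed

lemma Ck_on_add:
  assumes "open S"
  shows "Ck_on n S h \<Longrightarrow> Ck_on n S k \<Longrightarrow> Ck_on n S (\<lambda>x. h x + k x)"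
proof (induction n arbitrary: h k)
  case 0
  then show ?case by (auto intro: continuous_intros)
next
  case (Suc n)
  have "frechet_derivative (\<lambda>x. h x + k x) (at x) v
    = frechet_derivative h (at x) v + frechet_derivative k (at x) v" if "x \<in> S" for x v
    using that Suc.prems
    by (subst fd_eqI[OF has_derivative_add[OF fd_has_derivative fd_has_derivative]]) auto
  moreover have "Ck_on n S (\<lambda>x. frechet_derivative h (at x) v + frechet_derivative k (at x) v)" for v
    using Suc by simp
  ultimately have "Ck_on n S (\<lambda>x. frechet_derivative (\<lambda>x. h x + k x) (at x) v)" for v
    by (rule_tac Ck_on_cong[OF assms]) auto
  then show ?case using Suc.prems by auto
qed

lemma Ck_on_bilinear:
  assumes "open S" "bounded_bilinear pr"
  shows "Ck_on n S h \<Longrightarrow> Ck_on n S k \<Longrightarrow> Ck_on n S (\<lambda>x. pr (h x) (k x))"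
proof (induction n arbitrary: h k)
  case 0
  then show ?case by (auto intro: bounded_bilinear.continuous_on[OF assms(2)])
next
  case (Suc n)
  have der: "((\<lambda>x. pr (h x) (k x)) has_derivative
     (\<lambda>v. pr (h x) (frechet_derivative k (at x) v) + pr (frechet_derivative h (at x) v) (k x))) (at x)"
    if "x \<in> S" for x
    using that Suc.prems
    by (intro bounded_bilinear.FDERIV[OF assms(2)] fd_has_derivative) auto
  have "Ck_on n S (\<lambda>x. pr (h x) (frechet_derivative k (at x) v)
      + pr (frechet_derivative h (at x) v) (k x))" for v
    using Suc Ck_on_Suc_D[of n S h] Ck_on_Suc_D[of n S k]
    by (intro Ck_on_add[OF assms(1)]) auto
  then have "Ck_on n S (\<lambda>x. frechet_derivative (\<lambda>x. pr (h x) (k x)) (at x) v)" for v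
    by (rule Ck_on_cong[OF assms(1), rotated]) (simp add: fd_eqI[OF der])
  moreover have "(\<lambda>x. pr (h x) (k x)) differentiable (at x)" if "x \<in> S" for x
    using der[OF that] unfolding differentiable_def by blast
  ultimately show ?case by simp
qed

lemma Ck_on_sum:
  assumes "open S" "finite J"
  shows "(\<And>i. i \<in> J \<Longrightarrow> Ck_on n S (h i)) \<Longrightarrow> Ck_on n S (\<lambda>x. \<Sum>i\<in>J. h i x)"
  using assms(2) by induction (auto intro: Ck_on_const Ck_on_add[OF assms(1)])

lemma linear_expand:
  fixes L :: "'a::euclidean_space \<Rightarrow> 'b::real_vector"
  assumes "linear L"
  shows "L v = (\<Sum>b\<in>Basis. (v \<bullet> b) *\<^sub>R L b)"
proof -
  have "L v = L (\<Sum>b\<in>Basis. (v \<bullet> b) *\<^sub>R b)" by (simp add: euclidean_representation)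
  then show ?thesis by (simp only: linear_sum[OF assms] linear_scale[OF assms])
qed

lemma fd_expand:
  fixes v :: "'a::euclidean_space"
  assumes "h differentiable (at x)"
  shows "frechet_derivative h (at x) v = (\<Sum>b\<in>Basis. (v \<bullet> b) *\<^sub>R frechet_derivative h (at x) b)"
  by (rule linear_expand[OF linear_frechet_derivative[OF assms]])

text \<open>The chain rule yields a composition of linear maps, to which the induction hypothesis
  does not apply. Expanding over the basis of the middle space turns it into a finite sum of
  products of a component of the derivative of \<open>\<phi>\<close> with a partial derivative of
  \<open>h\<close> at \<open>\<phi> x\<close>; the induction runs over \<open>h\<close> with
  \<open>\<phi>\<close> fixed.\<close>

lemma Ck_on_compose:
  fixes \<phi> :: "'a::real_normed_vector \<Rightarrow> 'b::euclidean_space"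
  assumes "open S" "open T" "\<And>x. x \<in> S \<Longrightarrow> \<phi> x \<in> T"
  shows "Ck_on n T h \<Longrightarrow> Ck_on n S \<phi> \<Longrightarrow> Ck_on n S (\<lambda>x. h (\<phi> x))"
proof (induction n arbitrary: h)
  case 0
  then show ?case using assms by (auto intro: continuous_on_compose2)
next
  case (Suc n)
  have der: "((\<lambda>x. h (\<phi> x)) has_derivative
     (\<lambda>v. frechet_derivative h (at (\<phi> x)) (frechet_derivative \<phi> (at x) v))) (at x)"
    if "x \<in> S" for x
    using that Suc.prems assms(3)[OF that]
      has_derivative_compose[OF fd_has_derivative fd_has_derivative, of \<phi> x h] by auto
  have "Ck_on n S (\<lambda>x. frechet_derivative (\<lambda>x. h (\<phi> x)) (at x) v)" for v
  proof (rule Ck_on_cong[OF assms(1)])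
    show "Ck_on n S (\<lambda>x. \<Sum>b\<in>Basis. (frechet_derivative \<phi> (at x) v \<bullet> b) *\<^sub>R
      frechet_derivative h (at (\<phi> x)) b)"
      using Suc.prems Suc.IH Ck_on_Suc_D[OF Suc.prems(2)]
      by (intro Ck_on_sum[OF assms(1)] Ck_on_bilinear[OF assms(1) bounded_bilinear_scaleR]
          Ck_on_bilinear[OF assms(1) bounded_bilinear_inner] Ck_on_const) auto
    show "(\<Sum>b\<in>Basis. (frechet_derivative \<phi> (at x) v \<bullet> b) *\<^sub>R frechet_derivative h (at (\<phi> x)) b)
      = frechet_derivative (\<lambda>x. h (\<phi> x)) (at x) v" if "x \<in> S" for x
      unfolding fd_eqI[OF der[OF that]]
      by (rule fd_expand[symmetric]) (use Suc.prems assms(3) that in auto)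
  qed
  moreover have "(\<lambda>x. h (\<phi> x)) differentiable (at x)" if "x \<in> S" for x
    using der[OF that] unfolding differentiable_def by blast
  ultimately show ?case by simp
qed

lemma smooth_on_cong:
  "open S \<Longrightarrow> (\<And>x. x \<in> S \<Longrightarrow> h x = k x) \<Longrightarrow> smooth_on S h \<Longrightarrow> smooth_on S k"
  unfolding smooth_on_def using Ck_on_cong by blast

lemma smooth_on_subset: "smooth_on S h \<Longrightarrow> T \<subseteq> S \<Longrightarrow> smooth_on T h"
  unfolding smooth_on_def using Ck_on_subset by blast

lemma smooth_on_Un:
  "open S \<Longrightarrow> open T \<Longrightarrow> smooth_on S h \<Longrightarrow> smooth_on T h \<Longrightarrow> smooth_on (S \<union> T) h"
  unfolding smooth_on_def using Ck_on_local[of "S \<union> T" _ h] by blast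

lemma smooth_on_const: "smooth_on S (\<lambda>x. c)"
  unfolding smooth_on_def using Ck_on_const by blast

lemma smooth_on_bounded_linear: "bounded_linear L \<Longrightarrow> smooth_on S L"
  unfolding smooth_on_def using Ck_on_bounded_linear by blast

lemma smooth_on_add:
  "open S \<Longrightarrow> smooth_on S h \<Longrightarrow> smooth_on S k \<Longrightarrow> smooth_on S (\<lambda>x. h x + k x)"
  unfolding smooth_on_def using Ck_on_add by blast

lemma smooth_on_bilinear:
  "open S \<Longrightarrow> bounded_bilinear pr \<Longrightarrow> smooth_on S h \<Longrightarrow> smooth_on S k \<Longrightarrow>
    smooth_on S (\<lambda>x. pr (h x) (k x))"
  unfolding smooth_on_def using Ck_on_bilinear by blast

lemma smooth_on_compose:
  fixes \<phi> :: "'a::real_normed_vector \<Rightarrow> 'b::euclidean_space"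
  shows "open S \<Longrightarrow> open T \<Longrightarrow> (\<And>x. x \<in> S \<Longrightarrow> \<phi> x \<in> T) \<Longrightarrow> smooth_on T h \<Longrightarrow>
    smooth_on S \<phi> \<Longrightarrow> smooth_on S (\<lambda>x. h (\<phi> x))"
  unfolding smooth_on_def using Ck_on_compose[of S T \<phi>] by blast

lemma smooth_on_fd: "smooth_on S h \<Longrightarrow> smooth_on S (\<lambda>x. frechet_derivative h (at x) v)"
  unfolding smooth_on_def by (metis Ck_on.simps(2))

lemma smooth_on_differentiable: "smooth_on S h \<Longrightarrow> x \<in> S \<Longrightarrow> h differentiable (at x)"
  unfolding smooth_on_def by (metis Ck_on.simps(2))

lemma smooth_on_has_derivative:
  "smooth_on S h \<Longrightarrow> x \<in> S \<Longrightarrow> (h has_derivative frechet_derivative h (at x)) (at x)"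
  using smooth_on_differentiable fd_has_derivative by blast

lemma smooth_on_continuous: "smooth_on S h \<Longrightarrow> continuous_on S h"
  unfolding smooth_on_def by (metis Ck_on.simps(1))

lemma fd_linear:
  assumes "smooth_on S h" "x \<in> S"
  shows "linear (frechet_derivative h (at x))"
  using linear_frechet_derivative smooth_on_differentiable assms by blast

subsection \<open>Symmetry of second derivatives\<close>

text \<open>The mean value theorem is applied along \<open>u\<close> to the difference in direction
  \<open>v\<close>, and once more along \<open>v\<close> to the derivative in direction
  \<open>u\<close>. The left side is symmetric in \<open>u\<close> and \<open>v\<close>, so the same
  lemma with the directions exchanged controls the other mixed derivative.\<close>

lemma second_difference_mvt:
  fixes h :: "'a::real_normed_vector \<Rightarrow> real"
  assumes h: "smooth_on S h" and s: "s > 0"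
    and sub: "\<And>\<alpha> \<beta>. \<alpha> \<in> {0..s} \<Longrightarrow> \<beta> \<in> {0..s} \<Longrightarrow> x + \<alpha> *\<^sub>R u + \<beta> *\<^sub>R v \<in> S"
  shows "\<exists>\<alpha>\<in>{0..s}. \<exists>\<beta>\<in>{0..s}. h (x + s *\<^sub>R u + s *\<^sub>R v) - h (x + s *\<^sub>R u) - h (x + s *\<^sub>R v) + h x
      = s * (s * frechet_derivative (\<lambda>y. frechet_derivative h (at y) u) (at (x + \<alpha> *\<^sub>R u + \<beta> *\<^sub>R v)) v)"
proof -
  let ?hu = "\<lambda>y. frechet_derivative h (at y) u"
  let ?F = "\<lambda>\<sigma>. h (x + \<sigma> *\<^sub>R u + s *\<^sub>R v) - h (x + \<sigma> *\<^sub>R u)"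
  have d1: "((\<lambda>\<sigma>. h (x + \<sigma> *\<^sub>R u + c *\<^sub>R v)) has_field_derivative ?hu (x + \<sigma> *\<^sub>R u + c *\<^sub>R v)) (at \<sigma>)"
    if "\<sigma> \<in> {0..s}" "c \<in> {0..s}" for \<sigma> c
  proof -
    let ?p = "x + \<sigma> *\<^sub>R u + c *\<^sub>R v"
    have hd: "(h has_derivative frechet_derivative h (at ?p)) (at ?p)"
      using smooth_on_has_derivative[OF h sub[OF that]] .
    have "((\<lambda>\<sigma>. x + \<sigma> *\<^sub>R u + c *\<^sub>R v) has_derivative (\<lambda>r. r *\<^sub>R u)) (at \<sigma>)"
      by (auto intro!: derivative_eq_intros)
    from has_derivative_compose[OF this hd]
    show ?thesis
      by (rule has_derivative_imp_has_field_derivative)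
        (simp add: linear_scale[OF has_derivative_linear[OF hd]])
  qed
  have d2: "((\<lambda>\<tau>. ?hu (x + a *\<^sub>R u + \<tau> *\<^sub>R v)) has_field_derivative
      frechet_derivative ?hu (at (x + a *\<^sub>R u + \<tau> *\<^sub>R v)) v) (at \<tau>)"
    if "\<tau> \<in> {0..s}" "a \<in> {0..s}" for \<tau> a
  proof -
    let ?p = "x + a *\<^sub>R u + \<tau> *\<^sub>R v"
    have hd: "(?hu has_derivative frechet_derivative ?hu (at ?p)) (at ?p)"
      using smooth_on_has_derivative[OF smooth_on_fd[OF h] sub[OF that(2,1)]] .
    have "((\<lambda>\<tau>. x + a *\<^sub>R u + \<tau> *\<^sub>R v) has_derivative (\<lambda>r. r *\<^sub>R v)) (at \<tau>)"
      by (auto intro!: derivative_eq_intros)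
    from has_derivative_compose[OF this hd]
    show ?thesis
      by (rule has_derivative_imp_has_field_derivative)
        (simp add: linear_scale[OF has_derivative_linear[OF hd]])
  qed
  have "(?F has_field_derivative ?hu (x + \<sigma> *\<^sub>R u + s *\<^sub>R v) - ?hu (x + \<sigma> *\<^sub>R u)) (at \<sigma>)"
    if "\<sigma> \<in> {0..s}" for \<sigma>
    using DERIV_diff[OF d1[OF that, of s] d1[OF that, of 0]] s by simp
  then obtain a where a: "a \<in> {0<..<s}"
    and Fa: "?F s - ?F 0 = (s - 0) * (?hu (x + a *\<^sub>R u + s *\<^sub>R v) - ?hu (x + a *\<^sub>R u))"
    using MVT2[OF s, of ?F "\<lambda>\<sigma>. ?hu (x + \<sigma> *\<^sub>R u + s *\<^sub>R v) - ?hu (x + \<sigma> *\<^sub>R u)"] by auto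
  have db: "((\<lambda>\<tau>. ?hu (x + a *\<^sub>R u + \<tau> *\<^sub>R v)) has_field_derivative
      frechet_derivative ?hu (at (x + a *\<^sub>R u + \<tau> *\<^sub>R v)) v) (at \<tau>)"
    if "0 \<le> \<tau>" "\<tau> \<le> s" for \<tau>
    using d2[of \<tau> a] that a by simp
  obtain b where b: "0 < b" "b < s"
    and "?hu (x + a *\<^sub>R u + s *\<^sub>R v) - ?hu (x + a *\<^sub>R u + 0 *\<^sub>R v)
      = (s - 0) * frechet_derivative ?hu (at (x + a *\<^sub>R u + b *\<^sub>R v)) v"
    using MVT2[OF s db] by blast
  then show ?thesis using Fa a b by (intro bexI[of _ a] bexI[of _ b]) (auto simp: algebra_simps)
qed

lemma fd_symmetric_real:
  fixes h :: "'a::real_normed_vector \<Rightarrow> real"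
  assumes "open S" "x \<in> S" and h: "smooth_on S h"
  shows "frechet_derivative (\<lambda>y. frechet_derivative h (at y) u) (at x) v
       = frechet_derivative (\<lambda>y. frechet_derivative h (at y) v) (at x) u" (is "?A x = ?B x")
proof (rule ccontr)
  assume "?A x \<noteq> ?B x"
  \<comment> \<open>Half the gap: if both mixed derivatives stay within \<open>e\<close> of their
    values at \<open>x\<close>, they cannot coincide anywhere nearby, yet the second difference
    forces a common value.\<close>
  define e where "e = \<bar>?A x - ?B x\<bar> / 2"
  have e: "e > 0" using \<open>?A x \<noteq> ?B x\<close> unfolding e_def by simp
  have "isCont ?A x" "isCont ?B x"
    using smooth_on_continuous[OF smooth_on_fd[OF smooth_on_fd[OF h]]] assms(1,2)
    by (auto simp: continuous_on_eq_continuous_at)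
  then have "\<exists>d>0. \<forall>y. dist y x < d \<longrightarrow> dist (?A y) (?A x) < e"
    "\<exists>d>0. \<forall>y. dist y x < d \<longrightarrow> dist (?B y) (?B x) < e"
    using e unfolding continuous_at_eps_delta by simp_all
  then obtain d1 d2 where d: "d1 > 0" "d2 > 0"
    and A: "\<And>y. dist y x < d1 \<Longrightarrow> dist (?A y) (?A x) < e"
    and B: "\<And>y. dist y x < d2 \<Longrightarrow> dist (?B y) (?B x) < e"
    by metis
  obtain d3 where d3: "d3 > 0" "ball x d3 \<subseteq> S" using assms(1,2) openE by blast
  define m where "m = min d1 (min d2 d3)"
  \<comment> \<open>This size keeps the whole parallelogram within distance \<open>m / 2\<close> of
    \<open>x\<close>; the summand 1 makes the denominator positive when both directions
    vanish.\<close>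
  define s where "s = m / (2 * (norm u + norm v + 1))"
  have m: "m > 0" using d d3 unfolding m_def by simp
  have s: "s > 0" unfolding s_def using m by (simp add: add_nonneg_pos)
  have near: "dist (x + \<alpha> *\<^sub>R u + \<beta> *\<^sub>R v) x < m" if "\<alpha> \<in> {0..s}" "\<beta> \<in> {0..s}" for \<alpha> \<beta>
  proof -
    have "dist (x + \<alpha> *\<^sub>R u + \<beta> *\<^sub>R v) x \<le> \<alpha> * norm u + \<beta> * norm v"
      using norm_triangle_ineq[of "\<alpha> *\<^sub>R u" "\<beta> *\<^sub>R v"] that by (simp add: dist_norm add.assoc)
    also have "\<dots> \<le> s * (norm u + norm v + 1)"
      using that s mult_right_mono[of \<alpha> s "norm u"] mult_right_mono[of \<beta> s "norm v"]
      by (auto simp: algebra_simps)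
    also have "\<dots> = m / 2" unfolding s_def
      using add_nonneg_pos[of "norm u + norm v" 1] by (simp add: field_simps)
    finally show ?thesis using m by simp
  qed
  have inS: "x + \<alpha> *\<^sub>R u + \<beta> *\<^sub>R v \<in> S" if "\<alpha> \<in> {0..s}" "\<beta> \<in> {0..s}" for \<alpha> \<beta>
    using near[OF that] d3 unfolding m_def by (auto simp: dist_commute subset_eq)
  have inS': "x + \<alpha> *\<^sub>R v + \<beta> *\<^sub>R u \<in> S" if "\<alpha> \<in> {0..s}" "\<beta> \<in> {0..s}" for \<alpha> \<beta>
    using inS[OF that(2,1)] by (simp add: algebra_simps)
  obtain a b where ab: "a \<in> {0..s}" "b \<in> {0..s}" and
    1: "h (x + s *\<^sub>R u + s *\<^sub>R v) - h (x + s *\<^sub>R u) - h (x + s *\<^sub>R v) + h x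
      = s * (s * ?A (x + a *\<^sub>R u + b *\<^sub>R v))"
    using second_difference_mvt[OF h s inS] by blast
  obtain a' b' where ab': "a' \<in> {0..s}" "b' \<in> {0..s}" and
    2: "h (x + s *\<^sub>R v + s *\<^sub>R u) - h (x + s *\<^sub>R v) - h (x + s *\<^sub>R u) + h x
      = s * (s * ?B (x + a' *\<^sub>R v + b' *\<^sub>R u))"
    using second_difference_mvt[OF h s inS'] by blast
  have "s * (s * ?A (x + a *\<^sub>R u + b *\<^sub>R v)) = s * (s * ?B (x + a' *\<^sub>R v + b' *\<^sub>R u))"
    using 1 2 by (simp add: algebra_simps)
  then have "?A (x + a *\<^sub>R u + b *\<^sub>R v) = ?B (x + b' *\<^sub>R u + a' *\<^sub>R v)"
    using s by (simp add: algebra_simps)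
  moreover have "dist (?A (x + a *\<^sub>R u + b *\<^sub>R v)) (?A x) < e"
    using A near[OF ab] unfolding m_def by simp
  moreover have "dist (?B (x + b' *\<^sub>R u + a' *\<^sub>R v)) (?B x) < e"
    using B near[OF ab'(2,1)] unfolding m_def by simp
  ultimately show False unfolding e_def dist_real_def by (auto simp: abs_if split: if_splits)
qed

text \<open>The mean value theorem is about real values, hence the passage to the components
  \<open>h y \<bullet> b\<close>.\<close>

lemma fd_symmetric:
  fixes h :: "'a::real_normed_vector \<Rightarrow> 'b::euclidean_space"
  assumes "open S" "x \<in> S" and h: "smooth_on S h"
  shows "frechet_derivative (\<lambda>y. frechet_derivative h (at y) u) (at x) v
       = frechet_derivative (\<lambda>y. frechet_derivative h (at y) v) (at x) u"
proof (rule euclidean_eqI)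
  fix b :: 'b assume "b \<in> Basis"
  have inner_fd: "frechet_derivative (\<lambda>y. k y \<bullet> b) (at y) w = frechet_derivative k (at y) w \<bullet> b"
    if "smooth_on S k" "y \<in> S" for k :: "'a \<Rightarrow> 'b" and y w
    by (subst fd_eqI[OF has_derivative_inner_left[OF smooth_on_has_derivative[OF that]]]) simp
  have sm: "smooth_on S (\<lambda>y. h y \<bullet> b)"
    by (intro smooth_on_bilinear[OF assms(1) bounded_bilinear_inner] h smooth_on_const)
  have "frechet_derivative (\<lambda>y. frechet_derivative h (at y) u) (at x) v \<bullet> b
    = frechet_derivative (\<lambda>y. frechet_derivative (\<lambda>y. h y \<bullet> b) (at y) u) (at x) v" for u v
    using inner_fd[OF h] inner_fd[OF smooth_on_fd[OF h] assms(2)]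
      fd_cong[OF assms(1,2), of "\<lambda>y. frechet_derivative (\<lambda>y. h y \<bullet> b) (at y) u" "\<lambda>y. frechet_derivative h (at y) u \<bullet> b"]
    by simp
  then show "frechet_derivative (\<lambda>y. frechet_derivative h (at y) u) (at x) v \<bullet> b
       = frechet_derivative (\<lambda>y. frechet_derivative h (at y) v) (at x) u \<bullet> b"
    using fd_symmetric_real[OF assms(1,2) sm] by simp
qed

text \<open>The product rule for a linear map depending on a point, applied to a vector depending on
  the same point. Differentiability of \<open>B\<close> is assumed only for each fixed vector;
  expanding over the basis makes that sufficient. Metrics, Christoffel symbols, Jacobians and
  differentials are all differentiated by this rule.\<close>

lemma has_derivative_linear_family:
  fixes B :: "'a::real_normed_vector \<Rightarrow> 'e::euclidean_space \<Rightarrow> 'b::real_normed_vector"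
  assumes "open S" "x \<in> S" and lin: "\<And>y. y \<in> S \<Longrightarrow> linear (B y)"
    and diff: "\<And>v. (\<lambda>y. B y v) differentiable (at x)"
    and V: "(V has_derivative V') (at x)"
  shows "((\<lambda>y. B y (V y)) has_derivative
    (\<lambda>u. frechet_derivative (\<lambda>y. B y (V x)) (at x) u + B x (V' u))) (at x)"
proof -
  have ex: "B y w = (\<Sum>b\<in>Basis. (w \<bullet> b) *\<^sub>R B y b)" if "y \<in> S" for y w
    by (rule linear_expand[OF lin[OF that]])
  have d: "((\<lambda>y. \<Sum>b\<in>Basis. (W y \<bullet> b) *\<^sub>R B y b) has_derivative (\<lambda>u. \<Sum>b\<in>Basis.
      (W x \<bullet> b) *\<^sub>R frechet_derivative (\<lambda>y. B y b) (at x) u + (W' u \<bullet> b) *\<^sub>R B x b)) (at x)"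
    if "(W has_derivative W') (at x)" for W W'
    by (intro has_derivative_sum has_derivative_scaleR has_derivative_inner_left that
        fd_has_derivative diff)
  have 1: "((\<lambda>y. B y (V x)) has_derivative (\<lambda>u. \<Sum>b\<in>Basis.
      (V x \<bullet> b) *\<^sub>R frechet_derivative (\<lambda>y. B y b) (at x) u)) (at x)"
    using d[OF has_derivative_const, of "V x"] ex assms(1,2)
    by (simp add: has_derivative_transform_within_open[OF _ assms(1,2)])
  have 2: "((\<lambda>y. B y (V y)) has_derivative (\<lambda>u. \<Sum>b\<in>Basis.
      (V x \<bullet> b) *\<^sub>R frechet_derivative (\<lambda>y. B y b) (at x) u + (V' u \<bullet> b) *\<^sub>R B x b)) (at x)"
    by (rule has_derivative_transform_within_open[OF d[OF V] assms(1,2)]) (simp add: ex)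
  show ?thesis
    using 2 unfolding fd_eqI[OF 1] ex[OF assms(2), of "V' _"] sum.distrib .
qed

subsection \<open>Metrics on open subsets of a Euclidean space\<close>

text \<open>Differentiating the identities that express linearity. It gives the linearity of
  derivatives of the metric and of the Christoffel symbols in the slots other than the
  direction.\<close>

lemma linear_fd_param:
  fixes B :: "'a::real_normed_vector \<Rightarrow> 'e::real_vector \<Rightarrow> 'b::real_normed_vector"
  assumes "open S" "x \<in> S" and lin: "\<And>y. y \<in> S \<Longrightarrow> linear (B y)"
    and diff: "\<And>v. (\<lambda>y. B y v) differentiable (at x)"
  shows "linear (\<lambda>v. frechet_derivative (\<lambda>y. B y v) (at x) h)"
proof (rule linearI)
  fix v w and r :: real
  note d = fd_has_derivative[OF diff]
  have "frechet_derivative (\<lambda>y. B y (v + w)) (at x) = frechet_derivative (\<lambda>y. B y v + B y w) (at x)"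
    by (rule fd_cong[OF assms(1,2)]) (simp add: linear_add lin)
  then show "frechet_derivative (\<lambda>y. B y (v + w)) (at x) h
      = frechet_derivative (\<lambda>y. B y v) (at x) h + frechet_derivative (\<lambda>y. B y w) (at x) h"
    by (simp add: fd_eqI[OF has_derivative_add[OF d d]])
  have "frechet_derivative (\<lambda>y. B y (r *\<^sub>R v)) (at x) = frechet_derivative (\<lambda>y. r *\<^sub>R B y v) (at x)"
    by (rule fd_cong[OF assms(1,2)]) (simp add: linear_scale lin)
  then show "frechet_derivative (\<lambda>y. B y (r *\<^sub>R v)) (at x) h
      = r *\<^sub>R frechet_derivative (\<lambda>y. B y v) (at x) h"
    by (simp add: fd_eqI[OF has_derivative_scaleR_right[OF d]])
qed

text \<open>The coordinate form of \<open>sharp\<close>. This and the following \<open>_rep\<close>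
  notions mirror the manifold notions for a metric on a set of coordinate vectors, so that they can
  be computed without an atlas.\<close>

definition raise_index :: "('e \<Rightarrow> 'e \<Rightarrow> 'e \<Rightarrow> real) \<Rightarrow> 'e \<Rightarrow> ('e \<Rightarrow> real) \<Rightarrow> 'e" where
  "raise_index G x \<alpha> = (THE z. \<forall>w. G x z w = \<alpha> w)"

definition dmetric :: "('e::real_normed_vector \<Rightarrow> 'e \<Rightarrow> 'e \<Rightarrow> real) \<Rightarrow> 'e \<Rightarrow> 'e \<Rightarrow> 'e \<Rightarrow> 'e \<Rightarrow> real" where
  "dmetric G x u v w = frechet_derivative (\<lambda>y. G y v w) (at x) u"

definition christoffel_rep :: "('e::real_normed_vector \<Rightarrow> 'e \<Rightarrow> 'e \<Rightarrow> real) \<Rightarrow> 'e \<Rightarrow> 'e \<Rightarrow> 'e \<Rightarrow> 'e" where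
  "christoffel_rep G x u v = raise_index G x (\<lambda>w. (dmetric G x u v w + dmetric G x v u w - dmetric G x w u v) / 2)"

definition nabla_rep :: "('e::real_normed_vector \<Rightarrow> 'e \<Rightarrow> 'e \<Rightarrow> real) \<Rightarrow> ('e \<Rightarrow> 'e) \<Rightarrow> ('e \<Rightarrow> 'e) \<Rightarrow> 'e \<Rightarrow> 'e" where
  "nabla_rep G X Y x = frechet_derivative Y (at x) (X x) + christoffel_rep G x (X x) (Y x)"

definition dchris :: "('e::real_normed_vector \<Rightarrow> 'e \<Rightarrow> 'e \<Rightarrow> real) \<Rightarrow> 'e \<Rightarrow> 'e \<Rightarrow> 'e \<Rightarrow> 'e \<Rightarrow> 'e" where
  "dchris G x u v w = frechet_derivative (\<lambda>y. christoffel_rep G y v w) (at x) u"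

text \<open>The sign is that of \<^const>\<open>riemann\<close>.\<close>

definition riemann_rep :: "('e::real_normed_vector \<Rightarrow> 'e \<Rightarrow> 'e \<Rightarrow> real) \<Rightarrow> 'e \<Rightarrow> 'e \<Rightarrow> 'e \<Rightarrow> 'e \<Rightarrow> 'e" where
  "riemann_rep G x u v w = dchris G x v u w - dchris G x u v w
     + christoffel_rep G x v (christoffel_rep G x u w) - christoffel_rep G x u (christoffel_rep G x v w)"

definition hessian_rep :: "('e::real_normed_vector \<Rightarrow> 'e \<Rightarrow> 'e \<Rightarrow> real) \<Rightarrow> ('e \<Rightarrow> real) \<Rightarrow> 'e \<Rightarrow> 'e \<Rightarrow> 'e \<Rightarrow> real" where
  "hessian_rep G F x u v = frechet_derivative (\<lambda>y. frechet_derivative F (at y) v) (at x) u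
     - frechet_derivative F (at x) (christoffel_rep G x u v)"

definition gradient_rep :: "('e::real_normed_vector \<Rightarrow> 'e \<Rightarrow> 'e \<Rightarrow> real) \<Rightarrow> ('e \<Rightarrow> real) \<Rightarrow> 'e \<Rightarrow> 'e" where
  "gradient_rep G F x = raise_index G x (frechet_derivative F (at x))"

definition nabla_gradient_rep :: "('e::real_normed_vector \<Rightarrow> 'e \<Rightarrow> 'e \<Rightarrow> real) \<Rightarrow> ('e \<Rightarrow> real) \<Rightarrow> 'e \<Rightarrow> 'e \<Rightarrow> 'e" where
  "nabla_gradient_rep G F x u = frechet_derivative (gradient_rep G F) (at x) u + christoffel_rep G x u (gradient_rep G F x)"

locale local_metric =
  fixes S :: "'e::euclidean_space set" and G :: "'e \<Rightarrow> 'e \<Rightarrow> 'e \<Rightarrow> real"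
  assumes open_S: "open S"
    and G_sym: "x \<in> S \<Longrightarrow> G x u v = G x v u"
    and G_linear: "x \<in> S \<Longrightarrow> linear (\<lambda>u. G x u v)"
    and G_nondeg: "x \<in> S \<Longrightarrow> (\<And>v. G x u v = 0) \<Longrightarrow> u = 0"
    and G_smooth: "smooth_on S (\<lambda>x. G x u v)"
begin

lemma G_linear2: "x \<in> S \<Longrightarrow> linear (G x u)"
  using G_linear[of x u] by (simp add: G_sym[of x _ u])

lemmas G_simps = linear_add[OF G_linear] linear_add[OF G_linear2] linear_diff[OF G_linear]
  linear_diff[OF G_linear2] linear_scale[OF G_linear, simplified] linear_scale[OF G_linear2, simplified]
  linear_neg[OF G_linear] linear_neg[OF G_linear2] linear_0[OF G_linear] linear_0[OF G_linear2]

lemma G_ext: "x \<in> S \<Longrightarrow> (\<And>w. G x u w = G x v w) \<Longrightarrow> u = v"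
  using G_nondeg[of x "u - v"] by (simp add: G_simps)

text \<open>\<open>L\<close> represents the form \<open>G x\<close> by a linear map with respect to
  the Euclidean inner product. Nondegeneracy says that \<open>L\<close> is injective, and in finite
  dimension it is then surjective.\<close>

lemma raise_exists:
  assumes x: "x \<in> S" and \<alpha>: "linear \<alpha>"
  shows "\<exists>z. \<forall>w. G x z w = \<alpha> w"
proof -
  define L where "L z = (\<Sum>b\<in>Basis. G x z b *\<^sub>R b)" for z
  have linL: "linear L"
    unfolding L_def
    by (rule linearI) (simp_all add: G_simps x scaleR_add_left sum.distrib scaleR_sum_right)
  have coord: "L z \<bullet> b = G x z b" if "b \<in> Basis" for z b
    unfolding L_def using that by simp
  have Gw: "G x z w = L z \<bullet> w" for z w
    using linear_expand[OF G_linear2[OF x, of z], of w] unfolding L_def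
    by (simp add: inner_sum_left inner_sum_right inner_commute mult.commute)
  have "inj L"
    unfolding linear_injective_0[OF linL]
    using G_nondeg[OF x] Gw by simp
  then have "surj L" using linear_injective_imp_surjective[OF linL] by blast
  then obtain z where z: "L z = (\<Sum>b\<in>Basis. \<alpha> b *\<^sub>R b)" by (metis surjD)
  have "G x z w = \<alpha> w" for w
    unfolding Gw z using linear_expand[OF \<alpha>, of w]
    by (simp add: inner_sum_left inner_sum_right inner_commute mult.commute)
  then show ?thesis by blast
qed

lemma raise_eqI: "x \<in> S \<Longrightarrow> (\<And>w. G x z w = \<alpha> w) \<Longrightarrow> raise_index G x \<alpha> = z"
  unfolding raise_index_def by (rule the_equality) (auto intro: G_ext)

lemma G_raise: "x \<in> S \<Longrightarrow> linear \<alpha> \<Longrightarrow> G x (raise_index G x \<alpha>) w = \<alpha> w"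
  using raise_exists raise_eqI by metis

lemma G_differentiable: "x \<in> S \<Longrightarrow> (\<lambda>y. G y u v) differentiable (at x)"
  using smooth_on_differentiable[OF G_smooth] .

lemma G_has_derivative:
  assumes x: "x \<in> S" and U: "(U has_derivative U') (at x)" and W: "(W has_derivative W') (at x)"
  shows "((\<lambda>y. G y (U y) (W y)) has_derivative
    (\<lambda>h. dmetric G x h (U x) (W x) + G x (U' h) (W x) + G x (U x) (W' h))) (at x)"
proof -
  have 1: "((\<lambda>y. G y (U y) w) has_derivative (\<lambda>h. dmetric G x h (U x) w + G x (U' h) w)) (at x)" for w
    unfolding dmetric_def
    using has_derivative_linear_family[OF open_S x G_linear G_differentiable[OF x] U] .
  have "((\<lambda>y. G y (U y) (W y)) has_derivative (\<lambda>h. frechet_derivative (\<lambda>y. G y (U y) (W x)) (at x) h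
      + G x (U x) (W' h))) (at x)"
    by (rule has_derivative_linear_family[OF open_S x G_linear2 _ W])
      (use 1 in \<open>auto simp: differentiable_def\<close>)
  then show ?thesis unfolding fd_eqI[OF 1] .
qed

text \<open>Lowering an index is \<open>(y, z) \<mapsto> (y, L y z)\<close>, whose derivative is invertible, so its
  inverse is differentiable by the inverse function theorem.\<close>

lemma raise_differentiable:
  assumes x: "x \<in> S" and lin: "\<And>y. y \<in> S \<Longrightarrow> linear (\<alpha> y)"
    and diff: "\<And>w. (\<lambda>y. \<alpha> y w) differentiable (at x)"
  shows "(\<lambda>y. raise_index G y (\<alpha> y)) differentiable (at x)"
proof -
  define L where "L y z = (\<Sum>b\<in>Basis. G y z b *\<^sub>R b)" for y z
  define k where "k y = (\<Sum>b\<in>Basis. \<alpha> y b *\<^sub>R b)" for y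
  define Li where "Li y \<kappa> = raise_index G y (\<lambda>w. \<kappa> \<bullet> w)" for y \<kappa>
  have linL: "linear (L y)" if "y \<in> S" for y
    unfolding L_def
    by (rule linearI) (simp_all add: G_simps that scaleR_add_left sum.distrib scaleR_sum_right)
  have Gw: "G y z w = L y z \<bullet> w" if "y \<in> S" for y z w
    using linear_expand[OF G_linear2[OF that, of z], of w] unfolding L_def
    by (simp add: inner_sum_left inner_sum_right inner_commute mult.commute)
  have linw: "linear (\<lambda>w. \<kappa> \<bullet> w)" for \<kappa> :: 'e
    by (simp add: bounded_linear.linear bounded_linear_inner_right)
  have LiL: "Li y (L y z) = z" if "y \<in> S" for y z
    unfolding Li_def using raise_eqI[OF that Gw[OF that]] .
  have LLi: "L y (Li y \<kappa>) = \<kappa>" if "y \<in> S" for y \<kappa>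
    using Gw[OF that, of "Li y \<kappa>"] G_raise[OF that linw, of \<kappa>] unfolding Li_def
    by (metis inner_commute vector_eq_ldot)
  have kw: "\<alpha> y w = k y \<bullet> w" if "y \<in> S" for y w
    using linear_expand[OF lin[OF that], of w] unfolding k_def
    by (simp add: inner_sum_left inner_sum_right inner_commute mult.commute)
  have rk: "raise_index G y (\<alpha> y) = Li y (k y)" if "y \<in> S" for y
    unfolding Li_def using kw[OF that] by (metis ext)
  have Ldiff: "(\<lambda>y. L y z) differentiable (at y)" if "y \<in> S" for y z
    unfolding L_def
    by (rule differentiable_sum[OF finite_Basis ballI])
      (rule differentiable_scaleR[OF G_differentiable[OF that] differentiable_const])
  have derf: "((\<lambda>p. (fst p, L (fst p) (snd p))) has_derivative (\<lambda>h. (fst h,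
      frechet_derivative (\<lambda>y. L y z) (at y) (fst h) + L y (snd h)))) (at (y, z))"
    if "y \<in> S" for y z
  proof -
    have c: "((\<lambda>p. L (fst p) w) has_derivative (\<lambda>h. frechet_derivative (\<lambda>y. L y w) (at y) (fst h))) (at (y, z))"
      for w
      using has_derivative_compose[OF bounded_linear_imp_has_derivative[OF bounded_linear_fst], of "\<lambda>y. L y w" _ "(y, z)"]
        fd_has_derivative[OF Ldiff[OF that]] by simp
    have "((\<lambda>p. L (fst p) (snd p)) has_derivative (\<lambda>h. frechet_derivative (\<lambda>p. L (fst p) (snd (y, z))) (at (y, z)) h
        + L (fst (y, z)) (snd h))) (at (y, z))"
    proof (rule has_derivative_linear_family[where S = "S \<times> UNIV"])
      show "open (S \<times> (UNIV :: 'e set))" using open_S by (simp add: open_Times)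
      show "(y, z) \<in> S \<times> UNIV" using that by simp
      show "linear (L (fst p))" if "p \<in> S \<times> UNIV" for p :: "'e \<times> 'e"
        using linL that by auto
      show "(\<lambda>p. L (fst p) w) differentiable (at (y, z))" for w
        using c unfolding differentiable_def by blast
      show "(snd has_derivative snd) (at (y, z))"
        by (rule bounded_linear_imp_has_derivative[OF bounded_linear_snd])
    qed
    then have "((\<lambda>p. L (fst p) (snd p)) has_derivative (\<lambda>h. frechet_derivative (\<lambda>y. L y z) (at y) (fst h)
        + L y (snd h))) (at (y, z))"
      unfolding snd_conv fst_conv fd_eqI[OF c] .
    then show ?thesis
      by (rule has_derivative_Pair[OF bounded_linear_imp_has_derivative[OF bounded_linear_fst]])
  qed
  define z where "z = Li x (k x)"
  \<comment> \<open>The inverse map is known, so its derivative is found by solving h' = (fst h, D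
    (fst h) + L x (snd h)) for h, where D is the derivative of \<open>\<lambda>y. L y z\<close> at
    \<open>x\<close>. The first component \<open>y\<close> is carried along because the linear map
    to be inverted varies with it.\<close>
  have "((\<lambda>p. (fst p, Li (fst p) (snd p))) has_derivative (\<lambda>h. (fst h,
      Li x (snd h - frechet_derivative (\<lambda>y. L y z) (at x) (fst h))))) (at (fst (x, z), L (fst (x, z)) (snd (x, z))))"
  proof (rule has_derivative_inverse_strong[where S = "S \<times> UNIV"
        and f = "\<lambda>p. (fst p, L (fst p) (snd p))" and x = "(x, z)"
        and f' = "\<lambda>h. (fst h, frechet_derivative (\<lambda>y. L y z) (at x) (fst h) + L x (snd h))"])
    show "continuous_on (S \<times> UNIV) (\<lambda>p. (fst p, L (fst p) (snd p)))"
    proof (rule continuous_at_imp_continuous_on, safe)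
      fix y z assume "y \<in> S"
      from has_derivative_continuous[OF derf[OF this, of z]]
      show "isCont (\<lambda>p. (fst p, L (fst p) (snd p))) (y, z)" .
    qed
    show "((\<lambda>p. (fst p, L (fst p) (snd p))) has_derivative
        (\<lambda>h. (fst h, frechet_derivative (\<lambda>y. L y z) (at x) (fst h) + L x (snd h)))) (at (x, z))"
      by (rule derf[OF x])
    show "(\<lambda>h. (fst h, frechet_derivative (\<lambda>y. L y z) (at x) (fst h) + L x (snd h))) \<circ>
        (\<lambda>h. (fst h, Li x (snd h - frechet_derivative (\<lambda>y. L y z) (at x) (fst h)))) = id"
      by (auto simp: LLi[OF x])
  qed (use open_S x LiL in \<open>auto simp: open_Times\<close>)
  then have "((\<lambda>p. (fst p, Li (fst p) (snd p))) has_derivative (\<lambda>h. (fst h,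
      Li x (snd h - frechet_derivative (\<lambda>y. L y z) (at x) (fst h))))) (at (x, k x))"
    unfolding z_def by (simp add: LLi[OF x])
  from has_derivative_snd[OF this]
  have "(\<lambda>p. Li (fst p) (snd p)) differentiable (at (x, k x))"
    unfolding differentiable_def snd_conv by blast
  moreover have "(\<lambda>y. (y, k y)) differentiable (at x)"
  proof -
    have "k differentiable (at x)"
      unfolding k_def
      by (rule differentiable_sum[OF finite_Basis ballI])
        (rule differentiable_scaleR[OF diff differentiable_const])
    then show ?thesis unfolding differentiable_def
      using has_derivative_Pair[OF has_derivative_ident] by blast
  qed
  ultimately have "(\<lambda>y. Li y (k y)) differentiable (at x)"
    using differentiable_compose[of "\<lambda>p. Li (fst p) (snd p)" "\<lambda>y. (y, k y)" x UNIV] by simp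
  from differentiable_cong_open[OF open_S x rk[symmetric] this] show ?thesis .
qed

lemma dmetric_linear1: "x \<in> S \<Longrightarrow> linear (\<lambda>u. dmetric G x u v w)"
  unfolding dmetric_def using fd_linear[OF G_smooth] by (simp add: eta_contract_eq)

lemma dmetric_linear2: "x \<in> S \<Longrightarrow> linear (\<lambda>v. dmetric G x u v w)"
  unfolding dmetric_def using linear_fd_param[OF open_S _ G_linear G_differentiable] .

lemma dmetric_sym: "x \<in> S \<Longrightarrow> dmetric G x u v w = dmetric G x u w v"
  unfolding dmetric_def
  by (simp only: fd_cong[OF open_S, of x "\<lambda>y. G y v w" "\<lambda>y. G y w v", OF _ G_sym])

lemma dmetric_linear3: "x \<in> S \<Longrightarrow> linear (\<lambda>w. dmetric G x u v w)"
  using dmetric_linear2[of x u v] by (simp only: dmetric_sym[of x u v])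

lemmas dmetric_simps = linear_add[OF dmetric_linear1] linear_add[OF dmetric_linear2] linear_add[OF dmetric_linear3]
  linear_scale[OF dmetric_linear1, simplified] linear_scale[OF dmetric_linear2, simplified]
  linear_scale[OF dmetric_linear3, simplified]

lemma koszul_linear:
  "x \<in> S \<Longrightarrow> linear (\<lambda>w. (dmetric G x u v w + dmetric G x v u w - dmetric G x w u v) / 2)"
  by (rule linearI) (simp_all add: dmetric_simps field_simps)

lemma chris_koszul:
  "x \<in> S \<Longrightarrow> 2 * G x (christoffel_rep G x u v) w = dmetric G x u v w + dmetric G x v u w - dmetric G x w u v"
  unfolding christoffel_rep_def by (simp add: G_raise[OF _ koszul_linear])

text \<open>By nondegeneracy the Koszul formula determines the Christoffel symbols. Symmetry,
  linearity and the formulas for the static metric are all proved by checking a candidate against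
  it.\<close>

lemma chris_eqI:
  "x \<in> S \<Longrightarrow> (\<And>w. 2 * G x z w = dmetric G x u v w + dmetric G x v u w - dmetric G x w u v) \<Longrightarrow>
    christoffel_rep G x u v = z"
  by (rule G_ext[of x]) (auto simp: chris_koszul[symmetric])

lemma chris_sym: "x \<in> S \<Longrightarrow> christoffel_rep G x u v = christoffel_rep G x v u"
  by (rule chris_eqI) (auto simp: chris_koszul dmetric_sym[of x _ u v])

lemma chris_linear1: "x \<in> S \<Longrightarrow> linear (\<lambda>u. christoffel_rep G x u v)"
  by (rule linearI; rule chris_eqI)
    (auto simp: G_simps chris_koszul dmetric_simps algebra_simps)

lemma chris_linear2: "x \<in> S \<Longrightarrow> linear (\<lambda>v. christoffel_rep G x u v)"
  using chris_linear1[of x u] by (simp only: chris_sym[of x u])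

lemmas chris_simps = linear_add[OF chris_linear1] linear_add[OF chris_linear2]
  linear_diff[OF chris_linear1] linear_diff[OF chris_linear2]
  linear_scale[OF chris_linear1] linear_scale[OF chris_linear2]
  linear_0[OF chris_linear1] linear_0[OF chris_linear2]

text \<open>Adding the Koszul formulas for (u, v, w) and (u, w, v) doubles the derivative in
  direction \<open>u\<close> and cancels the other four terms in pairs.\<close>

lemma metric_compat:
  "x \<in> S \<Longrightarrow> dmetric G x u v w = G x (christoffel_rep G x u v) w + G x v (christoffel_rep G x u w)"
  using chris_koszul[of x u v w] chris_koszul[of x u w v] G_sym[of x v "christoffel_rep G x u w"]
    dmetric_sym[of x u v w] dmetric_sym[of x v u w] dmetric_sym[of x w u v] by simp

text \<open>The Christoffel symbols arise by raising the index of a form built from first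
  derivatives of the smooth metric. The curvature takes one further derivative, which this lemma
  provides.\<close>

lemma chris_differentiable: "x \<in> S \<Longrightarrow> (\<lambda>y. christoffel_rep G y u v) differentiable (at x)"
  unfolding christoffel_rep_def
proof (rule raise_differentiable[OF _ koszul_linear])
  fix w assume x: "x \<in> S"
  have "(\<lambda>y. dmetric G y u v w) differentiable (at x)" for u v w
    unfolding dmetric_def using smooth_on_differentiable[OF smooth_on_fd[OF G_smooth] x] .
  then show "(\<lambda>y. (dmetric G y u v w + dmetric G y v u w - dmetric G y w u v) / 2) differentiable (at x)"
    by (intro differentiable_divide differentiable_diff differentiable_add) auto
qed auto

lemma chris_has_derivative:
  assumes x: "x \<in> S" and U: "(U has_derivative U') (at x)" and W: "(W has_derivative W') (at x)"
  shows "((\<lambda>y. christoffel_rep G y (U y) (W y)) has_derivative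
    (\<lambda>h. dchris G x h (U x) (W x) + christoffel_rep G x (U' h) (W x) + christoffel_rep G x (U x) (W' h))) (at x)"
proof -
  have 1: "((\<lambda>y. christoffel_rep G y (U y) w) has_derivative (\<lambda>h. dchris G x h (U x) w + christoffel_rep G x (U' h) w)) (at x)" for w
    unfolding dchris_def
    using has_derivative_linear_family[OF open_S x chris_linear1 chris_differentiable[OF x] U] .
  have "((\<lambda>y. christoffel_rep G y (U y) (W y)) has_derivative (\<lambda>h. frechet_derivative (\<lambda>y. christoffel_rep G y (U y) (W x)) (at x) h
      + christoffel_rep G x (U x) (W' h))) (at x)"
    by (rule has_derivative_linear_family[OF open_S x chris_linear2 _ W])
      (use 1 in \<open>auto simp: differentiable_def\<close>)
  then show ?thesis unfolding fd_eqI[OF 1] .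
qed

lemma dchris_linear1: "x \<in> S \<Longrightarrow> linear (\<lambda>u. dchris G x u v w)"
  unfolding dchris_def using linear_frechet_derivative[OF chris_differentiable] by (simp add: eta_contract_eq)

lemma dchris_linear2: "x \<in> S \<Longrightarrow> linear (\<lambda>v. dchris G x u v w)"
  unfolding dchris_def using linear_fd_param[OF open_S _ chris_linear1 chris_differentiable] .

lemma dchris_linear3: "x \<in> S \<Longrightarrow> linear (\<lambda>w. dchris G x u v w)"
  unfolding dchris_def using linear_fd_param[OF open_S _ chris_linear2 chris_differentiable] .

lemma dchris_sym: "x \<in> S \<Longrightarrow> dchris G x u v w = dchris G x u w v"
  unfolding dchris_def
  by (simp only: fd_cong[OF open_S, of x "\<lambda>y. christoffel_rep G y v w" "\<lambda>y. christoffel_rep G y w v", OF _ chris_sym])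

lemmas dchris_simps = linear_add[OF dchris_linear1] linear_add[OF dchris_linear2] linear_add[OF dchris_linear3]
  linear_scale[OF dchris_linear1] linear_scale[OF dchris_linear2] linear_scale[OF dchris_linear3]

lemma curv_antisym: "riemann_rep G x v u w = - riemann_rep G x u v w"
  unfolding riemann_rep_def by simp

lemma curv_linear:
  assumes "x \<in> S"
  shows "linear (\<lambda>u. riemann_rep G x u v w)" "linear (\<lambda>v. riemann_rep G x u v w)" "linear (\<lambda>w. riemann_rep G x u v w)"
  unfolding riemann_rep_def
  by (rule linearI; simp add: chris_simps dchris_simps assms algebra_simps)+

lemma curv_bianchi: "x \<in> S \<Longrightarrow> riemann_rep G x u v w + riemann_rep G x v w u + riemann_rep G x w u v = 0"
  unfolding riemann_rep_def
  using dchris_sym[of x u v w] dchris_sym[of x v w u] dchris_sym[of x w u v]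
    chris_sym[of x u v] chris_sym[of x v w] chris_sym[of x w u] by simp

text \<open>Metric compatibility differentiated once more. The derivatives of \<open>G\<close> that
  appear are expanded by metric compatibility again, which groups the terms so that antisymmetrizing
  in \<open>u\<close> and \<open>v\<close> produces the curvature.\<close>

lemma second_derivative_metric:
  assumes x: "x \<in> S"
  shows "frechet_derivative (\<lambda>y. dmetric G y u w z) (at x) v
    = G x (dchris G x v u w + christoffel_rep G x v (christoffel_rep G x u w)) z
    + G x w (dchris G x v u z + christoffel_rep G x v (christoffel_rep G x u z))
    + G x (christoffel_rep G x u w) (christoffel_rep G x v z) + G x (christoffel_rep G x v w) (christoffel_rep G x u z)"
proof -
  note c = chris_has_derivative[OF x has_derivative_const has_derivative_const]
  have "((\<lambda>y. G y (christoffel_rep G y u w) z + G y w (christoffel_rep G y u z)) has_derivative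
     (\<lambda>h. (dmetric G x h (christoffel_rep G x u w) z + G x (dchris G x h u w) z)
        + (dmetric G x h w (christoffel_rep G x u z) + G x w (dchris G x h u z)))) (at x)"
    using has_derivative_add[OF G_has_derivative[OF x c[of u w] has_derivative_const[of z]]
        G_has_derivative[OF x has_derivative_const[of w] c[of u z]]]
    by (simp add: G_simps chris_simps x)
  then have "((\<lambda>y. dmetric G y u w z) has_derivative
     (\<lambda>h. (dmetric G x h (christoffel_rep G x u w) z + G x (dchris G x h u w) z)
        + (dmetric G x h w (christoffel_rep G x u z) + G x w (dchris G x h u z)))) (at x)"
    by (rule has_derivative_transform_within_open[OF _ open_S x]) (simp add: metric_compat)
  from fd_eqI[OF this] show ?thesis
    by (simp add: metric_compat[OF x] G_simps x)
qed

text \<open>Second derivatives of \<open>G y w z\<close> commute. In the difference of the two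
  orders the products of two Christoffel symbols, being symmetric in \<open>u\<close> and
  \<open>v\<close>, cancel, and the rest are the two curvature terms.\<close>

lemma curv_skew:
  assumes x: "x \<in> S"
  shows "G x (riemann_rep G x u v w) z = - G x (riemann_rep G x u v z) w"
proof -
  have "frechet_derivative (\<lambda>y. dmetric G y u w z) (at x) v = frechet_derivative (\<lambda>y. dmetric G y v w z) (at x) u"
    unfolding dmetric_def by (rule fd_symmetric[OF open_S x G_smooth])
  then have "G x (riemann_rep G x u v w) z + G x w (riemann_rep G x u v z) = 0"
    unfolding second_derivative_metric[OF x] riemann_rep_def by (simp add: G_simps x)
  then show ?thesis using G_sym[OF x, of w] by simp
qed

text \<open>The second derivatives of \<open>Z\<close> cancel by symmetry, and the first derivatives
  of \<open>X\<close> and \<open>Y\<close> cancel against the bracket. The fields are smooth only on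
  a part \<open>T\<close> of the domain because coordinate fields of another chart are defined only
  on the overlap.\<close>

lemma curv_tensorial:
  assumes T: "open T" "T \<subseteq> S" "x \<in> T"
    and sm: "smooth_on T X" "smooth_on T Y" "smooth_on T Z"
  shows "nabla_rep G Y (nabla_rep G X Z) x - nabla_rep G X (nabla_rep G Y Z) x
      + nabla_rep G (\<lambda>y. frechet_derivative Y (at y) (X y) - frechet_derivative X (at y) (Y y)) Z x
    = riemann_rep G x (X x) (Y x) (Z x)"
proof -
  have x: "x \<in> S" using T by auto
  note d = smooth_on_has_derivative[OF sm(1) T(3)] smooth_on_has_derivative[OF sm(2) T(3)]
    smooth_on_has_derivative[OF sm(3) T(3)]
  have linZ: "linear (frechet_derivative Z (at y))" if "y \<in> T" for y
    using fd_linear[OF sm(3) that] .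
  have "(nabla_rep G X Z has_derivative (\<lambda>h. frechet_derivative (\<lambda>y. frechet_derivative Z (at y) (X x)) (at x) h
      + frechet_derivative Z (at x) (X' h)
      + (dchris G x h (X x) (Z x) + christoffel_rep G x (X' h) (Z x) + christoffel_rep G x (X x) (frechet_derivative Z (at x) h)))) (at x)"
    if "(X has_derivative X') (at x)" for X X'
    unfolding nabla_rep_def
    by (intro has_derivative_add chris_has_derivative[OF x] that d(3)
        has_derivative_linear_family[OF T(1,3) linZ] smooth_on_differentiable[OF smooth_on_fd[OF sm(3)] T(3)])
  note c = fd_eqI[OF this]
  have s: "frechet_derivative (\<lambda>y. frechet_derivative Z (at y) (X x)) (at x) (Y x)
      = frechet_derivative (\<lambda>y. frechet_derivative Z (at y) (Y x)) (at x) (X x)"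
    by (rule fd_symmetric[OF T(1,3) sm(3)])
  show ?thesis
    unfolding nabla_rep_def[of G Y "nabla_rep G X Z"] nabla_rep_def[of G X "nabla_rep G Y Z"] c[OF d(1)] c[OF d(2)]
    unfolding nabla_rep_def riemann_rep_def
    by (simp add: s chris_simps x linear_diff[OF linZ[OF T(3)]])
qed

end

section \<open>Gradient and Hessian in coordinates, and constancy of the curvature\<close>

context local_metric
begin

lemma G_lgrad: "x \<in> S \<Longrightarrow> smooth_on S F \<Longrightarrow> G x (gradient_rep G F x) w = frechet_derivative F (at x) w"
  unfolding gradient_rep_def by (rule G_raise[OF _ fd_linear])

lemma lgrad_differentiable: "x \<in> S \<Longrightarrow> smooth_on S F \<Longrightarrow> gradient_rep G F differentiable (at x)"
  using raise_differentiable[of x "\<lambda>y. frechet_derivative F (at y)"] fd_linear[of S F]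
    smooth_on_differentiable[OF smooth_on_fd, of S F]
  by (simp add: gradient_rep_def[abs_def])

text \<open>Differentiating \<open>G x (gradient_rep G F x) w = dF w\<close> at fixed
  \<open>w\<close>; metric compatibility absorbs the derivative of \<open>G\<close>.\<close>

lemma G_covgrad:
  assumes x: "x \<in> S" and F: "smooth_on S F"
  shows "G x (nabla_gradient_rep G F x u) w = hessian_rep G F x u w"
proof -
  note dl = fd_has_derivative[OF lgrad_differentiable[OF x F]]
  have "((\<lambda>y. frechet_derivative F (at y) w) has_derivative (\<lambda>h. dmetric G x h (gradient_rep G F x) w
     + G x (frechet_derivative (gradient_rep G F) (at x) h) w + G x (gradient_rep G F x) 0)) (at x)"
    by (rule has_derivative_transform_within_open[OF G_has_derivative[OF x dl has_derivative_const] open_S x])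
      (rule G_lgrad[OF _ F])
  from fd_eqI[OF this]
  show ?thesis
    unfolding hessian_rep_def nabla_gradient_rep_def
    by (simp add: metric_compat[OF x] G_simps x G_lgrad[OF x F, symmetric])
qed

text \<open>The Ricci identity for \<open>grad F\<close>, with \<open>R\<close> and \<open>Hess F\<close> of the given forms,
  reads \<open>F dK(u) v = F dK(v) u\<close>; it replaces Schur's lemma and the second Bianchi identity.\<close>

lemma constant_if_space_form:
  assumes dim: "DIM('e) \<ge> 2"
    and F: "smooth_on S F" and pos: "\<And>x. x \<in> S \<Longrightarrow> F x > 0"
    and hessF: "\<And>x u v. x \<in> S \<Longrightarrow> hessian_rep G F x u v = - (K x * F x) * G x u v"
    and R: "\<And>x u v w. x \<in> S \<Longrightarrow> riemann_rep G x u v w = K x *\<^sub>R (G x u w *\<^sub>R v - G x v w *\<^sub>R u)"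
    and x: "x \<in> S"
  shows "(K has_derivative (\<lambda>_. 0)) (at x)"
proof -
  let ?D = "\<lambda>h. frechet_derivative F (at x) h"
  let ?dd = "\<lambda>v y. frechet_derivative F (at y) v"
  have Fd: "(F has_derivative ?D) (at x)" using smooth_on_has_derivative[OF F x] .
  have Dlin: "linear ?D" using fd_linear[OF F x] .
  have hd: "((\<lambda>y. hessian_rep G F y v w) has_derivative (\<lambda>h. frechet_derivative (\<lambda>y. frechet_derivative (?dd w) (at y) v) (at x) h
       - (frechet_derivative (\<lambda>y. frechet_derivative F (at y) (christoffel_rep G x v w)) (at x) h
          + ?D (dchris G x h v w)))) (at x)" for v w
  proof -
    have "((\<lambda>y. christoffel_rep G y v w) has_derivative (\<lambda>h. dchris G x h v w)) (at x)"
      unfolding dchris_def by (rule fd_has_derivative[OF chris_differentiable[OF x]])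
    then show ?thesis
      unfolding hessian_rep_def
      by (intro has_derivative_diff has_derivative_linear_family[OF open_S x] fd_linear[OF F]
          smooth_on_has_derivative[OF smooth_on_fd[OF smooth_on_fd[OF F]] x]
          smooth_on_differentiable[OF smooth_on_fd[OF F] x]) auto
  qed
  \<comment> \<open>Nothing is assumed about the regularity of \<open>K\<close>. Near
    \<open>x\<close> it equals - Hess F (v0, w0) / (F G (v0, w0)) for any pair on which the metric
    does not vanish at \<open>x\<close>, and this quotient is differentiable.\<close>
  have "\<exists>v w. G x v w \<noteq> 0"
  proof -
    obtain b :: 'e where "b \<in> Basis" using nonempty_Basis by blast
    then have "b \<noteq> 0" by auto
    then show ?thesis using G_nondeg[OF x] by blast
  qed
  then obtain v0 w0 where vw0: "G x v0 w0 \<noteq> 0" by blast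
  define T where "T = {y \<in> S. G y v0 w0 \<noteq> 0}"
  have T: "open T" "x \<in> T"
  proof -
    have "T = S \<inter> (\<lambda>y. G y v0 w0) -` (- {0})" unfolding T_def by auto
    then show "open T"
      using continuous_open_preimage[OF smooth_on_continuous[OF G_smooth, of v0 w0] open_S, of "- {0}"]
      by (simp add: open_Compl)
    show "x \<in> T" unfolding T_def using x vw0 by simp
  qed
  have "(\<lambda>y. - hessian_rep G F y v0 w0 / (F y * G y v0 w0)) differentiable (at x)"
    using hd[of v0 w0] G_differentiable[OF x] Fd vw0 pos[OF x]
    by (intro differentiable_divide differentiable_minus differentiable_mult)
      (auto simp: differentiable_def)
  moreover have "- hessian_rep G F y v0 w0 / (F y * G y v0 w0) = K y" if "y \<in> T" for y
    using that hessF[of y v0 w0] pos[of y] unfolding T_def by (simp add: field_simps)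
  ultimately have "K differentiable (at x)"
    using differentiable_cong_open[OF T, of "\<lambda>y. - hessian_rep G F y v0 w0 / (F y * G y v0 w0)" K] by blast
  then obtain K' where K': "(K has_derivative K') (at x)" unfolding differentiable_def by blast
  \<comment> \<open>The Hessian equation is differentiated on both sides and solved for the third
    derivative of \<open>F\<close>; \<open>second\<close> does the same for the second derivative
    without differentiating.\<close>
  have third: "frechet_derivative (\<lambda>y. frechet_derivative (?dd w) (at y) v) (at x) u
      = frechet_derivative (\<lambda>y. frechet_derivative F (at y) (christoffel_rep G x v w)) (at x) u + ?D (dchris G x u v w)
        - (K x * (F x * dmetric G x u v w) + (K' u * F x + K x * ?D u) * G x v w)" for u v w
  proof -
    have gd: "((\<lambda>y. G y v w) has_derivative (\<lambda>h. dmetric G x h v w)) (at x)"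
      unfolding dmetric_def by (rule fd_has_derivative[OF G_differentiable[OF x]])
    have "((\<lambda>y. - (K y * F y) * G y v w) has_derivative
        (\<lambda>h. - (K x * F x) * dmetric G x h v w + - (K x * ?D h + K' h * F x) * G x v w)) (at x)"
      by (rule has_derivative_mult[OF has_derivative_minus[OF has_derivative_mult[OF K' Fd]] gd])
    then have "((\<lambda>y. hessian_rep G F y v w) has_derivative
        (\<lambda>h. - (K x * F x) * dmetric G x h v w + - (K x * ?D h + K' h * F x) * G x v w)) (at x)"
      by (rule has_derivative_transform_within_open[OF _ open_S x]) (simp add: hessF)
    from has_derivative_unique[OF this hd[of v w]]
    show ?thesis by (auto dest!: fun_cong[of _ _ u] simp: algebra_simps)
  qed
  have second: "frechet_derivative (\<lambda>y. frechet_derivative F (at y) z) (at x) u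
      = ?D (christoffel_rep G x u z) - K x * F x * G x u z" for u z
    using hessF[OF x, of u z] unfolding hessian_rep_def by simp
  \<comment> \<open>Exchanging \<open>u\<close> and \<open>v\<close> in \<open>third\<close> and
    subtracting removes the third derivatives. The Christoffel terms combine to dF (R (u, v) w),
    whose value by \<open>R\<close> cancels the terms K dF, and torsion-freeness with metric
    compatibility removes the derivatives of the metric. Only the terms in \<open>K'\<close>
    remain.\<close>
  have key: "F x * (K' u * G x v w) = F x * (K' v * G x u w)" for u v w
  proof -
    have "frechet_derivative (\<lambda>y. frechet_derivative (?dd w) (at y) v) (at x) u
        = frechet_derivative (\<lambda>y. frechet_derivative (?dd w) (at y) u) (at x) v"
      by (rule fd_symmetric[OF open_S x smooth_on_fd[OF F]])
    then have eq: "?D (christoffel_rep G x u (christoffel_rep G x v w)) - K x * F x * G x u (christoffel_rep G x v w) + ?D (dchris G x u v w)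
        - (K x * (F x * dmetric G x u v w) + (K' u * F x + K x * ?D u) * G x v w)
      = ?D (christoffel_rep G x v (christoffel_rep G x u w)) - K x * F x * G x v (christoffel_rep G x u w) + ?D (dchris G x v u w)
        - (K x * (F x * dmetric G x v u w) + (K' v * F x + K x * ?D v) * G x u w)"
      unfolding third second .
    have "?D (riemann_rep G x u v w) = ?D (dchris G x v u w) - ?D (dchris G x u v w)
        + ?D (christoffel_rep G x v (christoffel_rep G x u w)) - ?D (christoffel_rep G x u (christoffel_rep G x v w))"
      unfolding riemann_rep_def by (simp add: linear_add[OF Dlin] linear_diff[OF Dlin])
    moreover have "?D (riemann_rep G x u v w) = K x * (G x u w * ?D v - G x v w * ?D u)"
      unfolding R[OF x] by (simp add: linear_diff[OF Dlin] linear_scale[OF Dlin])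
    moreover have "dmetric G x u v w + G x u (christoffel_rep G x v w) = dmetric G x v u w + G x v (christoffel_rep G x u w)"
      unfolding metric_compat[OF x] chris_sym[OF x, of v u] by simp
    then have "K x * F x * (dmetric G x u v w + G x u (christoffel_rep G x v w))
      = K x * F x * (dmetric G x v u w + G x v (christoffel_rep G x u w))" by simp
    ultimately show ?thesis using eq by (auto simp: algebra_simps)
  qed
  have Kv: "K' u *\<^sub>R v = K' v *\<^sub>R u" for u v
    by (rule G_ext[OF x]) (use key[of u v] pos[OF x] in \<open>simp add: G_simps x\<close>)
  \<comment> \<open>If \<open>K' u\<close> were nonzero, \<open>Kv\<close> would make every vector a
    multiple of \<open>u\<close>, which dimension at least two excludes.\<close>
  have "K' u = 0" for u
  proof (rule ccontr)
    assume nz: "K' u \<noteq> 0"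
    have "v \<in> span {u}" for v
    proof -
      have "(1 / K' u) *\<^sub>R (K' u *\<^sub>R v) = (1 / K' u) *\<^sub>R (K' v *\<^sub>R u)"
        by (simp only: Kv[of u v])
      then have "v = (K' v / K' u) *\<^sub>R u" using nz by simp
      then show ?thesis by (metis span_base span_mul singletonI)
    qed
    then have "span {u} = (UNIV :: 'e set)" by auto
    then have "dim (UNIV :: 'e set) \<le> card {u}" by (intro dim_le_card) auto
    then show False using dim by simp
  qed
  then have "K' = (\<lambda>_. 0)" by auto
  then show ?thesis using K' by simp
qed

end

subsection \<open>Change of coordinates\<close>

text \<open>In use \<open>\<phi>\<close> is a chart transition and \<open>T\<close> lies in the
  chart overlap. Surjectivity of the derivative makes every vector of the target available as a test
  vector.\<close>

locale local_isometry =
  src: local_metric S G + tgt: local_metric S' G'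
  for S :: "'e::euclidean_space set" and G and S' :: "'e set" and G' +
  fixes T :: "'e set" and \<phi> :: "'e \<Rightarrow> 'e"
  assumes T: "open T" "T \<subseteq> S" and \<phi>_in: "x \<in> T \<Longrightarrow> \<phi> x \<in> S'" and \<phi>: "smooth_on T \<phi>"
    and surj: "x \<in> T \<Longrightarrow> surj (frechet_derivative \<phi> (at x))"
    and isometric: "x \<in> T \<Longrightarrow> G x u v = G' (\<phi> x) (frechet_derivative \<phi> (at x) u) (frechet_derivative \<phi> (at x) v)"
begin

abbreviation J :: "'e \<Rightarrow> 'e \<Rightarrow> 'e" where "J x \<equiv> frechet_derivative \<phi> (at x)"

abbreviation H :: "'e \<Rightarrow> 'e \<Rightarrow> 'e \<Rightarrow> 'e" where "H x u v \<equiv> frechet_derivative (\<lambda>y. J y v) (at x) u"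

lemma T_S: "x \<in> T \<Longrightarrow> x \<in> S"
  using T by auto

lemma J_has_derivative: "x \<in> T \<Longrightarrow> ((\<lambda>y. J y v) has_derivative (\<lambda>u. H x u v)) (at x)"
  using smooth_on_has_derivative[OF smooth_on_fd[OF \<phi>]] by (simp add: eta_contract_eq)

lemma J_differentiable: "x \<in> T \<Longrightarrow> (\<lambda>y. J y v) differentiable (at x)"
  using smooth_on_differentiable[OF smooth_on_fd[OF \<phi>]] .

lemma H_sym: "x \<in> T \<Longrightarrow> H x u v = H x v u"
  using fd_symmetric[OF T(1) _ \<phi>] .

lemma J_linear: "x \<in> T \<Longrightarrow> linear (J x)"
  using fd_linear[OF \<phi>] .

lemma dmetric_transform:
  assumes x: "x \<in> T"
  shows "dmetric G x w u v = dmetric G' (\<phi> x) (J x w) (J x u) (J x v) + G' (\<phi> x) (H x w u) (J x v)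
    + G' (\<phi> x) (J x u) (H x w v)"
proof -
  have "((\<lambda>p. G' (\<phi> p) u' v') has_derivative (\<lambda>h. dmetric G' (\<phi> x) (J x h) u' v')) (at x)" for u' v'
    unfolding dmetric_def
    by (rule has_derivative_compose[OF smooth_on_has_derivative[OF \<phi> x]
          fd_has_derivative[OF tgt.G_differentiable[OF \<phi>_in[OF x]]]])
  note 0 = this
  have 1: "((\<lambda>y. G' (\<phi> y) (J y u) v') has_derivative (\<lambda>h. dmetric G' (\<phi> x) (J x h) (J x u) v'
      + G' (\<phi> x) (H x h u) v')) (at x)" for v'
    using has_derivative_linear_family[OF T(1) x tgt.G_linear[OF \<phi>_in] differentiableI[OF 0]
        J_has_derivative[OF x, of u]]
    unfolding fd_eqI[OF 0] .
  have 2: "((\<lambda>y. G' (\<phi> y) (J y u) (J y v)) has_derivative (\<lambda>h. (dmetric G' (\<phi> x) (J x h) (J x u) (J x v)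
      + G' (\<phi> x) (H x h u) (J x v)) + G' (\<phi> x) (J x u) (H x h v))) (at x)"
    using has_derivative_linear_family[OF T(1) x tgt.G_linear2[OF \<phi>_in] differentiableI[OF 1]
        J_has_derivative[OF x, of v]]
    unfolding fd_eqI[OF 1] .
  have "((\<lambda>y. G y u v) has_derivative (\<lambda>h. (dmetric G' (\<phi> x) (J x h) (J x u) (J x v)
      + G' (\<phi> x) (H x h u) (J x v)) + G' (\<phi> x) (J x u) (H x h v))) (at x)"
    by (rule has_derivative_transform_within_open[OF 2 T(1) x]) (simp add: isometric)
  from fd_eqI[OF this] show ?thesis unfolding dmetric_def[of G] by simp
qed

text \<open>The classical inhomogeneous law. Of the six terms in \<open>H\<close> that the three
  metric derivatives contribute to the Koszul formula, four cancel because \<open>H\<close> is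
  symmetric, and the other two agree.\<close>

lemma chris_transform:
  assumes x: "x \<in> T"
  shows "J x (christoffel_rep G x u v) = christoffel_rep G' (\<phi> x) (J x u) (J x v) + H x u v"
proof (rule tgt.G_ext[OF \<phi>_in[OF x]])
  fix w' obtain w where w: "w' = J x w" using surj[OF x] by (metis surjD)
  note y = \<phi>_in[OF x]
  have "2 * G' (\<phi> x) (J x (christoffel_rep G x u v)) w' = dmetric G x u v w + dmetric G x v u w - dmetric G x w u v"
    unfolding w isometric[OF x, symmetric] src.chris_koszul[OF T_S[OF x]] ..
  also have "\<dots> = 2 * G' (\<phi> x) (christoffel_rep G' (\<phi> x) (J x u) (J x v)) w' + 2 * G' (\<phi> x) (H x u v) w'"
    unfolding dmetric_transform[OF x] tgt.chris_koszul[OF y] w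
    using H_sym[OF x, of w u] H_sym[OF x, of w v] H_sym[OF x, of v u] tgt.G_sym[OF y]
    by simp
  finally show "G' (\<phi> x) (J x (christoffel_rep G x u v)) w' = G' (\<phi> x) (christoffel_rep G' (\<phi> x) (J x u) (J x v) + H x u v) w'"
    by (simp add: tgt.G_simps y)
qed

lemma fd_transform:
  assumes x: "x \<in> T" and rel: "\<And>y. y \<in> T \<Longrightarrow> Y' (\<phi> y) = J y (Y y)"
    and Y: "Y differentiable (at x)" and Y': "Y' differentiable (at (\<phi> x))"
  shows "frechet_derivative Y' (at (\<phi> x)) (J x u) = H x u (Y x) + J x (frechet_derivative Y (at x) u)"
proof -
  have 1: "((\<lambda>y. J y (Y y)) has_derivative (\<lambda>h. H x h (Y x) + J x (frechet_derivative Y (at x) h))) (at x)"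
    by (rule has_derivative_linear_family[OF T(1) x J_linear J_differentiable[OF x] fd_has_derivative[OF Y]])
  have 2: "((\<lambda>y. Y' (\<phi> y)) has_derivative (\<lambda>h. frechet_derivative Y' (at (\<phi> x)) (J x h))) (at x)"
    by (rule has_derivative_compose[OF smooth_on_has_derivative[OF \<phi> x] fd_has_derivative[OF Y']])
  have "((\<lambda>y. J y (Y y)) has_derivative (\<lambda>h. frechet_derivative Y' (at (\<phi> x)) (J x h))) (at x)"
    by (rule has_derivative_transform_within_open[OF 2 T(1) x]) (simp add: rel)
  from has_derivative_unique[OF this 1] show ?thesis by (rule fun_cong)
qed

text \<open>The second-derivative term \<open>H\<close> that the chain rule produces for
  \<open>Y'\<close> is exactly the one by which the Christoffel symbols fail to transform as a
  tensor.\<close>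

lemma cov_transform:
  assumes x: "x \<in> T" and rel: "\<And>y. y \<in> T \<Longrightarrow> Y' (\<phi> y) = J y (Y y)"
    and "Y differentiable (at x)" "Y' differentiable (at (\<phi> x))" and X: "X' (\<phi> x) = J x (X x)"
  shows "nabla_rep G' X' Y' (\<phi> x) = J x (nabla_rep G X Y x)"
proof -
  have "frechet_derivative Y' (at (\<phi> x)) (J x (X x)) = H x (X x) (Y x) + J x (frechet_derivative Y (at x) (X x))"
    by (rule fd_transform) (use assms in auto)
  then show ?thesis
    unfolding nabla_rep_def X rel[OF x]
    by (simp add: linear_add[OF J_linear[OF x]] chris_transform[OF x])
qed

end

subsection \<open>Constant sectional curvature\<close>

definition polyfun :: "(real \<Rightarrow> real) \<Rightarrow> bool" where
  "polyfun h \<longleftrightarrow> (\<exists>p. h = poly p)"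

lemma polyfun_const: "polyfun (\<lambda>s. c)"
  unfolding polyfun_def by (rule exI[of _ "[:c:]"]) auto

lemma polyfun_ident: "polyfun (\<lambda>s. s)"
  unfolding polyfun_def by (rule exI[of _ "[:0, 1:]"]) auto

lemma polyfun_add: "polyfun h \<Longrightarrow> polyfun k \<Longrightarrow> polyfun (\<lambda>s. h s + k s)"
  unfolding polyfun_def
proof (elim exE)
  fix p q assume "h = poly p" "k = poly q"
  then show "\<exists>r. (\<lambda>s. h s + k s) = poly r" by (intro exI[of _ "p + q"]) auto
qed

lemma polyfun_diff: "polyfun h \<Longrightarrow> polyfun k \<Longrightarrow> polyfun (\<lambda>s. h s - k s)"
  unfolding polyfun_def
proof (elim exE)
  fix p q assume "h = poly p" "k = poly q"
  then show "\<exists>r. (\<lambda>s. h s - k s) = poly r" by (intro exI[of _ "p - q"]) auto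
qed

lemma polyfun_mult: "polyfun h \<Longrightarrow> polyfun k \<Longrightarrow> polyfun (\<lambda>s. h s * k s)"
  unfolding polyfun_def
proof (elim exE)
  fix p q assume "h = poly p" "k = poly q"
  then show "\<exists>r. (\<lambda>s. h s * k s) = poly r" by (intro exI[of _ "p * q"]) auto
qed

lemmas polyfun_intros = polyfun_const polyfun_ident polyfun_add polyfun_diff polyfun_mult

text \<open>The product vanishes at every point, so it is the zero polynomial, and real polynomials
  have no zero divisors. This is the density argument restricted to a line.\<close>

lemma polyfun_zero_product:
  assumes "polyfun h" "polyfun k" "\<And>s. h s \<noteq> 0 \<Longrightarrow> k s = 0" "h s0 \<noteq> 0"
  shows "k s = 0"
proof -
  obtain p q where pq: "h = poly p" "k = poly q" using assms(1,2) unfolding polyfun_def by blast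
  have "poly (p * q) r = 0" for r using assms(3)[of r] pq by auto
  then have "p * q = 0" using poly_all_0_iff_0 by blast
  moreover have "p \<noteq> 0" using assms(4) pq by auto
  ultimately show ?thesis using pq by simp
qed

text \<open>Substitutes a moving point of a line into one slot of a multilinear form.
  \<open>B\<close> may itself depend on \<open>s\<close>, so the slots can be treated one at a
  time.\<close>

lemma polyfun_linear_compose:
  assumes "\<And>a. linear (\<lambda>z. B z a)" "polyfun (\<lambda>s. B a s)" "polyfun (\<lambda>s. B b s)"
  shows "polyfun (\<lambda>s. B (a + s *\<^sub>R b) s)"
  using assms by (simp add: linear_add[OF assms(1)] linear_scale[OF assms(1)] polyfun_intros)

context local_metric
begin

text \<open>By polarization (\<open>pol\<close>) a symmetric form that vanishes on the diagonal of a
  subspace vanishes on it altogether, so some \<open>u\<close> is not null. Were its orthogonal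
  complement totally null, each vector in it would be orthogonal to \<open>u\<close> as well and
  hence zero, and \<open>u\<close> alone would span the space.\<close>

lemma exists_nondegenerate_plane:
  assumes x: "x \<in> S" and dim: "DIM('e) \<ge> 2"
  shows "\<exists>u v. G x u u * G x v v - (G x u v)\<^sup>2 \<noteq> 0"
proof -
  have pol: "G x v w = 0" if "\<And>y. y \<in> V \<Longrightarrow> G x y y = 0" "v \<in> V" "w \<in> V" "v + w \<in> V" for V v w
    using that(1)[OF that(2)] that(1)[OF that(3)] that(1)[OF that(4)] G_sym[OF x, of w v]
    by (simp add: G_simps x)
  have "\<exists>u. G x u u \<noteq> 0"
  proof (rule ccontr)
    assume "\<nexists>u. G x u u \<noteq> 0"
    then have "G x v w = 0" for v w using pol[of UNIV v w] by simp
    then have "(v :: 'e) = 0" for v using G_nondeg[OF x] by blast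
    then show False using nonempty_Basis nonzero_Basis by (metis ex_in_conv)
  qed
  then obtain u where u: "G x u u \<noteq> 0" by blast
  define V where "V = {v. G x u v = 0}"
  have "\<exists>v\<in>V. G x v v \<noteq> 0"
  proof (rule ccontr)
    assume "\<not> (\<exists>v\<in>V. G x v v \<noteq> 0)"
    then have V0: "G x v w = 0" if "v \<in> V" "w \<in> V" for v w
      using pol[of V v w] that unfolding V_def by (simp add: G_simps x)
    define P where "P y = y - (G x u y / G x u u) *\<^sub>R u" for y
    have PV: "P y \<in> V" for y using u unfolding P_def V_def by (simp add: G_simps x)
    have dec: "y = P y + (G x u y / G x u u) *\<^sub>R u" for y unfolding P_def by simp
    have "v = 0" if "v \<in> V" for v
    proof (rule G_nondeg[OF x])
      fix w have "G x v (P w) = 0" using V0[OF that PV] .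
      moreover have "G x v u = 0" using that G_sym[OF x] unfolding V_def by simp
      ultimately show "G x v w = 0" by (subst dec) (simp add: G_simps x)
    qed
    then have "P y = 0" for y using PV by blast
    then have "y = (G x u y / G x u u) *\<^sub>R u" for y unfolding P_def by (metis eq_iff_diff_eq_0)
    then have "y \<in> span {u}" for y by (metis span_base span_mul singletonI)
    then have "span {u} = (UNIV :: 'e set)" by auto
    then have "dim (UNIV :: 'e set) \<le> card {u}" by (intro dim_le_card) auto
    then show False using dim by simp
  qed
  then obtain v where "G x u v = 0" "G x v v \<noteq> 0" unfolding V_def by blast
  then show ?thesis using u by (intro exI[of _ u] exI[of _ v]) simp
qed

text \<open>\<open>f\<close> is the difference between the curvature and the model tensor of
  curvature \<open>\<kappa>\<close>, with all indices lowered. It has every algebraic symmetry of a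
  curvature tensor, and such a tensor is determined by its values \<open>f u v u v\<close>.\<close>

lemma space_form_if_sectional:
  assumes x: "x \<in> S" and dim: "DIM('e) \<ge> 2"
    and sec: "\<And>u v. G x u u * G x v v - (G x u v)\<^sup>2 \<noteq> 0 \<Longrightarrow>
      G x (riemann_rep G x u v u) v = \<kappa> * (G x u u * G x v v - (G x u v)\<^sup>2)"
  shows "riemann_rep G x u v w = \<kappa> *\<^sub>R (G x u w *\<^sub>R v - G x v w *\<^sub>R u)"
proof -
  define f where "f u v w z = G x (riemann_rep G x u v w) z - \<kappa> * (G x u w * G x v z - G x v w * G x u z)" for u v w z
  note cl = curv_linear[OF x]
  have lin1: "linear (\<lambda>u. f u v w z)" and lin2: "linear (\<lambda>v. f u v w z)" and lin3: "linear (\<lambda>w. f u v w z)"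
    and lin4: "linear (\<lambda>z. f u v w z)" for u v w z
    unfolding f_def
    by (rule linearI; simp add: G_simps x linear_add[OF cl(1)] linear_add[OF cl(2)] linear_add[OF cl(3)]
        linear_scale[OF cl(1)] linear_scale[OF cl(2)] linear_scale[OF cl(3)] algebra_simps)+
  have f0: "f u v u v = 0" for u v
  proof -
    \<comment> \<open>Join \<open>(u, v)\<close> to a nondegenerate plane by a line: \<open>f\<close> vanishes along it wherever
      the Gram determinant does not, hence everywhere, both being polynomial.\<close>
    obtain u' v' where nd: "G x u' u' * G x v' v' - (G x u' v')\<^sup>2 \<noteq> 0"
      using exists_nondegenerate_plane[OF x dim] by blast
    define U where "U s = u' + s *\<^sub>R (u - u')" for s
    define V where "V s = v' + s *\<^sub>R (v - v')" for s
    have "polyfun (\<lambda>s. G x (U s) (U s) * G x (V s) (V s) - (G x (U s) (V s))\<^sup>2)"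
      unfolding U_def V_def G_simps(1)[OF x] G_simps(2)[OF x] G_simps(5)[OF x] G_simps(6)[OF x] power2_eq_square
      by (intro polyfun_intros)
    moreover have "polyfun (\<lambda>s. f (U s) (V s) (U s) (V s))"
    proof -
      \<comment> \<open>The slots are filled from the last to the first; those to the right of the
        current one already depend on \<open>s\<close>.\<close>
      have 4: "polyfun (\<lambda>s. f a b c (V s))" for a b c
        unfolding V_def
        by (rule polyfun_linear_compose[of "\<lambda>z s. f a b c z"]) (rule lin4 polyfun_const)+
      have 3: "polyfun (\<lambda>s. f a b (U s) (V s))" for a b
        unfolding U_def
        by (rule polyfun_linear_compose[of "\<lambda>z s. f a b z (V s)"]) (rule lin3 4)+
      have 2: "polyfun (\<lambda>s. f a (V s) (U s) (V s))" for a
        using polyfun_linear_compose[of "\<lambda>z s. f a z (U s) (V s)" v' "v - v'", OF lin2 3 3]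
        by (simp only: V_def[symmetric])
      show ?thesis
        using polyfun_linear_compose[of "\<lambda>z s. f z (V s) (U s) (V s)" u' "u - u'", OF lin1 2 2]
        by (simp only: U_def[symmetric])
    qed
    moreover have "f (U s) (V s) (U s) (V s) = 0" if "G x (U s) (U s) * G x (V s) (V s) - (G x (U s) (V s))\<^sup>2 \<noteq> 0" for s
      using sec[OF that] G_sym[OF x, of "V s" "U s"] unfolding f_def by (simp add: power2_eq_square)
    ultimately have "f (U 1) (V 1) (U 1) (V 1) = 0"
      by (rule polyfun_zero_product[of "\<lambda>s. G x (U s) (U s) * G x (V s) (V s) - (G x (U s) (V s))\<^sup>2" _ 0])
        (use nd in \<open>auto simp: U_def V_def\<close>)
    then show ?thesis unfolding U_def V_def by simp
  qed
  have anti: "f v u w z = - f u v w z" for u v w z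
    unfolding f_def by (subst curv_antisym) (simp add: G_simps x algebra_simps)
  have skew: "f u v z w = - f u v w z" for u v w z
    unfolding f_def curv_skew[OF x, of u v z w] by (simp add: algebra_simps)
  have bianchi: "f u v w z + f v w u z + f w u v z = 0" for u v w z
    using arg_cong[OF curv_bianchi[OF x, of u v w], of "\<lambda>y. G x y z"]
      G_sym[OF x, of v u] G_sym[OF x, of w v] G_sym[OF x, of w u]
    unfolding f_def by (simp add: G_simps x algebra_simps)
  \<comment> \<open>The usual combination of the Bianchi identities of the four cyclic arrangements,
    with all signs normalized by the two antisymmetries.\<close>
  have pair: "f u v w z = f w z u v" for u v w z
    using bianchi[of u v w z] bianchi[of v w z u] bianchi[of w z u v] bianchi[of z u v w]
      anti[of u v] anti[of v w] anti[of u w] anti[of v z] anti[of u z] anti[of w z]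
      skew[of _ _ u v] skew[of _ _ u w] skew[of _ _ u z] skew[of _ _ v w] skew[of _ _ v z] skew[of _ _ w z]
    by simp
  \<comment> \<open>Polarization in \<open>v\<close>: the two cross terms of \<open>f0\<close> at
    \<open>v + z\<close> agree by pair symmetry. The next fact polarizes this one in
    \<open>u\<close>.\<close>
  have f1: "f u v u z = 0" for u v z
    using f0[of u "v + z"] f0[of u v] f0[of u z] pair[of u z u v]
    by (simp add: linear_add[OF lin2] linear_add[OF lin4])
  have f2: "f u v w z = - f w v u z" for u v w z
    using f1[of "u + w" v z] f1[of u v z] f1[of w v z]
    by (simp add: linear_add[OF lin1] linear_add[OF lin3])
  \<comment> \<open>By \<open>f2\<close> and \<open>anti\<close> the tensor is unchanged under
    cyclic permutation of the first three slots, so the Bianchi identity says that three times its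
    value is zero.\<close>
  have "f u v w z = 0" for u v w z
    using bianchi[of u v w z] f2[of u v w z] f2[of v w u z] f2[of w u v z]
      anti[of u v w z] anti[of v w u z] anti[of w u v z] by simp
  then show ?thesis
    by (intro G_ext[OF x]) (simp add: f_def G_simps x)
qed

end

subsection \<open>The static metric in coordinates\<close>

locale local_static =
  base: local_metric S G + total: local_metric "I \<times> S" Gb
  for S :: "'e::euclidean_space set" and G and I :: "real set" and Gb +
  fixes F :: "'e \<Rightarrow> real"
  assumes open_I: "open I" and F: "smooth_on S F" and pos: "x \<in> S \<Longrightarrow> F x > 0"
    and Gb: "t \<in> I \<Longrightarrow> x \<in> S \<Longrightarrow> Gb (t, x) (a, u) (b, v) = - (F x)\<^sup>2 * a * b + G x u v"
begin

abbreviation "DF \<equiv> \<lambda>x. frechet_derivative F (at x)"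

lemma F_has_derivative: "x \<in> S \<Longrightarrow> (F has_derivative DF x) (at x)"
  using smooth_on_has_derivative[OF F] .

text \<open>The explicit expressions for the static metric hold on \<open>I \<times> S\<close> only;
  openness of this set lets them be differentiated in place of the original.\<close>

lemma static_transform:
  assumes "t \<in> I" "x \<in> S" "(h has_derivative h') (at (t, x))"
    and "\<And>t x. t \<in> I \<Longrightarrow> x \<in> S \<Longrightarrow> h (t, x) = k (t, x)"
  shows "frechet_derivative k (at (t, x)) = h'"
proof -
  have "open (I \<times> S)" "(t, x) \<in> I \<times> S" using assms open_I base.open_S by (auto intro!: open_Times)
  from has_derivative_transform_within_open[OF assms(3) this, of k] show ?thesis
    using assms(4) by (intro fd_eqI) auto
qed

lemma has_derivative_snd_compose:
  assumes "(h has_derivative h') (at x)"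
  shows "((\<lambda>p. h (snd p)) has_derivative (\<lambda>H. h' (snd H))) (at (t, x))"
  using has_derivative_compose[OF bounded_linear_imp_has_derivative[OF bounded_linear_snd], of h h' "(t, x)"] assms
  by simp

lemma dmetric_static:
  assumes "t \<in> I" "x \<in> S"
  shows "dmetric Gb (t, x) H (a, u) (b, v) = - 2 * F x * DF x (snd H) * a * b + dmetric G x (snd H) u v"
proof -
  have "((\<lambda>p. G (snd p) u v) has_derivative (\<lambda>H. dmetric G x (snd H) u v)) (at (t, x))"
    unfolding dmetric_def
    by (rule has_derivative_snd_compose[OF fd_has_derivative[OF base.G_differentiable[OF assms(2)]]])
  moreover have "((\<lambda>p. - (F (snd p))\<^sup>2 * a * b) has_derivative (\<lambda>H. - 2 * F x * DF x (snd H) * a * b)) (at (t, x))"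
    by (auto intro!: derivative_eq_intros has_derivative_snd_compose[OF F_has_derivative[OF assms(2)]])
  ultimately have "((\<lambda>p. - (F (snd p))\<^sup>2 * a * b + G (snd p) u v) has_derivative
      (\<lambda>H. - 2 * F x * DF x (snd H) * a * b + dmetric G x (snd H) u v)) (at (t, x))"
    by (rule has_derivative_add[rotated])
  from static_transform[OF assms this, of "\<lambda>p. Gb p (a, u) (b, v)"] show ?thesis
    unfolding dmetric_def[of Gb] by (simp add: Gb)
qed

text \<open>The connection of a warped product: besides the connection of the base, Gamma(dt, v) =
  (v(f) / f) dt and Gamma(dt, dt) = f grad f. The candidate is checked against the Koszul
  formula.\<close>

lemma chris_static:
  assumes "t \<in> I" "x \<in> S"
  shows "christoffel_rep Gb (t, x) (a, u) (b, v) =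
    ((a * DF x v + b * DF x u) / F x, christoffel_rep G x u v + (a * b * F x) *\<^sub>R gradient_rep G F x)"
proof (rule total.chris_eqI)
  show "(t, x) \<in> I \<times> S" using assms by simp
  fix W :: "real \<times> 'e"
  obtain e w where W: "W = (e, w)" by fastforce
  show "2 * Gb (t, x) ((a * DF x v + b * DF x u) / F x, christoffel_rep G x u v + (a * b * F x) *\<^sub>R gradient_rep G F x) W
    = dmetric Gb (t, x) (a, u) (b, v) W + dmetric Gb (t, x) (b, v) (a, u) W - dmetric Gb (t, x) W (a, u) (b, v)"
  proof -
    \<comment> \<open>The quotient occurs only multiplied by the square of \<open>F x\<close>.
      Keeping it opaque leaves a polynomial identity for the simplifier.\<close>
    define q where "q = (a * DF x v + b * DF x u) / F x"
    have "F x * q = a * DF x v + b * DF x u" unfolding q_def using pos[OF assms(2)] by simp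
    then have "(F x)\<^sup>2 * q * e = F x * (a * DF x v + b * DF x u) * e" by (simp add: power2_eq_square)
    then show ?thesis
      unfolding W dmetric_static[OF assms] Gb[OF assms] snd_conv q_def[symmetric]
      using base.chris_koszul[OF assms(2), of u v w]
      by (simp add: base.G_simps assms base.G_lgrad[OF assms(2) F] algebra_simps)
  qed
qed

lemma dchris_static:
  assumes "t \<in> I" "x \<in> S"
  shows "dchris Gb (t, x) (c, h) (a, u) (b, v) =
    ((a * frechet_derivative (\<lambda>y. DF y v) (at x) h + b * frechet_derivative (\<lambda>y. DF y u) (at x) h) / F x
       - (a * DF x v + b * DF x u) * DF x h / (F x)\<^sup>2,
     dchris G x h u v + (a * b) *\<^sub>R (DF x h *\<^sub>R gradient_rep G F x + F x *\<^sub>R frechet_derivative (gradient_rep G F) (at x) h))"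
proof -
  note x = assms(2)
  have nz: "F x \<noteq> 0" using pos[OF x] by simp
  have D: "((\<lambda>y. DF y w) has_derivative (\<lambda>h. frechet_derivative (\<lambda>y. DF y w) (at x) h)) (at x)" for w
    using smooth_on_has_derivative[OF smooth_on_fd[OF F] x] by (simp add: eta_contract_eq)
  have 1: "((\<lambda>y. (a * DF y v + b * DF y u) / F y) has_derivative
    (\<lambda>h. - (a * DF x v + b * DF x u) * (inverse (F x) * DF x h * inverse (F x))
      + (a * frechet_derivative (\<lambda>y. DF y v) (at x) h + b * frechet_derivative (\<lambda>y. DF y u) (at x) h) / F x)) (at x)"
    by (intro has_derivative_divide has_derivative_add has_derivative_mult_right D F_has_derivative x nz)
  have 2: "((\<lambda>y. christoffel_rep G y u v + (a * b * F y) *\<^sub>R gradient_rep G F y) has_derivative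
    (\<lambda>h. dchris G x h u v + ((a * b * F x) *\<^sub>R frechet_derivative (gradient_rep G F) (at x) h + (a * b * DF x h) *\<^sub>R gradient_rep G F x))) (at x)"
    unfolding dchris_def
    by (intro has_derivative_add has_derivative_scaleR has_derivative_mult_right F_has_derivative x
        fd_has_derivative base.chris_differentiable base.lgrad_differentiable[OF x F])
  from static_transform[OF assms has_derivative_Pair[OF has_derivative_snd_compose[OF 1] has_derivative_snd_compose[OF 2]],
      of "\<lambda>p. christoffel_rep Gb p (a, u) (b, v)"]
  show ?thesis
    unfolding dchris_def[of Gb] using nz
    by (simp add: chris_static algebra_simps divide_inverse power2_eq_square)
qed

text \<open>The terms quadratic in the differential of \<open>F\<close>, and the bare multiples of
  grad F, arise both from differentiating the Christoffel symbols and from their products, and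
  cancel. Second derivatives of \<open>F\<close> survive only as Hess F and nabla grad F.\<close>

lemma curv_static:
  assumes "t \<in> I" "x \<in> S"
  shows "riemann_rep Gb (t, x) (a, u) (b, v) (e, w) =
    ((a * hessian_rep G F x v w - b * hessian_rep G F x u w) / F x,
     riemann_rep G x u v w + (e * F x) *\<^sub>R (a *\<^sub>R nabla_gradient_rep G F x v - b *\<^sub>R nabla_gradient_rep G F x u))"
proof -
  note x = assms(2)
  have nz: "F x \<noteq> 0" using pos[OF x] by simp
  have lin: "linear (DF x)" using fd_linear[OF F x] .
  have s: "frechet_derivative (\<lambda>y. DF y u) (at x) v = frechet_derivative (\<lambda>y. DF y v) (at x) u"
    by (rule fd_symmetric[OF base.open_S x F])
  \<comment> \<open>\<open>\<alpha>\<close> and \<open>\<beta>\<close> are the time components of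
    the inner Christoffel terms for (U, W) and (V, W). In the outer terms grad F has the
    coefficients \<open>b * \<alpha> * F x\<close> and \<open>a * \<beta> * F x\<close>, from which
    the denominator disappears.\<close>
  define \<alpha> where "\<alpha> = (a * DF x w + e * DF x u) / F x"
  define \<beta> where "\<beta> = (b * DF x w + e * DF x v) / F x"
  have \<alpha>: "b * \<alpha> * F x = b * (a * DF x w + e * DF x u)" and \<beta>: "a * \<beta> * F x = a * (b * DF x w + e * DF x v)"
    using nz by (simp_all add: \<alpha>_def \<beta>_def)
  show ?thesis
    unfolding riemann_rep_def[of Gb] dchris_static[OF assms] chris_static[OF assms] \<alpha>_def[symmetric] \<beta>_def[symmetric]
      \<alpha> \<beta>
    apply (intro prod_eqI)
    subgoal using nz
      by (simp add: riemann_rep_def hessian_rep_def nabla_gradient_rep_def base.chris_simps x linear_add[OF lin] linear_scale[OF lin] s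
          \<alpha>_def \<beta>_def power2_eq_square field_simps base.chris_sym[OF x, of v u])
    subgoal
      by (simp add: riemann_rep_def hessian_rep_def nabla_gradient_rep_def base.chris_simps x
          algebra_simps base.chris_sym[OF x, of v u])
    done
qed

lemma static_space_form_iff:
  assumes "t \<in> I" "x \<in> S"
  shows "(\<forall>U V W. riemann_rep Gb (t, x) U V W = K *\<^sub>R (Gb (t, x) U W *\<^sub>R V - Gb (t, x) V W *\<^sub>R U)) \<longleftrightarrow>
    (\<forall>u. nabla_gradient_rep G F x u = - (K * F x) *\<^sub>R u) \<and>
    (\<forall>u v w. riemann_rep G x u v w = K *\<^sub>R (G x u w *\<^sub>R v - G x v w *\<^sub>R u))" (is "?L \<longleftrightarrow> ?R")
proof
  note x = assms(2)
  have nz: "F x \<noteq> 0" using pos[OF x] by simp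
  {
    assume L: ?L
    have "nabla_gradient_rep G F x v = - (K * F x) *\<^sub>R v" for v
    proof -
      have "riemann_rep Gb (t, x) (1, 0) (0, v) (1, 0)
          = K *\<^sub>R (Gb (t, x) (1, 0) (1, 0) *\<^sub>R (0, v) - Gb (t, x) (0, v) (1, 0) *\<^sub>R (1, 0))"
        using L by blast
      then have "F x *\<^sub>R nabla_gradient_rep G F x v = F x *\<^sub>R (- (K * F x) *\<^sub>R v)"
        unfolding curv_static[OF assms] Gb[OF assms]
        by (simp add: base.G_simps x linear_0[OF base.curv_linear(1)[OF x]] power2_eq_square mult.assoc mult.left_commute)
      then show ?thesis using nz by (metis scaleR_left_imp_eq)
    qed
    moreover have "riemann_rep G x u v w = K *\<^sub>R (G x u w *\<^sub>R v - G x v w *\<^sub>R u)" for u v w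
    proof -
      have "riemann_rep Gb (t, x) (0, u) (0, v) (0, w)
          = K *\<^sub>R (Gb (t, x) (0, u) (0, w) *\<^sub>R (0, v) - Gb (t, x) (0, v) (0, w) *\<^sub>R (0, u))"
        using L by blast
      then show ?thesis unfolding curv_static[OF assms] Gb[OF assms] by simp
    qed
    ultimately show ?R by blast
  next
    assume R: ?R
    \<comment> \<open>The time component of the curvature contains the Hessian as a bilinear form,
      so the condition on nabla grad F is lowered before use.\<close>
    have h: "hessian_rep G F x u w = - (K * F x) * G x u w" for u w
      using base.G_covgrad[OF x F, of u w] R by (simp add: base.G_simps x)
    show ?L
    proof (intro allI)
      fix U V W :: "real \<times> 'e"
      obtain a u b v e w where UVW: "U = (a, u)" "V = (b, v)" "W = (e, w)" by fastforce
      show "riemann_rep Gb (t, x) U V W = K *\<^sub>R (Gb (t, x) U W *\<^sub>R V - Gb (t, x) V W *\<^sub>R U)"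
        unfolding UVW curv_static[OF assms] Gb[OF assms] h using R nz
        by (simp add: field_simps power2_eq_square scaleR_diff_left scaleR_diff_right scaleR_add_left)
    qed
  }
qed

end

lemma cov_cong:
  assumes "open T" "x \<in> T" "X x = X' x" "\<And>y. y \<in> T \<Longrightarrow> Y y = Y' y"
  shows "nabla_rep G X Y x = nabla_rep G X' Y' x"
  unfolding nabla_rep_def using fd_cong[OF assms(1,2), of Y Y'] assms by simp

text \<open>Prepares the iterated covariant derivative: the inner one must be differentiable before
  the transformation law applies to the outer one.\<close>

lemma (in local_metric) cov_differentiable:
  assumes T: "open T" "T \<subseteq> S" "x \<in> T" and sm: "smooth_on T X" "smooth_on T Z"
  shows "nabla_rep G X Z differentiable (at x)"
proof -
  have x: "x \<in> S" using T by auto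
  note X = smooth_on_has_derivative[OF sm(1) T(3)] and Z = smooth_on_has_derivative[OF sm(2) T(3)]
  show ?thesis
    unfolding nabla_rep_def
    by (intro differentiable_add differentiableI[OF chris_has_derivative[OF x X Z]]
        differentiableI[OF has_derivative_linear_family[OF T(1,3) fd_linear[OF sm(2)] _ X]]
        smooth_on_differentiable[OF smooth_on_fd[OF sm(2)] T(3)])
qed

subsection \<open>Charts and tangent spaces\<close>

locale manifold =
  fixes A :: "('a::{t2_space,second_countable_topology}, 'e::euclidean_space) chart set"
  assumes atlas: "smooth_atlas A"
begin

abbreviation img :: "('a, 'e) chart \<Rightarrow> 'e set" where "img c \<equiv> cmap c ` cdom c"

abbreviation trans :: "('a, 'e) chart \<Rightarrow> ('a, 'e) chart \<Rightarrow> 'e \<Rightarrow> 'e" where "trans c d \<equiv> cmap d \<circ> cinv c"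

lemma cinv_cmap: "c \<in> A \<Longrightarrow> p \<in> cdom c \<Longrightarrow> cinv c (cmap c p) = p"
  using atlas unfolding smooth_atlas_def homeomorphism_def by blast

lemma cinv_in: "c \<in> A \<Longrightarrow> y \<in> img c \<Longrightarrow> cinv c y \<in> cdom c"
  by (auto simp: cinv_cmap)

lemma cmap_cinv: "c \<in> A \<Longrightarrow> y \<in> img c \<Longrightarrow> cmap c (cinv c y) = y"
  by (auto simp: cinv_cmap)

lemma open_cdom: "c \<in> A \<Longrightarrow> open (cdom c)"
  using atlas unfolding smooth_atlas_def by blast

lemma open_img: "c \<in> A \<Longrightarrow> open (img c)"
  using atlas unfolding smooth_atlas_def by blast

lemma open_cmap:
  assumes "c \<in> A" "open U"
  shows "open (cmap c ` (cdom c \<inter> U))"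
proof -
  have "cmap c ` (cdom c \<inter> U) = img c \<inter> cinv c -` U"
    using cinv_cmap[OF assms(1)] by auto
  moreover have "continuous_on (img c) (cinv c)"
    using atlas assms(1) unfolding smooth_atlas_def homeomorphism_def by blast
  ultimately show ?thesis
    using continuous_open_preimage[OF _ open_img[OF assms(1)] assms(2)] by simp
qed

lemma trans_smooth: "c \<in> A \<Longrightarrow> d \<in> A \<Longrightarrow> smooth_on (cmap c ` (cdom c \<inter> cdom d)) (trans c d)"
  using atlas unfolding smooth_atlas_def by blast

lemma chart_at_in: "p \<in> carrier A \<Longrightarrow> chart_at A p \<in> A \<and> p \<in> cdom (chart_at A p)"
  unfolding chart_at_def carrier_def by (rule someI_ex) auto

lemma carrierI: "c \<in> A \<Longrightarrow> p \<in> cdom c \<Longrightarrow> p \<in> carrier A"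
  unfolding carrier_def by blast

abbreviation jac :: "('a, 'e) chart \<Rightarrow> ('a, 'e) chart \<Rightarrow> 'a \<Rightarrow> 'e \<Rightarrow> 'e" where
  "jac c d p \<equiv> frechet_derivative (trans c d) (at (cmap c p))"

lemma trans_has_derivative:
  "c \<in> A \<Longrightarrow> d \<in> A \<Longrightarrow> p \<in> cdom c \<Longrightarrow> p \<in> cdom d \<Longrightarrow> (trans c d has_derivative jac c d p) (at (cmap c p))"
  by (rule smooth_on_has_derivative[OF trans_smooth]) auto

lemma jac_linear: "c \<in> A \<Longrightarrow> d \<in> A \<Longrightarrow> p \<in> cdom c \<Longrightarrow> p \<in> cdom d \<Longrightarrow> linear (jac c d p)"
  using trans_has_derivative has_derivative_linear by blast

lemma jac_self:
  assumes "c \<in> A" "p \<in> cdom c"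
  shows "jac c c p v = v"
proof -
  have "frechet_derivative (trans c c) (at (cmap c p)) = frechet_derivative (\<lambda>y. y) (at (cmap c p))"
    by (rule fd_cong[OF open_img[OF assms(1)]]) (use assms in \<open>auto simp: cmap_cinv\<close>)
  then show ?thesis by simp
qed

text \<open>The target of \<open>h\<close> is left general: for \<open>h\<close> a chart map this
  becomes the cocycle rule \<open>jac_comp\<close>, for a real function the chart independence of
  its differential.\<close>

lemma fd_chart_change:
  assumes "c \<in> A" "d \<in> A" "p \<in> cdom c" "p \<in> cdom d"
    and h: "(h \<circ> cinv d) differentiable (at (cmap d p))"
  shows "frechet_derivative (h \<circ> cinv c) (at (cmap c p)) v
       = frechet_derivative (h \<circ> cinv d) (at (cmap d p)) (jac c d p v)"
proof -
  have y: "trans c d (cmap c p) = cmap d p" using cinv_cmap assms by simp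
  have "((\<lambda>y. (h \<circ> cinv d) (trans c d y)) has_derivative
      (\<lambda>v. frechet_derivative (h \<circ> cinv d) (at (cmap d p)) (jac c d p v))) (at (cmap c p))"
    using has_derivative_compose[OF trans_has_derivative[OF assms(1-4)], of "h \<circ> cinv d"]
      fd_has_derivative[OF h] unfolding y by blast
  then have "((h \<circ> cinv c) has_derivative
      (\<lambda>v. frechet_derivative (h \<circ> cinv d) (at (cmap d p)) (jac c d p v))) (at (cmap c p))"
    by (rule has_derivative_transform_within_open[OF _ open_cmap[OF assms(1) open_cdom[OF assms(2)]]])
      (use assms in \<open>auto simp: cinv_cmap\<close>)
  from fd_eqI[OF this] show ?thesis by simp
qed

lemma jac_comp:
  assumes "c \<in> A" "d \<in> A" "e \<in> A" "p \<in> cdom c" "p \<in> cdom d" "p \<in> cdom e"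
  shows "jac c e p v = jac d e p (jac c d p v)"
  by (rule fd_chart_change[OF assms(1,2,4,5) differentiableI[OF trans_has_derivative[OF assms(2,3,5,6)]]])

lemma jac_surj:
  assumes "c \<in> A" "d \<in> A" "p \<in> cdom c" "p \<in> cdom d"
  shows "surj (jac c d p)"
  using jac_comp[of d c d p] jac_self[of d p] assms by (intro surjI[of _ "jac d c p"]) simp

lemma coord_field_apply:
  "d \<in> A \<Longrightarrow> p \<in> cdom d \<Longrightarrow> p \<in> cdom c \<Longrightarrow> coord_field A c a p d = jac c d p a"
  unfolding coord_field_def by simp

lemma coord_field_self: "c \<in> A \<Longrightarrow> p \<in> cdom c \<Longrightarrow> coord_field A c a p c = a"
  by (simp add: coord_field_apply jac_self)

lemma tangentI:
  assumes "\<And>c d. c \<in> A \<Longrightarrow> d \<in> A \<Longrightarrow> p \<in> cdom c \<Longrightarrow> p \<in> cdom d \<Longrightarrow> v d = jac c d p (v c)"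
    and "\<And>c. c \<notin> A \<or> p \<notin> cdom c \<Longrightarrow> v c = 0"
  shows "v \<in> tangent_space A p"
  unfolding tangent_space_def using assms by blast

lemma tangent_change:
  "v \<in> tangent_space A p \<Longrightarrow> c \<in> A \<Longrightarrow> d \<in> A \<Longrightarrow> p \<in> cdom c \<Longrightarrow> p \<in> cdom d \<Longrightarrow> v d = jac c d p (v c)"
  unfolding tangent_space_def by blast

lemma tangent_outside: "v \<in> tangent_space A p \<Longrightarrow> c \<notin> A \<or> p \<notin> cdom c \<Longrightarrow> v c = 0"
  unfolding tangent_space_def by blast

lemma coord_field_tangent:
  assumes c: "c \<in> A" "p \<in> cdom c"
  shows "coord_field A c a p \<in> tangent_space A p"
proof (rule tangentI)
  fix d e assume de: "d \<in> A" "e \<in> A" "p \<in> cdom d" "p \<in> cdom e"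
  show "coord_field A c a p e = jac d e p (coord_field A c a p d)"
    unfolding coord_field_apply[OF de(1,3) c(2)] coord_field_apply[OF de(2,4) c(2)]
    by (rule jac_comp[OF c(1) de(1,2) c(2) de(3,4)])
next
  fix d assume "d \<notin> A \<or> p \<notin> cdom d"
  then show "coord_field A c a p d = 0" unfolding coord_field_def by auto
qed

lemma coord_field_of_tangent:
  assumes c: "c \<in> A" "p \<in> cdom c" and v: "v \<in> tangent_space A p"
  shows "coord_field A c (v c) p = v"
proof
  fix d show "coord_field A c (v c) p d = v d"
  proof (cases "d \<in> A \<and> p \<in> cdom d")
    case True
    then show ?thesis using tangent_change[OF v c(1) _ c(2), of d] coord_field_apply[of d p c] c by simp
  next
    case False
    then show ?thesis using tangent_outside[OF v, of d] unfolding coord_field_def by auto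
  qed
qed

lemma tangent_eqI:
  assumes "c \<in> A" "p \<in> cdom c" "u \<in> tangent_space A p" "v \<in> tangent_space A p" "u c = v c"
  shows "u = v"
  using coord_field_of_tangent assms by metis

lemma tangent_combination:
  assumes u: "u \<in> tangent_space A p" and v: "v \<in> tangent_space A p"
  shows "(\<lambda>c. a *\<^sub>R u c + b *\<^sub>R v c) \<in> tangent_space A p"
proof (rule tangentI)
  fix c d assume cd: "c \<in> A" "d \<in> A" "p \<in> cdom c" "p \<in> cdom d"
  show "a *\<^sub>R u d + b *\<^sub>R v d = jac c d p (a *\<^sub>R u c + b *\<^sub>R v c)"
    unfolding tangent_change[OF u cd] tangent_change[OF v cd]
    by (simp add: linear_add[OF jac_linear[OF cd]] linear_scale[OF jac_linear[OF cd]])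
qed (simp add: tangent_outside[OF u] tangent_outside[OF v])

lemma tangent_add:
  "u \<in> tangent_space A p \<Longrightarrow> v \<in> tangent_space A p \<Longrightarrow> (\<lambda>c. u c + v c) \<in> tangent_space A p"
  using tangent_combination[of u p v 1 1] by simp

lemma tangent_diff:
  "u \<in> tangent_space A p \<Longrightarrow> v \<in> tangent_space A p \<Longrightarrow> (\<lambda>c. u c - v c) \<in> tangent_space A p"
  using tangent_combination[of u p v 1 "-1"] by simp

lemma zero_tangent: "(\<lambda>_. 0) \<in> tangent_space A p"
  by (rule tangentI) (simp_all add: linear_0[OF jac_linear])

lemma coord_field_combination:
  "c \<in> A \<Longrightarrow> p \<in> cdom c \<Longrightarrow>
    coord_field A c (a *\<^sub>R u + b *\<^sub>R v) p = (\<lambda>d. a *\<^sub>R coord_field A c u p d + b *\<^sub>R coord_field A c v p d)"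
  unfolding coord_field_def by (auto simp: linear_add[OF jac_linear] linear_scale[OF jac_linear])

lemma field_rep_cmap: "c \<in> A \<Longrightarrow> p \<in> cdom c \<Longrightarrow> field_rep c X (cmap c p) = X p c"
  unfolding field_rep_def by (simp add: cinv_cmap)

text \<open>In the chart \<open>d\<close> the components are the derivative of the transition from
  \<open>c\<close> to \<open>d\<close> in the fixed direction \<open>a\<close>, evaluated at the
  transition back to \<open>c\<close>.\<close>

lemma coord_field_smooth:
  assumes "c \<in> A" "d \<in> A"
  shows "smooth_on (cmap d ` (cdom d \<inter> cdom c)) (field_rep d (coord_field A c a))"
proof (rule smooth_on_cong[OF open_cmap[OF assms(2) open_cdom[OF assms(1)]]])
  show "smooth_on (cmap d ` (cdom d \<inter> cdom c)) (\<lambda>y. frechet_derivative (trans c d) (at (trans d c y)) a)"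
    by (rule smooth_on_compose[OF open_cmap[OF assms(2) open_cdom[OF assms(1)]]
          open_cmap[OF assms(1) open_cdom[OF assms(2)]] _ smooth_on_fd[OF trans_smooth] trans_smooth])
      (use assms in \<open>auto simp: cinv_cmap\<close>)
  show "frechet_derivative (trans c d) (at (trans d c y)) a = field_rep d (coord_field A c a) y"
    if "y \<in> cmap d ` (cdom d \<inter> cdom c)" for y
    using that assms by (auto simp: field_rep_def cinv_cmap coord_field_apply)
qed

text \<open>The definition computes in the chart picked by \<open>chart_at\<close>; this frees the
  differential from that choice.\<close>

lemma differential_chart:
  assumes f: "smooth_function A f" and c: "c \<in> A" "p \<in> cdom c" and v: "v \<in> tangent_space A p"
  shows "differential A f p v = frechet_derivative (f \<circ> cinv c) (at (cmap c p)) (v c)"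
proof -
  let ?d = "chart_at A p"
  have d: "?d \<in> A" "p \<in> cdom ?d" using chart_at_in carrierI c by auto
  have "(f \<circ> cinv c) differentiable (at (cmap c p))"
    using f c unfolding smooth_function_def by (intro smooth_on_differentiable) auto
  from fd_chart_change[OF d(1) c(1) d(2) c(2) this]
  show ?thesis
    unfolding differential_def Let_def tangent_change[OF v d(1) c(1) d(2) c(2)] by simp
qed

end

subsection \<open>Metrics in charts\<close>

locale pr_manifold = manifold A for A :: "('a::{t2_space,second_countable_topology}, 'e::euclidean_space) chart set" +
  fixes g :: "('a, 'e) metric"
  assumes metric: "pseudo_riemannian A g"
begin

abbreviation G :: "('a, 'e) chart \<Rightarrow> 'e \<Rightarrow> 'e \<Rightarrow> 'e \<Rightarrow> real" where "G c \<equiv> metric_rep A g c"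

lemma metric_sym: "p \<in> carrier A \<Longrightarrow> u \<in> tangent_space A p \<Longrightarrow> v \<in> tangent_space A p \<Longrightarrow> g p u v = g p v u"
  using metric unfolding pseudo_riemannian_def by blast

lemma metric_combination:
  "p \<in> carrier A \<Longrightarrow> u \<in> tangent_space A p \<Longrightarrow> v \<in> tangent_space A p \<Longrightarrow> w \<in> tangent_space A p \<Longrightarrow>
    g p (\<lambda>c. a *\<^sub>R u c + b *\<^sub>R v c) w = a * g p u w + b * g p v w"
  using metric unfolding pseudo_riemannian_def by blast

lemma metric_nondeg:
  "p \<in> carrier A \<Longrightarrow> u \<in> tangent_space A p \<Longrightarrow> (\<And>v. v \<in> tangent_space A p \<Longrightarrow> g p u v = 0) \<Longrightarrow> u = (\<lambda>_. 0)"
  using metric unfolding pseudo_riemannian_def by blast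

lemma G_coord: "c \<in> A \<Longrightarrow> p \<in> cdom c \<Longrightarrow>
    G c (cmap c p) u v = g p (coord_field A c u p) (coord_field A c v p)"
  unfolding metric_rep_def Let_def by (simp add: cinv_cmap)

lemma metric_chart:
  "c \<in> A \<Longrightarrow> p \<in> cdom c \<Longrightarrow> u \<in> tangent_space A p \<Longrightarrow> v \<in> tangent_space A p \<Longrightarrow>
    g p u v = G c (cmap c p) (u c) (v c)"
  by (simp add: G_coord coord_field_of_tangent)

text \<open>The entry point for the coordinate calculus: results of \<open>local_metric\<close>
  become available in every chart.\<close>

lemma local_metric_chart:
  assumes c: "c \<in> A"
  shows "local_metric (img c) (G c)"
proof (rule local_metric.intro)
  show "open (img c)" using open_img[OF c] .
  show "smooth_on (img c) (\<lambda>x. G c x u v)" for u v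
    using metric c unfolding pseudo_riemannian_def by blast
  note tan = coord_field_tangent[OF c] and car = carrierI[OF c]
  show "G c x u v = G c x v u" if "x \<in> img c" for x u v
    using that by (auto simp: G_coord[OF c] intro: metric_sym[OF car tan tan])
  show "linear (\<lambda>u. G c x u v)" if xi: "x \<in> img c" for x v
  proof -
    obtain p where p: "p \<in> cdom c" and x: "x = cmap c p" using xi by blast
    note comb = metric_combination[OF car[OF p] tan[OF p] tan[OF p] tan[OF p]]
    show ?thesis
    proof (rule linearI)
      fix u u' r
      show "G c x (u + u') v = G c x u v + G c x u' v"
        using comb[of 1 u 1 u' v] coord_field_combination[OF c p, of 1 u 1 u']
        unfolding x G_coord[OF c p] by simp
      show "G c x (r *\<^sub>R u) v = r *\<^sub>R G c x u v"
        using comb[of r u 0 u v] coord_field_combination[OF c p, of r u 0 u]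
        unfolding x G_coord[OF c p] by simp
    qed
  qed
  show "u = 0" if x: "x \<in> img c" and u: "\<And>v. G c x u v = 0" for x u
  proof -
    obtain p where p: "p \<in> cdom c" and xp: "x = cmap c p" using x by blast
    have "g p (coord_field A c u p) v = 0" if "v \<in> tangent_space A p" for v
      using u[of "v c"] coord_field_of_tangent[OF c p that] unfolding xp G_coord[OF c p] by simp
    then have "coord_field A c u p = (\<lambda>_. 0)" by (rule metric_nondeg[OF car[OF p] tan[OF p]])
    then show ?thesis using coord_field_self[OF c p, of u] by simp
  qed
qed

lemma sharp_chart:
  assumes c: "c \<in> A" "p \<in> cdom c" and lin: "linear (\<lambda>w. \<alpha> (coord_field A c w p))"
  shows "sharp A g p \<alpha> = coord_field A c (raise_index (G c) (cmap c p) (\<lambda>w. \<alpha> (coord_field A c w p))) p"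
proof -
  interpret L: local_metric "img c" "G c" by (rule local_metric_chart[OF c(1)])
  let ?\<alpha> = "\<lambda>w. \<alpha> (coord_field A c w p)"
  let ?z = "raise_index (G c) (cmap c p) ?\<alpha>"
  have x: "cmap c p \<in> img c" using c by simp
  note tan = coord_field_tangent[OF c]
  show ?thesis
    unfolding sharp_def
  proof (rule the_equality, safe)
    show "coord_field A c ?z p \<in> tangent_space A p" by (rule tan)
    fix w assume w: "w \<in> tangent_space A p"
    show "g p (coord_field A c ?z p) w = \<alpha> w"
      using L.G_raise[OF x lin, of "w c"] metric_chart[OF c tan w] coord_field_self[OF c]
        coord_field_of_tangent[OF c w] by simp
  next
    fix z assume z: "z \<in> tangent_space A p" "\<forall>w\<in>tangent_space A p. g p z w = \<alpha> w"
    have "?z = z c"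
      by (rule L.raise_eqI[OF x]) (use z metric_chart[OF c z(1) tan] coord_field_self[OF c] tan in simp)
    then show "z = coord_field A c ?z p" using coord_field_of_tangent[OF c z(1)] by simp
  qed
qed

lemma christoffel_chart:
  assumes c: "c \<in> A" "p \<in> cdom c"
  shows "christoffel A g c p u v = christoffel_rep (G c) (cmap c p) u v"
proof -
  interpret L: local_metric "img c" "G c" by (rule local_metric_chart[OF c(1)])
  have x: "cmap c p \<in> img c" using c by simp
  show ?thesis
    unfolding christoffel_def dmetric_def[symmetric]
    using sharp_chart[OF c, of "\<lambda>w. (dmetric (G c) (cmap c p) u v (w c) + dmetric (G c) (cmap c p) v u (w c)
        - dmetric (G c) (cmap c p) (w c) u v) / 2"] L.koszul_linear[OF x, of u v]
    by (simp add: coord_field_self[OF c] christoffel_rep_def)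
qed

lemma gradient_chart:
  assumes c: "c \<in> A" "p \<in> cdom c" and f: "smooth_function A f"
  shows "gradient A g f p = coord_field A c (gradient_rep (G c) (f \<circ> cinv c) (cmap c p)) p"
proof -
  have *: "differential A f p (coord_field A c w p) = frechet_derivative (f \<circ> cinv c) (at (cmap c p)) w" for w
    using differential_chart[OF f c coord_field_tangent[OF c]] coord_field_self[OF c] by simp
  have "smooth_on (img c) (f \<circ> cinv c)" using f c unfolding smooth_function_def by blast
  from fd_linear[OF this, of "cmap c p"] sharp_chart[OF c, of "differential A f p"] c
  show ?thesis unfolding gradient_def * gradient_rep_def by simp
qed

lemma nabla_chart:
  assumes c: "c \<in> A" "p \<in> cdom c"
  shows "nabla A g X Y p c = nabla_rep (G c) (field_rep c X) (field_rep c Y) (cmap c p)"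
  unfolding nabla_def nabla_rep_def christoffel_chart[OF c] using c by (simp add: field_rep_cmap)

lemma field_rep_nabla:
  assumes "c \<in> A" "y \<in> img c"
  shows "field_rep c (nabla A g X Y) y = nabla_rep (G c) (field_rep c X) (field_rep c Y) y"
  using nabla_chart[OF assms(1)] assms field_rep_cmap[OF assms(1)] by auto

text \<open>The set \<open>T\<close> serves two uses: for global vector fields it is the whole chart
  image, for coordinate fields of another chart the image of the overlap.\<close>

lemma riemann_chart:
  assumes c: "c \<in> A" "p \<in> cdom c" and T: "open T" "T \<subseteq> img c" "cmap c p \<in> T"
    and sm: "smooth_on T (field_rep c X)" "smooth_on T (field_rep c Y)" "smooth_on T (field_rep c Z)"
  shows "riemann A g X Y Z p c = riemann_rep (G c) (cmap c p) (X p c) (Y p c) (Z p c)"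
proof -
  interpret L: local_metric "img c" "G c" by (rule local_metric_chart[OF c(1)])
  have x: "cmap c p \<in> img c" using c by simp
  have N: "nabla_rep (G c) V (field_rep c (nabla A g W Z)) (cmap c p)
      = nabla_rep (G c) V (nabla_rep (G c) (field_rep c W) (field_rep c Z)) (cmap c p)" for V W
    by (rule cov_cong[OF open_img[OF c(1)] x]) (auto simp: field_rep_nabla[OF c(1)])
  have B: "nabla_rep (G c) (field_rep c (lie_bracket A X Y)) W (cmap c p)
      = nabla_rep (G c) (\<lambda>y. frechet_derivative (field_rep c Y) (at y) (field_rep c X y)
          - frechet_derivative (field_rep c X) (at y) (field_rep c Y y)) W (cmap c p)" for W
    by (rule cov_cong[OF open_img[OF c(1)] x]) (use c in \<open>auto simp: field_rep_cmap lie_bracket_def\<close>)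
  show ?thesis
    unfolding riemann_def nabla_chart[OF c] N B L.curv_tensorial[OF T sm] field_rep_cmap[OF c] ..
qed

text \<open>\<open>U\<close> cuts the overlap down to the points where a field is known to take
  values in the tangent spaces.\<close>

lemma local_isometry_charts:
  assumes c: "c \<in> A" and d: "d \<in> A" and U: "open U"
  shows "local_isometry (img c) (G c) (img d) (G d) (cmap c ` (cdom c \<inter> (cdom d \<inter> U))) (trans c d)"
proof -
  interpret C: local_metric "img c" "G c" by (rule local_metric_chart[OF c])
  interpret D: local_metric "img d" "G d" by (rule local_metric_chart[OF d])
  let ?T = "cmap c ` (cdom c \<inter> (cdom d \<inter> U))"
  show ?thesis
  proof
    show "open ?T" by (intro open_cmap[OF c] open_Int open_cdom[OF d] U)
    show "?T \<subseteq> img c" by auto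
    show "smooth_on ?T (trans c d)" by (rule smooth_on_subset[OF trans_smooth[OF c d]]) auto
    fix x assume "x \<in> ?T"
    then obtain p where p: "p \<in> cdom c" "p \<in> cdom d" and x: "x = cmap c p" by blast
    show "trans c d x \<in> img d" unfolding x using cinv_cmap[OF c] p by simp
    show "surj (frechet_derivative (trans c d) (at x))" unfolding x using jac_surj[OF c d p] .
    show "G c x u v = G d (trans c d x) (frechet_derivative (trans c d) (at x) u)
        (frechet_derivative (trans c d) (at x) v)" for u v
      using metric_chart[OF d p(2) coord_field_tangent[OF c p(1), of u] coord_field_tangent[OF c p(1), of v]]
        coord_field_apply[OF d p(2,1)]
      unfolding x G_coord[OF c p(1)] by (simp add: cinv_cmap[OF c p(1)])
  qed
qed

text \<open>\<open>nabla\<close> is defined chart by chart, so its value is a tangent vector only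
  because the coordinate expressions are related by the Jacobians, which is
  \<open>cov_transform\<close>. A local hypothesis on \<open>Y\<close> suits coordinate fields and
  their derivatives.\<close>

lemma nabla_tangent:
  assumes X: "X p \<in> tangent_space A p" and U: "open U" "p \<in> U"
    and Y: "\<And>q. q \<in> U \<Longrightarrow> Y q \<in> tangent_space A q"
    and diff: "\<And>c. c \<in> A \<Longrightarrow> p \<in> cdom c \<Longrightarrow> field_rep c Y differentiable (at (cmap c p))"
  shows "nabla A g X Y p \<in> tangent_space A p"
proof -
  have "nabla A g X Y p d = jac c d p (nabla A g X Y p c)"
    if c: "c \<in> A" "p \<in> cdom c" and d: "d \<in> A" "p \<in> cdom d" for c d
  proof -
    interpret local_isometry "img c" "G c" "img d" "G d" "cmap c ` (cdom c \<inter> (cdom d \<inter> U))" "trans c d"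
      by (rule local_isometry_charts[OF c(1) d(1) U(1)])
    have px: "trans c d (cmap c p) = cmap d p" using cinv_cmap[OF c] by simp
    have "nabla_rep (G d) (field_rep d X) (field_rep d Y) (trans c d (cmap c p))
        = jac c d p (nabla_rep (G c) (field_rep c X) (field_rep c Y) (cmap c p))"
    proof (rule cov_transform)
      show "cmap c p \<in> cmap c ` (cdom c \<inter> (cdom d \<inter> U))" using c d U by blast
      show "field_rep d Y (trans c d y) = frechet_derivative (trans c d) (at y) (field_rep c Y y)"
        if yi: "y \<in> cmap c ` (cdom c \<inter> (cdom d \<inter> U))" for y
      proof -
        obtain q where q: "q \<in> cdom c" "q \<in> cdom d" "q \<in> U" and y: "y = cmap c q" using yi by blast
        show ?thesis
          unfolding y using tangent_change[OF Y[OF q(3)] c(1) d(1) q(1,2)]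
          by (simp add: field_rep_def cinv_cmap[OF c(1) q(1)] cinv_cmap[OF d(1) q(2)])
      qed
      show "field_rep c Y differentiable (at (cmap c p))" by (rule diff[OF c])
      show "field_rep d Y differentiable (at (trans c d (cmap c p)))" unfolding px by (rule diff[OF d])
      show "field_rep d X (trans c d (cmap c p)) = jac c d p (field_rep c X (cmap c p))"
        unfolding px field_rep_cmap[OF c] field_rep_cmap[OF d] using tangent_change[OF X c(1) d(1) c(2) d(2)] .
    qed
    then show ?thesis unfolding px nabla_chart[OF c] nabla_chart[OF d] .
  qed
  moreover have "nabla A g X Y p c = 0" if "c \<notin> A \<or> p \<notin> cdom c" for c
    using that unfolding nabla_def by (simp only: if_False de_Morgan_conj[symmetric])
  ultimately show ?thesis by (rule tangentI)
qed

text \<open>Immediate in the chart \<open>c\<close>, where the components are constant. In another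
  chart \<open>d\<close> the bracket is the difference of second derivatives of the transition in
  the directions \<open>a\<close> and \<open>b\<close>, which vanishes by symmetry.\<close>

lemma lie_bracket_coord_fields:
  assumes c: "c \<in> A" "p \<in> cdom c"
  shows "lie_bracket A (coord_field A c a) (coord_field A c b) p = (\<lambda>_. 0)"
proof -
  have "lie_bracket A (coord_field A c a) (coord_field A c b) p d = 0" if d: "d \<in> A" "p \<in> cdom d" for d
  proof -
    interpret local_isometry "img c" "G c" "img d" "G d" "cmap c ` (cdom c \<inter> (cdom d \<inter> UNIV))" "trans c d"
      by (rule local_isometry_charts[OF c(1) d(1) open_UNIV])
    let ?x = "cmap c p"
    have px: "trans c d ?x = cmap d p" using cinv_cmap[OF c] by simp
    have x: "?x \<in> cmap c ` (cdom c \<inter> (cdom d \<inter> UNIV))" using c d by simp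
    have "frechet_derivative (field_rep d (coord_field A c b)) (at (trans c d ?x)) (jac c d p a)
        = H ?x a b + jac c d p (frechet_derivative (\<lambda>_. b) (at ?x) a)" for a b
    proof (rule fd_transform[OF x, where Y = "\<lambda>_. b"])
      show "field_rep d (coord_field A c b) (trans c d y) = frechet_derivative (trans c d) (at y) b"
        if "y \<in> cmap c ` (cdom c \<inter> (cdom d \<inter> UNIV))" for y
        using that by (auto simp: field_rep_def cinv_cmap[OF c(1)] cinv_cmap[OF d(1)] coord_field_apply[OF d(1)])
      show "field_rep d (coord_field A c b) differentiable (at (trans c d ?x))"
        unfolding px using c d by (intro smooth_on_differentiable[OF coord_field_smooth[OF c(1) d(1)]]) auto
    qed simp
    then show ?thesis
      unfolding lie_bracket_def using c d H_sym[OF x, of a b]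
      by (simp add: cinv_cmap[OF c] coord_field_apply linear_0[OF jac_linear[OF c(1) d(1) c(2) d(2)]])
  qed
  then show ?thesis unfolding lie_bracket_def by auto
qed

text \<open>The metric can be evaluated in coordinates on tangent vectors only, so the curvature
  vector has to be recognized as one before it enters the sectional curvature.\<close>

lemma riemann_coord_fields_tangent:
  assumes c: "c \<in> A" "p \<in> cdom c"
  shows "riemann A g (coord_field A c u) (coord_field A c v) (coord_field A c w) p \<in> tangent_space A p"
proof -
  let ?E = "coord_field A c"
  have sm: "smooth_on (cmap d ` (cdom d \<inter> cdom c)) (field_rep d (?E a))" if "d \<in> A" for d a
    using coord_field_smooth[OF c(1) that] .
  have mem: "cmap d q \<in> cmap d ` (cdom d \<inter> cdom c)" if "q \<in> cdom d" "q \<in> cdom c" for d q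
    using that by auto
  have E: "nabla A g (?E a) (?E b) q \<in> tangent_space A q" if "q \<in> cdom c" for a b q
    using that by (intro nabla_tangent[OF _ open_cdom[OF c(1)]] coord_field_tangent[OF c(1)]
        smooth_on_differentiable[OF sm] mem)
  have dN: "field_rep d (nabla A g (?E a) (?E b)) differentiable (at (cmap d p))"
    if d: "d \<in> A" "p \<in> cdom d" for a b d
  proof -
    interpret L: local_metric "img d" "G d" by (rule local_metric_chart[OF d(1)])
    have "nabla_rep (G d) (field_rep d (?E a)) (field_rep d (?E b)) differentiable (at (cmap d p))"
      by (rule L.cov_differentiable[OF open_cmap[OF d(1) open_cdom[OF c(1)]] _ mem[OF d(2) c(2)] sm[OF d(1)] sm[OF d(1)]]) auto
    then show ?thesis
      by (rule differentiable_cong_open[OF open_img[OF d(1)], rotated -1]) (use d in \<open>auto simp: field_rep_nabla\<close>)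
  qed
  have "nabla A g (?E a) (nabla A g (?E b) (?E w)) p \<in> tangent_space A p" for a b
  proof (rule nabla_tangent)
    show "?E a p \<in> tangent_space A p" by (rule coord_field_tangent[OF c])
    show "open (cdom c)" "p \<in> cdom c" using open_cdom c by auto
  qed (use E dN in auto)
  moreover have "nabla A g (lie_bracket A (?E u) (?E v)) (?E w) p \<in> tangent_space A p"
  proof (rule nabla_tangent[OF _ open_cdom[OF c(1)] c(2) coord_field_tangent[OF c(1)]])
    show "lie_bracket A (?E u) (?E v) p \<in> tangent_space A p"
      unfolding lie_bracket_coord_fields[OF c] by (rule zero_tangent)
    show "field_rep d (?E w) differentiable (at (cmap d p))" if "d \<in> A" "p \<in> cdom d" for d
      using smooth_on_differentiable[OF sm mem] that c by blast
  qed auto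
  ultimately show ?thesis
    unfolding riemann_def by (intro tangent_add tangent_diff)
qed

text \<open>\<open>riemann_at\<close> extends the vectors by constants in a chosen chart
  \<open>?d\<close>, while \<open>c\<close> is arbitrary. Tensoriality in \<open>c\<close> removes
  the dependence on the extension.\<close>

lemma sectional_curvature_chart:
  assumes c: "c \<in> A" "p \<in> cdom c" and uv: "u \<in> tangent_space A p" "v \<in> tangent_space A p"
  shows "g p (riemann_at A g p u v u) v = G c (cmap c p) (riemann_rep (G c) (cmap c p) (u c) (v c) (u c)) (v c)"
proof -
  let ?d = "chart_at A p"
  have d: "?d \<in> A" "p \<in> cdom ?d" using chart_at_in carrierI c by auto
  have "riemann_at A g p u v u \<in> tangent_space A p"
    unfolding riemann_at_def Let_def by (rule riemann_coord_fields_tangent[OF d])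
  moreover have "riemann_at A g p u v u c = riemann_rep (G c) (cmap c p) (u c) (v c) (u c)"
    unfolding riemann_at_def Let_def
    using riemann_chart[OF c open_cmap[OF c(1) open_cdom[OF d(1)]] _ _ coord_field_smooth[OF d(1) c(1)]
        coord_field_smooth[OF d(1) c(1)] coord_field_smooth[OF d(1) c(1)]] c d
    by (simp add: coord_field_of_tangent[OF d] uv image_mono)
  ultimately show ?thesis using metric_chart[OF c _ uv(2)] by simp
qed

lemma constant_sectional_curvature_iff:
  assumes dim: "DIM('e) \<ge> 2"
  shows "constant_sectional_curvature A g \<kappa> \<longleftrightarrow> (\<forall>c\<in>A. \<forall>p\<in>cdom c. \<forall>u v w.
    riemann_rep (G c) (cmap c p) u v w = \<kappa> *\<^sub>R (G c (cmap c p) u w *\<^sub>R v - G c (cmap c p) v w *\<^sub>R u))" (is "?L \<longleftrightarrow> ?R")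
proof
  assume L: ?L
  show ?R
  proof (intro ballI allI)
    fix c p u v w assume c: "c \<in> A" "p \<in> cdom c"
    interpret L: local_metric "img c" "G c" by (rule local_metric_chart[OF c(1)])
    note tan = coord_field_tangent[OF c]
    have x: "cmap c p \<in> img c" using c by simp
    show "riemann_rep (G c) (cmap c p) u v w = \<kappa> *\<^sub>R (G c (cmap c p) u w *\<^sub>R v - G c (cmap c p) v w *\<^sub>R u)"
    proof (rule L.space_form_if_sectional[OF x dim])
      fix u v
      assume nz: "G c (cmap c p) u u * G c (cmap c p) v v - (G c (cmap c p) u v)\<^sup>2 \<noteq> 0"
      then have "sectional_curvature A g p (coord_field A c u p) (coord_field A c v p) = \<kappa>"
        using L carrierI[OF c] tan unfolding constant_sectional_curvature_def G_coord[OF c] by blast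
      then show "G c (cmap c p) (riemann_rep (G c) (cmap c p) u v u) v
          = \<kappa> * (G c (cmap c p) u u * G c (cmap c p) v v - (G c (cmap c p) u v)\<^sup>2)"
        using nz unfolding sectional_curvature_def sectional_curvature_chart[OF c tan tan] coord_field_self[OF c]
          G_coord[OF c, symmetric] by (simp add: field_simps)
    qed
  qed
next
  assume R: ?R
  show ?L
    unfolding constant_sectional_curvature_def
  proof (intro ballI impI)
    fix p u v assume "p \<in> carrier A" and uv: "u \<in> tangent_space A p" "v \<in> tangent_space A p"
      and nz: "g p u u * g p v v - (g p u v)\<^sup>2 \<noteq> 0"
    then obtain c where c: "c \<in> A" "p \<in> cdom c" unfolding carrier_def by blast
    interpret L: local_metric "img c" "G c" by (rule local_metric_chart[OF c(1)])
    have x: "cmap c p \<in> img c" using c by simp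
    have "G c (cmap c p) (riemann_rep (G c) (cmap c p) (u c) (v c) (u c)) (v c) = \<kappa> * (g p u u * g p v v - (g p u v)\<^sup>2)"
      using R c L.G_sym[OF x, of "v c" "u c"]
      by (simp add: metric_chart[OF c] uv L.G_simps x power2_eq_square)
    then show "sectional_curvature A g p u v = \<kappa>"
      using nz unfolding sectional_curvature_def sectional_curvature_chart[OF c uv] by simp
  qed
qed

end

subsection \<open>Bump functions and extension of tangent vectors\<close>

text \<open>Differentiation preserves this family of functions, so they are all smooth.\<close>

definition flat_fun :: "real poly \<Rightarrow> real \<Rightarrow> real" where
  "flat_fun p t = (if t > 0 then poly p (1 / t) * exp (- (1 / t)) else 0)"

lemma poly_times_exp_tendsto_0: "((\<lambda>s. poly p s * exp (- s)) \<longlongrightarrow> (0 :: real)) at_top"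
proof -
  have "((\<lambda>s. \<Sum>i\<le>degree p. coeff p i * (s ^ i / exp s)) \<longlongrightarrow> (\<Sum>i\<le>degree p. coeff p i * 0)) at_top"
    by (intro tendsto_sum tendsto_mult tendsto_const tendsto_power_div_exp_0)
  then show ?thesis
    by (simp add: poly_altdef sum_distrib_right exp_minus divide_inverse mult.assoc)
qed

lemma flat_fun_tendsto_0: "(flat_fun p \<longlongrightarrow> 0) (at 0)"
proof (rule filterlim_split_at)
  have "eventually (\<lambda>t. flat_fun p t = 0) (at_left 0)"
    unfolding eventually_at_filter flat_fun_def by (rule always_eventually) auto
  then show "(flat_fun p \<longlongrightarrow> 0) (at_left 0)" by (rule tendsto_eventually)
  have "((\<lambda>t. poly p (inverse t) * exp (- inverse t)) \<longlongrightarrow> 0) (at_right 0)"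
    by (rule filterlim_compose[OF poly_times_exp_tendsto_0 filterlim_inverse_at_top_right])
  moreover have "eventually (\<lambda>t. poly p (inverse t) * exp (- inverse t) = flat_fun p t) (at_right 0)"
    unfolding eventually_at_filter flat_fun_def
    by (rule always_eventually) (auto simp: inverse_eq_divide)
  ultimately show "(flat_fun p \<longlongrightarrow> 0) (at_right 0)" by (rule Lim_transform_eventually)
qed

text \<open>For positive t the derivative of p(1/t) exp(-1/t) is (1/t)^2 (p - p')(1/t) exp(-1/t),
  which explains the new polynomial. At 0 every function of the family has derivative 0.\<close>

lemma flat_fun_has_derivative:
  "(flat_fun p has_real_derivative flat_fun (monom 1 2 * (p - pderiv p)) t) (at t)"
proof -
  consider "t > 0" | "t < 0" | "t = 0" by linarith
  then show ?thesis
  proof cases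
    case 1
    have "((\<lambda>t. poly p (1 / t) * exp (- (1 / t))) has_real_derivative
      poly p (1 / t) * (exp (- (1 / t)) * (1 / t\<^sup>2)) + poly (pderiv p) (1 / t) * (- 1 / t\<^sup>2) * exp (- (1 / t))) (at t)"
      using 1 by (auto intro!: derivative_eq_intros DERIV_chain2[OF poly_DERIV] simp: power2_eq_square)
    moreover have "poly p (1 / t) * (exp (- (1 / t)) * (1 / t\<^sup>2)) + poly (pderiv p) (1 / t) * (- 1 / t\<^sup>2) * exp (- (1 / t))
      = flat_fun (monom 1 2 * (p - pderiv p)) t"
      using 1 unfolding flat_fun_def by (simp add: poly_monom field_simps)
    ultimately have "((\<lambda>t. poly p (1 / t) * exp (- (1 / t))) has_real_derivative
      flat_fun (monom 1 2 * (p - pderiv p)) t) (at t)" by simp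
    then show ?thesis
      by (rule DERIV_cong_ev[THEN iffD1, rotated -1, OF _ refl _ refl])
        (use 1 in \<open>auto simp: flat_fun_def eventually_nhds intro!: exI[of _ "{0<..}"]\<close>)
  next
    case 2
    have "((\<lambda>_. 0) has_real_derivative flat_fun (monom 1 2 * (p - pderiv p)) t) (at t)"
      using 2 by (simp add: flat_fun_def)
    then show ?thesis
      by (rule DERIV_cong_ev[THEN iffD1, rotated -1, OF _ refl _ refl])
        (use 2 in \<open>auto simp: flat_fun_def eventually_nhds intro!: exI[of _ "{..<0}"]\<close>)
  next
    case 3
    \<comment> \<open>Dividing by \<open>h\<close> multiplies the polynomial in 1 / h by its
      variable, so the difference quotient at 0 stays in the family and tends to 0.\<close>
    have "(\<lambda>h. (flat_fun p (0 + h) - flat_fun p 0) / h) = flat_fun (pCons 0 p)"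
      by (rule ext) (auto simp: flat_fun_def)
    then show ?thesis
      using flat_fun_tendsto_0[of "pCons 0 p"] 3 unfolding DERIV_def by (simp add: flat_fun_def[of _ 0])
  qed
qed

lemma flat_fun_smooth: "smooth_on UNIV (flat_fun p)"
proof -
  have "Ck_on n UNIV (flat_fun p)" for n p
  proof (induction n arbitrary: p)
    case 0
    then show ?case
      using flat_fun_has_derivative DERIV_isCont continuous_at_imp_continuous_on by (simp, blast)
  next
    case (Suc n)
    let ?q = "monom 1 2 * (p - pderiv p)"
    have d: "(flat_fun p has_derivative (\<lambda>v. flat_fun ?q x * v)) (at x)" for x
      using flat_fun_has_derivative[of p x] unfolding has_field_derivative_def .
    have "Ck_on n UNIV (\<lambda>x. flat_fun ?q x * v)" for v
      by (rule Ck_on_bilinear[OF open_UNIV bounded_bilinear_mult Suc.IH Ck_on_const])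
    then show ?case using d by (auto simp: fd_eqI[OF d] intro: differentiableI)
  qed
  then show ?thesis unfolding smooth_on_def by blast
qed

lemma bump_exists:
  fixes x :: "'e::euclidean_space"
  assumes "r > 0"
  obtains \<psi> :: "'e \<Rightarrow> real" where "smooth_on UNIV \<psi>" "\<psi> x = 1" "\<And>y. y \<notin> cball x r \<Longrightarrow> \<psi> y = 0"
proof -
  \<comment> \<open>On the open ball this is exp(-1 / (r^2 - |y - x|^2)), and outside it is 0.
    Differences are written as sums with a negative so that the smoothness rules for sums and linear
    maps apply; division by \<open>h x\<close> normalizes the value at the centre.\<close>
  define h where "h = (\<lambda>y. flat_fun 1 (r\<^sup>2 + - ((y + - x) \<bullet> (y + - x))))"
  have neg: "smooth_on UNIV (\<lambda>y::real. - y)"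
    by (rule smooth_on_bounded_linear) (rule bounded_linear_minus[OF bounded_linear_ident])
  have "smooth_on UNIV (\<lambda>y. r\<^sup>2 + - ((y + - x) \<bullet> (y + - x)))"
    by (intro smooth_on_add smooth_on_const smooth_on_compose[OF _ open_UNIV _ neg]
        smooth_on_bilinear[OF _ bounded_bilinear_inner] smooth_on_bounded_linear bounded_linear_ident) auto
  then have "smooth_on UNIV h"
    unfolding h_def by (rule smooth_on_compose[OF open_UNIV open_UNIV _ flat_fun_smooth, rotated]) auto
  then have "smooth_on UNIV (\<lambda>y. h y * (1 / h x))"
    by (intro smooth_on_bilinear[OF _ bounded_bilinear_mult] smooth_on_const) auto
  moreover have "h x \<noteq> 0" unfolding h_def flat_fun_def using assms by simp
  moreover have "h y = 0" if "y \<notin> cball x r" for y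
  proof -
    have "r < norm (y - x)" using that by (simp add: dist_norm norm_minus_commute)
    then have "r\<^sup>2 < (norm (y - x))\<^sup>2" using assms by (intro power_strict_mono) auto
    then show ?thesis unfolding h_def flat_fun_def by (simp add: power2_norm_eq_inner)
  qed
  ultimately show ?thesis by (intro that[of "\<lambda>y. h y * (1 / h x)"]) auto
qed

text \<open>A coordinate field times a bump function. The field vanishes off the compact set
  \<open>K\<close>, which is closed because the space is Hausdorff; hence the domain of
  \<open>c\<close> and the complement of \<open>K\<close> are two open sets that cover the space,
  and smoothness is clear on each.\<close>

lemma (in manifold) vector_field_extension:
  assumes c: "c \<in> A" "p \<in> cdom c"
  obtains X where "vector_field A X" "X p c = a"
proof -
  have "cmap c p \<in> img c" using c by simp
  then obtain r where r: "r > 0" "cball (cmap c p) r \<subseteq> img c"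
    using open_img[OF c(1)] open_contains_cball by blast
  obtain \<psi> :: "'e \<Rightarrow> real" where \<psi>: "smooth_on UNIV \<psi>" "\<psi> (cmap c p) = 1" "\<And>y. y \<notin> cball (cmap c p) r \<Longrightarrow> \<psi> y = 0"
    using bump_exists[OF r(1), of "cmap c p"] by blast
  define X where "X q = (\<lambda>d. (if q \<in> cdom c then \<psi> (cmap c q) else 0) *\<^sub>R coord_field A c a q d)" for q
  define K where "K = cinv c ` cball (cmap c p) r"
  have "continuous_on (img c) (cinv c)"
    using atlas c(1) unfolding smooth_atlas_def homeomorphism_def by blast
  then have "compact K"
    unfolding K_def using r(2) by (intro compact_continuous_image compact_cball) (rule continuous_on_subset)
  then have oK: "open (- K)" using compact_imp_closed by blast
  have X0: "X q = (\<lambda>_. 0)" if "q \<notin> K" for q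
  proof (cases "q \<in> cdom c")
    case True
    then have "cmap c q \<notin> cball (cmap c p) r" using that cinv_cmap[OF c(1) True] unfolding K_def by force
    then show ?thesis unfolding X_def using \<psi>(3) by simp
  qed (simp add: X_def)
  have "X q \<in> tangent_space A q" for q
  proof (cases "q \<in> cdom c")
    case True
    note t = coord_field_tangent[OF c(1) True, of a]
    from tangent_combination[OF t t, of "\<psi> (cmap c q)" 0] True show ?thesis unfolding X_def by simp
  qed (simp add: X_def zero_tangent)
  moreover have "smooth_on (img d) (field_rep d X)" if d: "d \<in> A" for d
  proof -
    let ?V = "cmap d ` (cdom d \<inter> cdom c)" and ?W = "cmap d ` (cdom d \<inter> - K)"
    note oV = open_cmap[OF d open_cdom[OF c(1)]] and oW = open_cmap[OF d oK]
    have "K \<subseteq> cdom c" unfolding K_def using r(2) cinv_in[OF c(1)] by auto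
    then have "img d = ?V \<union> ?W" by auto
    moreover have "smooth_on ?V (field_rep d X)"
    proof (rule smooth_on_cong[OF oV])
      show "smooth_on ?V (\<lambda>y. \<psi> (trans d c y) *\<^sub>R field_rep d (coord_field A c a) y)"
        by (intro smooth_on_bilinear[OF oV bounded_bilinear_scaleR] coord_field_smooth[OF c(1) d]
            smooth_on_compose[OF oV open_UNIV _ \<psi>(1)] trans_smooth[OF d c(1)]) auto
      show "\<psi> (trans d c y) *\<^sub>R field_rep d (coord_field A c a) y = field_rep d X y" if "y \<in> ?V" for y
        using that by (auto simp: field_rep_def X_def cinv_cmap[OF d])
    qed
    moreover have "smooth_on ?W (field_rep d X)"
      by (rule smooth_on_cong[OF oW _ smooth_on_const[of _ 0]]) (auto simp: field_rep_def cinv_cmap[OF d] X0)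
    ultimately show ?thesis using smooth_on_Un[OF oV oW] by simp
  qed
  ultimately have "vector_field A X" unfolding vector_field_def by blast
  moreover have "X p c = a" unfolding X_def using c \<psi>(2) coord_field_self[OF c] by simp
  ultimately show ?thesis by (rule that)
qed

section \<open>The global conditions in terms of charts\<close>

context pr_manifold
begin

lemma vector_field_riemann:
  assumes "vector_field A X" "vector_field A Y" "vector_field A Z" and c: "c \<in> A" "p \<in> cdom c"
  shows "riemann A g X Y Z p c = riemann_rep (G c) (cmap c p) (X p c) (Y p c) (Z p c)"
  using assms unfolding vector_field_def
  by (intro riemann_chart[OF c open_img[OF c(1)]]) auto

lemma concircularly_flat_iff:
  "concircularly_flat A g \<longleftrightarrow> (\<forall>c\<in>A. \<forall>p\<in>cdom c. \<forall>u v w. riemann_rep (G c) (cmap c p) u v w =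
    (scalar_curvature A g p / (real DIM('e) * (real DIM('e) - 1))) *\<^sub>R
      (G c (cmap c p) u w *\<^sub>R v - G c (cmap c p) v w *\<^sub>R u))" (is "?L \<longleftrightarrow> ?R")
proof
  assume L: ?L
  show ?R
  proof (intro ballI allI)
    fix c p u v w assume c: "c \<in> A" "p \<in> cdom c"
    obtain X Y Z where X: "vector_field A X" "X p c = u" and Y: "vector_field A Y" "Y p c = v"
      and Z: "vector_field A Z" "Z p c = w"
      using vector_field_extension[OF c] by metis
    have tan: "X p \<in> tangent_space A p" "Y p \<in> tangent_space A p" "Z p \<in> tangent_space A p"
      using X Y Z carrierI[OF c] unfolding vector_field_def by auto
    have "concircular A g X Y Z p c = 0"
      using L X Y Z carrierI[OF c] unfolding concircularly_flat_def by metis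
    then show "riemann_rep (G c) (cmap c p) u v w = (scalar_curvature A g p / (real DIM('e) * (real DIM('e) - 1))) *\<^sub>R
      (G c (cmap c p) u w *\<^sub>R v - G c (cmap c p) v w *\<^sub>R u)"
      unfolding concircular_def vector_field_riemann[OF X(1) Y(1) Z(1) c]
      by (simp add: metric_chart[OF c] tan X Y Z)
  qed
next
  assume R: ?R
  show ?L
    unfolding concircularly_flat_def
  proof (intro allI impI ballI ext)
    fix X Y Z p c assume vf: "vector_field A X" "vector_field A Y" "vector_field A Z" and p: "p \<in> carrier A"
    have tan: "X p \<in> tangent_space A p" "Y p \<in> tangent_space A p" "Z p \<in> tangent_space A p"
      using vf p unfolding vector_field_def by auto
    show "concircular A g X Y Z p c = 0"
    proof (cases "c \<in> A \<and> p \<in> cdom c")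
      case True
      then have c: "c \<in> A" "p \<in> cdom c" by auto
      show ?thesis
        unfolding concircular_def vector_field_riemann[OF vf c]
        using R c by (simp add: metric_chart[OF c] tan)
    next
      case False
      \<comment> \<open>At indices that are not charts around \<open>p\<close>, covariant
        derivatives and tangent vectors have the default value 0, so every term vanishes.\<close>
      then have "nabla A g V W p c = 0" for V W unfolding nabla_def by (simp only: if_False)
      then show ?thesis
        unfolding concircular_def riemann_def
        using tangent_outside[OF tan(1)] tangent_outside[OF tan(2)] False by simp
    qed
  qed
qed

text \<open>The factor \<open>k\<close> depends on \<open>t\<close> as well, since it will be the
  scalar curvature of the product up to a constant factor, whereas the left side lives on the
  base.\<close>

lemma hessian_condition_iff:
  assumes f: "smooth_function A f"
  shows "(\<forall>X. vector_field A X \<longrightarrow> (\<forall>t\<in>I. \<forall>p\<in>carrier A.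
        nabla A g X (gradient A g f) p = (\<lambda>c. - (k t p * f p) *\<^sub>R X p c)))
    \<longleftrightarrow> (\<forall>t\<in>I. \<forall>c\<in>A. \<forall>p\<in>cdom c. \<forall>u. nabla_gradient_rep (G c) (f \<circ> cinv c) (cmap c p) u = - (k t p * f p) *\<^sub>R u)"
    (is "?L \<longleftrightarrow> ?R")
proof -
  have n: "nabla A g X (gradient A g f) p c = nabla_gradient_rep (G c) (f \<circ> cinv c) (cmap c p) (X p c)"
    if c: "c \<in> A" "p \<in> cdom c" for X p c
  proof -
    have "nabla_rep (G c) (field_rep c X) (field_rep c (gradient A g f)) (cmap c p)
      = nabla_rep (G c) (field_rep c X) (gradient_rep (G c) (f \<circ> cinv c)) (cmap c p)"
    proof (rule cov_cong[OF open_img[OF c(1)]])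
      fix y assume "y \<in> img c"
      then obtain q where q: "q \<in> cdom c" "y = cmap c q" by blast
      show "field_rep c (gradient A g f) y = gradient_rep (G c) (f \<circ> cinv c) y"
        unfolding q(2) field_rep_cmap[OF c(1) q(1)] gradient_chart[OF c(1) q(1) f] coord_field_self[OF c(1) q(1)] ..
    qed (use c in auto)
    then show ?thesis unfolding nabla_chart[OF c] by (simp add: nabla_rep_def nabla_gradient_rep_def field_rep_cmap[OF c])
  qed
  show ?thesis
  proof
    assume L: ?L
    show ?R
    proof (intro ballI allI)
      fix t c p u assume t: "t \<in> I" and c: "c \<in> A" "p \<in> cdom c"
      obtain X where X: "vector_field A X" "X p c = u" using vector_field_extension[OF c] by metis
      show "nabla_gradient_rep (G c) (f \<circ> cinv c) (cmap c p) u = - (k t p * f p) *\<^sub>R u"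
        using n[OF c, of X] L X t carrierI[OF c] by simp
    qed
  next
    assume R: ?R
    show ?L
    proof (intro allI impI ballI ext)
      fix X t p c assume X: "vector_field A X" and t: "t \<in> I" and p: "p \<in> carrier A"
      show "nabla A g X (gradient A g f) p c = - (k t p * f p) *\<^sub>R X p c"
      proof (cases "c \<in> A \<and> p \<in> cdom c")
        case True
        then show ?thesis using n R t by simp
      next
        case False
        then have "nabla A g X (gradient A g f) p c = 0" unfolding nabla_def by (simp only: if_False)
        moreover have "X p c = 0"
          using X p False tangent_outside[of "X p" p c] unfolding vector_field_def by auto
        ultimately show ?thesis by simp
      qed
    qed
  qed
qed

end

subsection \<open>Static space-times\<close>

lemma smooth_on_Pair:
  fixes h :: "'a::real_normed_vector \<Rightarrow> 'b::euclidean_space" and k :: "'a \<Rightarrow> 'c::euclidean_space"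
  assumes "open S" "smooth_on S h" "smooth_on S k"
  shows "smooth_on S (\<lambda>x. (h x, k x))"
proof -
  have b: "smooth_on UNIV (\<lambda>z::'b. (z, 0::'c))"
    by (intro smooth_on_bounded_linear bounded_linear_Pair bounded_linear_ident bounded_linear_zero)
  have c: "smooth_on UNIV (\<lambda>z::'c. (0::'b, z))"
    by (intro smooth_on_bounded_linear bounded_linear_Pair bounded_linear_ident bounded_linear_zero)
  have "smooth_on S (\<lambda>x. (h x, 0::'c))" "smooth_on S (\<lambda>x. (0::'b, k x))"
    using smooth_on_compose[OF assms(1) open_UNIV _ b assms(2)]
      smooth_on_compose[OF assms(1) open_UNIV _ c assms(3)] by simp_all
  from smooth_on_add[OF assms(1) this] show ?thesis by simp
qed

locale static_manifold = pr_manifold A g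
  for A :: "('a::{t2_space,second_countable_topology}, 'e::euclidean_space) chart set" and g +
  fixes I :: "real set" and f :: "'a \<Rightarrow> real"
  assumes open_I: "open I" and f: "smooth_function A f" and pos: "p \<in> carrier A \<Longrightarrow> f p > 0"
begin

definition product_chart :: "('a, 'e) chart \<Rightarrow> (real \<times> 'a, real \<times> 'e) chart" where
  "product_chart c = (I \<times> cdom c, map_prod (\<lambda>t. t) (cmap c))"

abbreviation B where "B \<equiv> static_atlas I A"

abbreviation gb where "gb \<equiv> static_metric I A g f"

lemma B_eq: "B = product_chart ` A"
proof (intro set_eqI iffI)
  fix z assume "z \<in> B"
  then obtain b c where "b = (I, \<lambda>t. t)" "c \<in> A" "z = (cdom b \<times> cdom c, map_prod (cmap b) (cmap c))"
    unfolding static_atlas_def product_atlas_def by blast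
  then show "z \<in> product_chart ` A" by (simp add: product_chart_def cdom_def[of "(I, _)"] cmap_def[of "(I, _)"])
next
  fix z assume "z \<in> product_chart ` A"
  then obtain c where "c \<in> A" "z = product_chart c" by blast
  moreover have "product_chart c = (cdom (I, \<lambda>t. t) \<times> cdom c, map_prod (cmap (I, \<lambda>t. t)) (cmap c))"
    by (simp add: product_chart_def cdom_def[of "(I, _)"] cmap_def[of "(I, _)"])
  ultimately show "z \<in> B" unfolding static_atlas_def product_atlas_def by blast
qed

lemma cdom_pch [simp]: "cdom (product_chart c) = I \<times> cdom c"
  unfolding product_chart_def cdom_def by simp

lemma cmap_pch [simp]: "cmap (product_chart c) q = (fst q, cmap c (snd q))"
  unfolding product_chart_def cmap_def by (simp add: map_prod_def case_prod_beta)

lemma image_fst_snd [simp]: "(\<lambda>q. (fst q, h (snd q))) ` (S \<times> D) = S \<times> h ` D"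
  by force

lemma image_cmap_pch: "cmap (product_chart c) ` (I \<times> D) = I \<times> cmap c ` D"
  by simp

lemma cinv_pch:
  assumes c: "c \<in> A" and "t \<in> I" "y \<in> img c"
  shows "cinv (product_chart c) (t, y) = (t, cinv c y)"
proof -
  have "inj_on (cmap (product_chart c)) (cdom (product_chart c))"
    unfolding inj_on_def by (auto dest: arg_cong[of _ _ "cinv c"] simp: cinv_cmap[OF c])
  then show ?thesis
    unfolding cinv_def[of "product_chart c"]
    by (rule inv_into_f_eq) (use assms cinv_in[OF c] cmap_cinv[OF c] in auto)
qed

lemma cinv_cmap_pch: "c \<in> A \<Longrightarrow> t \<in> I \<Longrightarrow> p \<in> cdom c \<Longrightarrow> cinv (product_chart c) (t, cmap c p) = (t, p)"
  by (simp add: cinv_pch cinv_cmap)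

lemma smooth_atlas_static: "smooth_atlas B"
  unfolding smooth_atlas_def B_eq ball_simps
proof (intro conjI ballI)
  fix c assume c: "c \<in> A"
  show "open (cdom (product_chart c))" using open_I open_cdom[OF c] by (simp add: open_Times)
  show "open (cmap (product_chart c) ` cdom (product_chart c))"
    unfolding cdom_pch image_cmap_pch using open_I open_img[OF c] by (rule open_Times)
  have hom: "homeomorphism (cdom c) (img c) (cmap c) (cinv c)"
    using atlas c unfolding smooth_atlas_def by blast
  have "continuous_on (I \<times> cdom c) (\<lambda>q. (fst q, cmap c (snd q)))"
    by (intro continuous_intros continuous_on_compose2[OF homeomorphism_cont1[OF hom]]) auto
  then have 1: "continuous_on (I \<times> cdom c) (cmap (product_chart c))"
    by (simp add: continuous_on_cong[OF refl cmap_pch])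
  have "continuous_on (I \<times> img c) (\<lambda>y. (fst y, cinv c (snd y)))"
    by (intro continuous_intros continuous_on_compose2[OF homeomorphism_cont2[OF hom]]) auto
  then have 2: "continuous_on (I \<times> img c) (cinv (product_chart c))"
    by (rule continuous_on_eq) (auto simp: cinv_pch[OF c])
  show "homeomorphism (cdom (product_chart c)) (cmap (product_chart c) ` cdom (product_chart c)) (cmap (product_chart c)) (cinv (product_chart c))"
    unfolding cdom_pch image_cmap_pch
    using 1 2 by (auto simp: homeomorphism_def cinv_cmap_pch[OF c] image_iff)
  fix d assume d: "d \<in> A"
  let ?T = "cmap c ` (cdom c \<inter> cdom d)"
  have oT: "open (I \<times> ?T)" using open_I open_cmap[OF c open_cdom[OF d]] by (simp add: open_Times)
  show "smooth_on (cmap (product_chart c) ` (cdom (product_chart c) \<inter> cdom (product_chart d))) (cmap (product_chart d) \<circ> cinv (product_chart c))"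
  proof -
    have T: "cmap (product_chart c) ` (cdom (product_chart c) \<inter> cdom (product_chart d)) = I \<times> ?T"
      unfolding cdom_pch Times_Int_Times Int_absorb image_cmap_pch ..
    show ?thesis
      unfolding T
    proof (rule smooth_on_cong[OF oT])
      show "smooth_on (I \<times> ?T) (\<lambda>y. (fst y, trans c d (snd y)))"
        by (intro smooth_on_Pair oT smooth_on_bounded_linear bounded_linear_fst bounded_linear_snd
            smooth_on_compose[OF oT open_cmap[OF c open_cdom[OF d]] _ trans_smooth[OF c d]]) auto
    qed (auto simp: cinv_pch[OF c])
  qed
qed

interpretation total: manifold B
  by standard (rule smooth_atlas_static)

lemma pch_in: "c \<in> A \<Longrightarrow> product_chart c \<in> B"
  unfolding B_eq by simp

lemma carrier_static: "carrier B = I \<times> carrier A"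
  unfolding carrier_def B_eq by auto

lemma chart_at_static:
  assumes "t \<in> I" "p \<in> carrier A"
  obtains c where "c \<in> A" "p \<in> cdom c" "chart_at B (t, p) = product_chart c"
proof -
  have "chart_at B (t, p) \<in> product_chart ` A" "(t, p) \<in> cdom (chart_at B (t, p))"
    using total.chart_at_in[of "(t, p)"] assms by (simp_all add: carrier_static B_eq[symmetric])
  then obtain c where "c \<in> A" "chart_at B (t, p) = product_chart c" "(t, p) \<in> cdom (product_chart c)" by auto
  then show ?thesis using that by simp
qed

lemma differential_static:
  assumes c: "c \<in> A" "p \<in> cdom c" and t: "t \<in> I" and u: "u \<in> tangent_space B (t, p)"
  shows "differential B fst (t, p) u = fst (u (product_chart c))"
proof -
  have o: "open (I \<times> img d)" if "d \<in> A" for d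
    using open_I open_img[OF that] by (simp add: open_Times)
  have "smooth_on (I \<times> img d) (fst \<circ> cinv (product_chart d))" if d: "d \<in> A" for d
    by (rule smooth_on_cong[OF o[OF d] _ smooth_on_bounded_linear[OF bounded_linear_fst]])
      (auto simp: cinv_pch[OF d])
  then have sm: "smooth_function B fst"
    unfolding smooth_function_def B_eq by simp
  have "frechet_derivative (fst \<circ> cinv (product_chart c)) (at (t, cmap c p)) = frechet_derivative fst (at (t, cmap c p))"
    by (rule fd_cong[OF o[OF c(1)]]) (use t c in \<open>auto simp: cinv_pch[OF c(1)]\<close>)
  then have "frechet_derivative (fst \<circ> cinv (product_chart c)) (at (t, cmap c p)) = fst"
    by (simp add: fd_eqI[OF bounded_linear_imp_has_derivative[OF bounded_linear_fst]])
  with total.differential_chart[OF sm pch_in[OF c(1)] _ u] c t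
  show ?thesis by simp
qed

text \<open>The definition computes in the product chart over some \<open>b\<close> picked by
  \<open>chart_at\<close>. The spatial part of the Jacobian between product charts is the Jacobian
  on the base (\<open>jac_static\<close>), and this carries the result from \<open>b\<close> to
  \<open>c\<close>.\<close>

lemma pushforward_static:
  assumes c: "c \<in> A" "p \<in> cdom c" and t: "t \<in> I" and u: "u \<in> tangent_space B (t, p)"
  shows "pushforward B A snd (t, p) u = coord_field A c (snd (u (product_chart c))) p"
proof -
  have jac_static: "snd (total.jac (product_chart b) (product_chart d) (t, p) w) = jac b d p (snd w)"
    and push: "frechet_derivative (cmap d \<circ> snd \<circ> cinv (product_chart b)) (at (cmap (product_chart b) (t, p))) w = jac b d p (snd w)"
    if b: "b \<in> A" "p \<in> cdom b" and d: "d \<in> A" "p \<in> cdom d" for b d w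
  proof -
    let ?T = "cmap b ` (cdom b \<inter> cdom d)" and ?x = "(t, cmap b p)"
    have oT: "open (I \<times> ?T)" using open_I open_cmap[OF b(1) open_cdom[OF d(1)]] by (simp add: open_Times)
    have x: "?x \<in> I \<times> ?T" using t b d by simp
    have D: "((\<lambda>y. trans b d (snd y)) has_derivative (\<lambda>w. jac b d p (snd w))) (at ?x)"
      using has_derivative_compose[OF bounded_linear_imp_has_derivative[OF bounded_linear_snd], of "trans b d" _ ?x]
        trans_has_derivative[OF b(1) d(1) b(2) d(2)] by simp
    have 2: "((cmap d \<circ> snd \<circ> cinv (product_chart b)) has_derivative (\<lambda>w. jac b d p (snd w))) (at ?x)"
      by (rule has_derivative_transform_within_open[OF D oT x]) (auto simp: cinv_pch[OF b(1)])
    then show "frechet_derivative (cmap d \<circ> snd \<circ> cinv (product_chart b)) (at (cmap (product_chart b) (t, p))) w = jac b d p (snd w)"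
      by (simp add: fd_eqI)
    have "(total.trans (product_chart b) (product_chart d) has_derivative (\<lambda>w. (fst w, jac b d p (snd w)))) (at ?x)"
      by (rule has_derivative_transform_within_open[OF has_derivative_Pair[OF
              bounded_linear_imp_has_derivative[OF bounded_linear_fst] D] oT x]) (auto simp: cinv_pch[OF b(1)])
    then show "snd (total.jac (product_chart b) (product_chart d) (t, p) w) = jac b d p (snd w)"
      by (simp add: fd_eqI)
  qed
  obtain b where b: "b \<in> A" "p \<in> cdom b" and at: "chart_at B (t, p) = product_chart b"
    using chart_at_static[OF t carrierI[OF c]] .
  have ub: "u (product_chart d) = total.jac (product_chart b) (product_chart d) (t, p) (u (product_chart b))" if "d \<in> A" "p \<in> cdom d" for d
    by (rule total.tangent_change[OF u]) (use b that t pch_in in auto)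
  have "pushforward B A snd (t, p) u = coord_field A b (snd (u (product_chart b))) p"
    unfolding pushforward_def at Let_def snd_conv coord_field_def using push[OF b] b by (intro ext) simp
  moreover have "coord_field A b (snd (u (product_chart b))) p = coord_field A c (snd (u (product_chart c))) p"
  proof (rule tangent_eqI[OF c coord_field_tangent[OF b] coord_field_tangent[OF c]])
    have "snd (u (product_chart c)) = jac b c p (snd (u (product_chart b)))" unfolding ub[OF c] by (rule jac_static[OF b c])
    then show "coord_field A b (snd (u (product_chart b))) p c = coord_field A c (snd (u (product_chart c))) p c"
      by (simp add: coord_field_self[OF c] coord_field_apply[OF c b(2)])
  qed
  ultimately show ?thesis by simp
qed

lemma static_metric_chart:
  assumes c: "c \<in> A" "p \<in> cdom c" and t: "t \<in> I"
    and u: "u \<in> tangent_space B (t, p)" and v: "v \<in> tangent_space B (t, p)"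
  shows "gb (t, p) u v = - (f p)\<^sup>2 * fst (u (product_chart c)) * fst (v (product_chart c))
    + G c (cmap c p) (snd (u (product_chart c))) (snd (v (product_chart c)))"
  unfolding static_metric_def Let_def differential_static[OF c t u] differential_static[OF c t v]
    snd_conv pushforward_static[OF c t u] pushforward_static[OF c t v] G_coord[OF c] ..

lemma static_metric_rep:
  assumes c: "c \<in> A" and t: "t \<in> I" and x: "x \<in> img c"
  shows "metric_rep B gb (product_chart c) (t, x) U V
    = - (f (cinv c x))\<^sup>2 * fst U * fst V + G c x (snd U) (snd V)"
proof -
  note p = cinv_in[OF c x]
  have m: "product_chart c \<in> B" "(t, cinv c x) \<in> cdom (product_chart c)" using c t p pch_in by auto
  show ?thesis
    unfolding metric_rep_def[of B] Let_def cinv_pch[OF c t x]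
      static_metric_chart[OF c p t total.coord_field_tangent[OF m] total.coord_field_tangent[OF m]]
      total.coord_field_self[OF m] cmap_cinv[OF c x] ..
qed

lemma pseudo_riemannian_static: "pseudo_riemannian B gb"
  unfolding pseudo_riemannian_def
proof (intro conjI ballI allI impI smooth_atlas_static)
  fix q u v assume q: "q \<in> carrier B" and u: "u \<in> tangent_space B q" and v: "v \<in> tangent_space B q"
  obtain t p where tp: "q = (t, p)" by fastforce
  have t: "t \<in> I" and "p \<in> carrier A" using q unfolding tp carrier_static by auto
  then obtain c where c: "c \<in> A" "p \<in> cdom c" unfolding carrier_def by blast
  interpret L: local_metric "img c" "G c" by (rule local_metric_chart[OF c(1)])
  have x: "cmap c p \<in> img c" using c by simp
  show "gb q u v = gb q v u"
    using u v L.G_sym[OF x] unfolding tp by (simp add: static_metric_chart[OF c t])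
  fix w a b assume w: "w \<in> tangent_space B q"
  show "gb q (\<lambda>c. a *\<^sub>R u c + b *\<^sub>R v c) w = a * gb q u w + b * gb q v w"
    using u v w total.tangent_combination[OF u v, of a b]
    unfolding tp by (simp add: static_metric_chart[OF c t] L.G_simps x algebra_simps)
next
  fix q u assume q: "q \<in> carrier B" and u: "u \<in> tangent_space B q" and z: "\<forall>v\<in>tangent_space B q. gb q u v = 0"
  obtain t p where tp: "q = (t, p)" by fastforce
  have t: "t \<in> I" and p: "p \<in> carrier A" using q unfolding tp carrier_static by auto
  then obtain c where c: "c \<in> A" "p \<in> cdom c" unfolding carrier_def by blast
  interpret L: local_metric "img c" "G c" by (rule local_metric_chart[OF c(1)])
  have x: "cmap c p \<in> img c" using c by simp
  have m: "product_chart c \<in> B" "(t, p) \<in> cdom (product_chart c)" using c t pch_in by auto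
  have e: "- (f p)\<^sup>2 * fst (u (product_chart c)) * b + G c (cmap c p) (snd (u (product_chart c))) w = 0" for b w
    using z static_metric_chart[OF c t u[unfolded tp] total.coord_field_tangent[OF m, of "(b, w)"]]
      total.coord_field_tangent[OF m, of "(b, w)"] total.coord_field_self[OF m, of "(b, w)"]
    unfolding tp by simp
  \<comment> \<open>Testing against the time direction leaves - f^2 times the time component; here
    positivity of \<open>f\<close> gives nondegeneracy.\<close>
  have "fst (u (product_chart c)) = 0" using e[of 1 0] pos[OF p] by (simp add: L.G_simps x)
  moreover have "snd (u (product_chart c)) = 0" using e[of 0] by (intro L.G_nondeg[OF x]) simp
  ultimately have "u (product_chart c) = 0" by (simp add: prod_eq_iff)
  then show "u = (\<lambda>_. 0)"
    using total.tangent_eqI[OF m u[unfolded tp] total.zero_tangent] by simp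
next
  fix d U V assume "d \<in> B"
  then obtain c where c: "c \<in> A" and d: "d = product_chart c" unfolding B_eq by blast
  interpret L: local_metric "img c" "G c" by (rule local_metric_chart[OF c])
  have o: "open (I \<times> img c)" using open_I open_img[OF c] by (simp add: open_Times)
  have F: "smooth_on (img c) (f \<circ> cinv c)" using f c unfolding smooth_function_def by blast
  show "smooth_on (cmap d ` cdom d) (\<lambda>x. metric_rep B gb d x U V)"
    unfolding d cdom_pch image_cmap_pch
  proof (rule smooth_on_cong[OF o])
    have s: "smooth_on (I \<times> img c) (\<lambda>y. h (snd y))" if "smooth_on (img c) h" for h :: "'e \<Rightarrow> real"
      by (rule smooth_on_compose[OF o open_img[OF c] _ that smooth_on_bounded_linear[OF bounded_linear_snd]]) auto
    show "smooth_on (I \<times> img c) (\<lambda>y. ((f \<circ> cinv c) (snd y) * (f \<circ> cinv c) (snd y)) * (- fst U * fst V)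
        + G c (snd y) (snd U) (snd V))"
      by (intro smooth_on_add[OF o] smooth_on_bilinear[OF o bounded_bilinear_mult] s[OF F] smooth_on_const
          s[OF L.G_smooth])
  qed (auto simp: static_metric_rep[OF c] power2_eq_square)
qed

interpretation total: pr_manifold B gb
  by standard (rule pseudo_riemannian_static)

lemma local_static_chart:
  assumes c: "c \<in> A"
  shows "local_static (img c) (G c) I (metric_rep B gb (product_chart c)) (f \<circ> cinv c)"
proof -
  interpret L: local_metric "img c" "G c" by (rule local_metric_chart[OF c])
  interpret P: local_metric "I \<times> img c" "metric_rep B gb (product_chart c)"
    using total.local_metric_chart[OF pch_in[OF c]] by (simp add: image_cmap_pch)
  show ?thesis
  proof
    show "smooth_on (img c) (f \<circ> cinv c)" using f c unfolding smooth_function_def by blast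
    show "0 < (f \<circ> cinv c) x" if "x \<in> img c" for x
      using pos carrierI[OF c cinv_in[OF c that]] by simp
  qed (auto simp: open_I static_metric_rep[OF c])
qed

lemma concircularly_flat_static_iff:
  "concircularly_flat B gb \<longleftrightarrow> (\<forall>t\<in>I. \<forall>c\<in>A. \<forall>p\<in>cdom c.
     (\<forall>u. nabla_gradient_rep (G c) (f \<circ> cinv c) (cmap c p) u
       = - (scalar_curvature B gb (t, p) / (real DIM('e) * (real DIM('e) + 1)) * f p) *\<^sub>R u) \<and>
     (\<forall>u v w. riemann_rep (G c) (cmap c p) u v w
       = (scalar_curvature B gb (t, p) / (real DIM('e) * (real DIM('e) + 1))) *\<^sub>R
         (G c (cmap c p) u w *\<^sub>R v - G c (cmap c p) v w *\<^sub>R u)))"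
proof -
  let ?k = "\<lambda>q. scalar_curvature B gb q / (real DIM('e) * (real DIM('e) + 1))"
  \<comment> \<open>The product has dimension m = n + 1, so m (m - 1) = n (n + 1).\<close>
  have dim: "real DIM(real \<times> 'e) * (real DIM(real \<times> 'e) - 1) = real DIM('e) * (real DIM('e) + 1)"
    by (simp add: algebra_simps)
  have iff: "(\<forall>U V W. riemann_rep (metric_rep B gb (product_chart c)) (cmap (product_chart c) (t, p)) U V W
        = ?k (t, p) *\<^sub>R (metric_rep B gb (product_chart c) (cmap (product_chart c) (t, p)) U W *\<^sub>R V
          - metric_rep B gb (product_chart c) (cmap (product_chart c) (t, p)) V W *\<^sub>R U)) \<longleftrightarrow>
      (\<forall>u. nabla_gradient_rep (G c) (f \<circ> cinv c) (cmap c p) u = - (?k (t, p) * f p) *\<^sub>R u) \<and>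
      (\<forall>u v w. riemann_rep (G c) (cmap c p) u v w = ?k (t, p) *\<^sub>R
         (G c (cmap c p) u w *\<^sub>R v - G c (cmap c p) v w *\<^sub>R u))"
    if t: "t \<in> I" and c: "c \<in> A" and p: "p \<in> cdom c" for t c p
  proof -
    interpret local_static "img c" "G c" I "metric_rep B gb (product_chart c)" "f \<circ> cinv c"
      by (rule local_static_chart[OF c])
    have "cmap c p \<in> img c" using p by simp
    from static_space_form_iff[OF t this, of "?k (t, p)"] show ?thesis
      by (simp add: cinv_cmap[OF c p])
  qed
  have "concircularly_flat B gb \<longleftrightarrow> (\<forall>c\<in>A. \<forall>t\<in>I. \<forall>p\<in>cdom c. \<forall>U V W.
      riemann_rep (metric_rep B gb (product_chart c)) (cmap (product_chart c) (t, p)) U V W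
        = ?k (t, p) *\<^sub>R (metric_rep B gb (product_chart c) (cmap (product_chart c) (t, p)) U W *\<^sub>R V
          - metric_rep B gb (product_chart c) (cmap (product_chart c) (t, p)) V W *\<^sub>R U))"
  proof -
    have charts: "(\<forall>d\<in>B. P d) \<longleftrightarrow> (\<forall>c\<in>A. P (product_chart c))" for P unfolding B_eq by blast
    have points: "(\<forall>q\<in>I \<times> D. P q) \<longleftrightarrow> (\<forall>t\<in>I. \<forall>p\<in>D. P (t, p))" for D :: "'a set" and P by blast
    show ?thesis unfolding total.concircularly_flat_iff dim charts cdom_pch points ..
  qed
  also have "\<dots> \<longleftrightarrow> (\<forall>t\<in>I. \<forall>c\<in>A. \<forall>p\<in>cdom c.
      (\<forall>u. nabla_gradient_rep (G c) (f \<circ> cinv c) (cmap c p) u = - (?k (t, p) * f p) *\<^sub>R u) \<and>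
      (\<forall>u v w. riemann_rep (G c) (cmap c p) u v w = ?k (t, p) *\<^sub>R
         (G c (cmap c p) u w *\<^sub>R v - G c (cmap c p) v w *\<^sub>R u)))"
    using iff by blast
  finally show ?thesis .
qed

text \<open>At fixed \<open>p\<close> the Hessian equation compares two instants, and dividing by
  \<open>f p\<close> gives independence of time. In a chart the derivative of \<open>k\<close> along
  the base is zero, so \<open>k\<close> is constant on coordinate balls; connectedness makes the
  local constants agree.\<close>

lemma curvature_constant:
  assumes dim: "DIM('e) \<ge> 2" and conn: "connected (carrier A)" and t0: "t0 \<in> I"
    and flat: "\<And>t c p. t \<in> I \<Longrightarrow> c \<in> A \<Longrightarrow> p \<in> cdom c \<Longrightarrow>
      (\<forall>u. nabla_gradient_rep (G c) (f \<circ> cinv c) (cmap c p) u = - (k (t, p) * f p) *\<^sub>R u) \<and>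
      (\<forall>u v w. riemann_rep (G c) (cmap c p) u v w = k (t, p) *\<^sub>R
         (G c (cmap c p) u w *\<^sub>R v - G c (cmap c p) v w *\<^sub>R u))"
  shows "\<exists>\<kappa>. \<forall>t\<in>I. \<forall>p\<in>carrier A. k (t, p) = \<kappa>"
proof -
  have time: "k (t, p) = k (t0, p)" if t: "t \<in> I" and p: "p \<in> carrier A" for t p
  proof -
    obtain c where c: "c \<in> A" "p \<in> cdom c" using p unfolding carrier_def by blast
    obtain b :: 'e where b: "b \<in> Basis" using nonempty_Basis by blast
    have "- (k (t, p) * f p) *\<^sub>R b = - (k (t0, p) * f p) *\<^sub>R b"
      by (rule trans[OF sym[OF flat[OF t c, THEN conjunct1, THEN spec]] flat[OF t0 c, THEN conjunct1, THEN spec]])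
    then show ?thesis using pos[OF p] nonzero_Basis[OF b] by simp
  qed
  have loc: "\<exists>U. open U \<and> p \<in> U \<and> (\<forall>q\<in>U. k (t0, q) = k (t0, p))" if p: "p \<in> carrier A" for p
  proof -
    obtain c where c: "c \<in> A" "p \<in> cdom c" using p unfolding carrier_def by blast
    interpret local_static "img c" "G c" I "metric_rep B gb (product_chart c)" "f \<circ> cinv c"
      by (rule local_static_chart[OF c(1)])
    let ?K = "\<lambda>x. k (t0, cinv c x)"
    have fl: "(\<forall>u. nabla_gradient_rep (G c) (f \<circ> cinv c) x u = - (?K x * (f \<circ> cinv c) x) *\<^sub>R u) \<and>
      (\<forall>u v w. riemann_rep (G c) x u v w = ?K x *\<^sub>R (G c x u w *\<^sub>R v - G c x v w *\<^sub>R u))" if "x \<in> img c" for x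
      using flat[OF t0 c(1) cinv_in[OF c(1) that]] cmap_cinv[OF c(1) that] by simp
    have K': "(?K has_derivative (\<lambda>_. 0)) (at x)" if x: "x \<in> img c" for x
    proof (rule base.constant_if_space_form[OF dim F _ _ _ x])
      show "hessian_rep (G c) (f \<circ> cinv c) x u v = - (?K x * (f \<circ> cinv c) x) * G c x u v" if "x \<in> img c" for x u v
        using base.G_covgrad[OF that F, of u v] fl[OF that] by (simp add: base.G_simps that)
    qed (use fl pos carrierI[OF c(1)] cinv_in[OF c(1)] in auto)
    have "cmap c p \<in> img c" using c by simp
    then obtain r where r: "r > 0" "ball (cmap c p) r \<subseteq> img c"
      using open_img[OF c(1)] open_contains_ball by blast
    have K: "?K x = ?K (cmap c p)" if "x \<in> ball (cmap c p) r" for x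
      by (rule has_derivative_zero_unique[OF convex_ball _ that])
        (use r in \<open>auto intro!: has_derivative_at_withinI K' subsetD[OF r(2)]\<close>)
    have "continuous_on (cdom c) (cmap c)"
      using atlas c unfolding smooth_atlas_def homeomorphism_def by blast
    then have "open (cdom c \<inter> cmap c -` ball (cmap c p) r)"
      by (rule continuous_open_preimage[OF _ open_cdom[OF c(1)] open_ball])
    moreover have "k (t0, q) = k (t0, p)" if "q \<in> cdom c \<inter> cmap c -` ball (cmap c p) r" for q
      using K[of "cmap c q"] that cinv_cmap[OF c(1), of q] cinv_cmap[OF c] by simp
    moreover have "p \<in> cdom c \<inter> cmap c -` ball (cmap c p) r" using c r(1) by simp
    ultimately show ?thesis
      by (intro exI[of _ "cdom c \<inter> cmap c -` ball (cmap c p) r"] conjI ballI)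
  qed
  have "k (t0, p) = k (t0, q)" if "p \<in> carrier A" "q \<in> carrier A" for p q
  proof (rule connected_local_const[OF conn that])
    show "\<forall>p\<in>carrier A. eventually (\<lambda>q. k (t0, p) = k (t0, q)) (at p within carrier A)"
    proof
      fix p assume "p \<in> carrier A"
      then obtain U where U: "open U" "p \<in> U" "\<And>q. q \<in> U \<Longrightarrow> k (t0, q) = k (t0, p)"
        using loc by metis
      then show "eventually (\<lambda>q. k (t0, p) = k (t0, q)) (at p within carrier A)"
        unfolding eventually_at_topological
        by (intro exI[of _ U] conjI ballI impI U(1,2)) (rule U(3)[symmetric])
    qed
  qed
  note const = this
  \<comment> \<open>On an empty manifold any \<open>\<kappa>\<close> will do; otherwise the value at
    a reference point is taken.\<close>
  show ?thesis
  proof (cases "carrier A = {}")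
    case False
    then obtain p0 where p0: "p0 \<in> carrier A" by blast
    show ?thesis
      by (intro exI[of _ "k (t0, p0)"] ballI) (rule trans[OF time const[OF _ p0]])
  qed simp
qed

text \<open>The single \<open>\<kappa>\<close> is what separates the right side from the pointwise
  criterion. From left to right it comes from \<open>curvature_constant\<close>; from right to left
  it is replaced by \<open>k (t, p)\<close> point by point. The instant \<open>t0\<close> gives
  access to the conditions on the base, which are free of time.\<close>

lemma static_concircularly_flat_iff:
  assumes dim: "DIM('e) \<ge> 2" and conn: "connected (carrier A)" and "I \<noteq> {}"
    and k: "k = (\<lambda>q. scalar_curvature B gb q / (real DIM('e) * (real DIM('e) + 1)))"
  shows "concircularly_flat B gb \<longleftrightarrow>
    (\<forall>X. vector_field A X \<longrightarrow> (\<forall>t\<in>I. \<forall>p\<in>carrier A.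
        nabla A g X (gradient A g f) p = (\<lambda>c. - (k (t, p) * f p) *\<^sub>R X p c))) \<and>
    (\<exists>\<kappa>. (\<forall>t\<in>I. \<forall>p\<in>carrier A. \<kappa> = k (t, p)) \<and> constant_sectional_curvature A g \<kappa>)"
    (is "?L \<longleftrightarrow> ?H \<and> ?C")
proof -
  obtain t0 where t0: "t0 \<in> I" using \<open>I \<noteq> {}\<close> by blast
  let ?h = "\<lambda>t c p. \<forall>u. nabla_gradient_rep (G c) (f \<circ> cinv c) (cmap c p) u = - (k (t, p) * f p) *\<^sub>R u"
  let ?r = "\<lambda>\<kappa> c p. \<forall>u v w. riemann_rep (G c) (cmap c p) u v w
    = \<kappa> *\<^sub>R (G c (cmap c p) u w *\<^sub>R v - G c (cmap c p) v w *\<^sub>R u)"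
  have H: "?H \<longleftrightarrow> (\<forall>t\<in>I. \<forall>c\<in>A. \<forall>p\<in>cdom c. ?h t c p)"
    by (rule hessian_condition_iff[OF f])
  have L: "?L \<longleftrightarrow> (\<forall>t\<in>I. \<forall>c\<in>A. \<forall>p\<in>cdom c. ?h t c p \<and> ?r (k (t, p)) c p)"
    unfolding concircularly_flat_static_iff k ..
  show ?thesis
  proof
    assume ?L
    then have flat: "?h t c p \<and> ?r (k (t, p)) c p" if "t \<in> I" "c \<in> A" "p \<in> cdom c" for t c p
      using that unfolding L by blast
    obtain \<kappa> where \<kappa>: "\<And>t p. t \<in> I \<Longrightarrow> p \<in> carrier A \<Longrightarrow> k (t, p) = \<kappa>"
      using curvature_constant[OF dim conn t0 flat] by blast
    have "?r \<kappa> c p" if "c \<in> A" "p \<in> cdom c" for c p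
      using flat[OF t0 that] \<kappa>[OF t0 carrierI[OF that]] by simp
    then have "constant_sectional_curvature A g \<kappa>"
      unfolding constant_sectional_curvature_iff[OF dim] by blast
    then have ?C using \<kappa> by (intro exI[of _ \<kappa>]) simp
    moreover have ?H unfolding H by (intro ballI conjunct1[OF flat])
    ultimately show "?H \<and> ?C" by blast
  next
    assume HC: "?H \<and> ?C"
    then obtain \<kappa> where \<kappa>: "\<And>t p. t \<in> I \<Longrightarrow> p \<in> carrier A \<Longrightarrow> \<kappa> = k (t, p)" and "constant_sectional_curvature A g \<kappa>"
      by blast
    then have "?r \<kappa> c p" if "c \<in> A" "p \<in> cdom c" for c p
      using that unfolding constant_sectional_curvature_iff[OF dim] by blast
    then have "?r (k (t, p)) c p" if "t \<in> I" "c \<in> A" "p \<in> cdom c" for t c p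
      using \<kappa>[OF that(1) carrierI[OF that(2,3)]] that by simp
    then show ?L unfolding L using HC unfolding H by blast
  qed
qed

end

text \<open>\<open>\<tau>\<close> is a function on the product, so condition (2) contains two
  assertions: the scaled scalar curvature is one number \<open>\<kappa>\<close> at all points, and
  this number is the sectional curvature of the base.\<close>

theorem proposition9:
  fixes A :: "('a::{t2_space,second_countable_topology}, 'e::euclidean_space) chart set"
    and g :: "('a, 'e) metric"
    and f :: "'a \<Rightarrow> real"
    and I :: "real set"
    and n :: nat
    and \<tau> :: "real \<times> 'a \<Rightarrow> real"
  assumes "pseudo_riemannian A g"
    and "connected (carrier A)"
    and "n = DIM('e)" and "n \<ge> 3"
    and "open I" and "is_interval I" and "I \<noteq> {}"
    and "smooth_function A f" and "\<forall>p\<in>carrier A. f p > 0"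
    and "\<tau> = scalar_curvature (static_atlas I A) (static_metric I A g f)"
  shows "concircularly_flat (static_atlas I A) (static_metric I A g f) \<longleftrightarrow>
    (\<forall>X. vector_field A X \<longrightarrow>
       (\<forall>t\<in>I. \<forall>p\<in>carrier A.
          nabla A g X (gradient A g f) p =
            (\<lambda>c. - (\<tau> (t, p) * f p / (real n * (real n + 1))) *\<^sub>R X p c))) \<and>
    (\<exists>\<kappa>. (\<forall>t\<in>I. \<forall>p\<in>carrier A. \<kappa> = \<tau> (t, p) / (real n * (real n + 1))) \<and>
       constant_sectional_curvature A g \<kappa>)"
proof -
  interpret static_manifold A g I f
    using assms by unfold_locales (auto simp: pseudo_riemannian_def)
  have "DIM('e) \<ge> 2" using assms(3,4) by simp
  from static_concircularly_flat_iff[OF this assms(2,7) refl] show ?thesis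
    unfolding assms(3,10) times_divide_eq_left .
qed

end
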